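(* Let $E$ be a countable Borel equivalence relation on a standard Borel space $X$. If $E$ admits a locally finite Borel graphing $G$ each of whose connected components (with its path metric) is a quasi-tree, then $E$ is Borel treeable.
   Context: A countable Borel equivalence relation (CBER) $E$ on a standard Borel space $X$ is an equivalence relation that is a Borel subset of $X^2$ with every class countable. A graph on $X$ is a symmetric irreflexive relation $G\subseteq X^2$; it is locally finite if every vertex has finitely many neighbors. A Borel graphing of $E$ is a graph $G \subseteq X^2$ that is Borel and whose connectedness relation is exactly $E$. $E$ is (Borel) treeable if it has a Borel graphing that is acyclic (each component is a tree). Connected graphs are viewed as metric spaces via the path metric. A map $f:X\to Y$ of metric spaces is a quasi-isometry if there are $g:Y\to X$ and a constant $K<\infty$ with $d(f(x),f(x'))\le K d(x,x')+K$, $d(g(y),g(y'))\le K d(y,y')+K$, $d(x,g(f(x)))\le K$, $d(y,f(g(y)))\le K$ for all $x,x'\in X$, $y,y'\in Y$. A quasi-tree is a metric space (here, a connected graph) quasi-isometric to a (graph-theoretic) tree. The quasi-isometries and constants may depend on the component, and no Borelness of them is assumed. *)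

theory Defs
  imports "HOL-Analysis.Analysis"
begin

section \<open>Standard Borel spaces\<close>

text \<open>
  Only \<open>space M\<close> and \<open>sets M\<close> matter; the measure carried by \<open>M\<close> is ignored. For completely
  metrizable topologies, second countability is the same as separability, so the topology
  below is Polish.
\<close>

definition standard_borel :: "'a measure \<Rightarrow> bool" where
  "standard_borel M \<longleftrightarrow>
     (\<exists>T. topspace T = space M \<and> completely_metrizable_space T \<and> second_countable T \<and>
          sets M = sigma_sets (topspace T) {U. openin T U})"

definition cber :: "'a measure \<Rightarrow> ('a \<times> 'a) set \<Rightarrow> bool" where
  "cber M E \<longleftrightarrow>
     equiv (space M) E \<and> E \<in> sets (M \<Otimes>\<^sub>M M) \<and> (\<forall>x\<in>space M. countable (E `` {x}))"


section \<open>Graphs as relations\<close>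

definition graph_on :: "'a set \<Rightarrow> ('a \<times> 'a) set \<Rightarrow> bool" where
  "graph_on V G \<longleftrightarrow> G \<subseteq> V \<times> V \<and> sym G \<and> irrefl G"

definition locally_finite :: "'a set \<Rightarrow> ('a \<times> 'a) set \<Rightarrow> bool" where
  "locally_finite V G \<longleftrightarrow> (\<forall>x\<in>V. finite (G `` {x}))"

definition connected_graph :: "'a set \<Rightarrow> ('a \<times> 'a) set \<Rightarrow> bool" where
  "connected_graph V G \<longleftrightarrow> graph_on V G \<and> (\<forall>x\<in>V. \<forall>y\<in>V. (x, y) \<in> G\<^sup>*)"

text \<open>
  A simple cycle, listed without repeating its first vertex. Edges occur in both
  orientations, so the length bound rules out going back and forth along one edge.
\<close>

definition graph_cycle :: "('a \<times> 'a) set \<Rightarrow> 'a list \<Rightarrow> bool" where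
  "graph_cycle G p \<longleftrightarrow>
     3 \<le> length p \<and> distinct p \<and>
     (\<forall>i<length p. (p ! i, p ! (Suc i mod length p)) \<in> G)"

definition acyclic_graph :: "('a \<times> 'a) set \<Rightarrow> bool" where
  "acyclic_graph G \<longleftrightarrow> (\<nexists>p. graph_cycle G p)"

definition tree_graph :: "'a set \<Rightarrow> ('a \<times> 'a) set \<Rightarrow> bool" where
  "tree_graph V G \<longleftrightarrow> connected_graph V G \<and> acyclic_graph G"

definition component :: "('a \<times> 'a) set \<Rightarrow> 'a \<Rightarrow> 'a set" where
  "component G x = G\<^sup>* `` {x}"

definition induced_graph :: "('a \<times> 'a) set \<Rightarrow> 'a set \<Rightarrow> ('a \<times> 'a) set" where
  "induced_graph G V = G \<inter> V \<times> V"

text \<open>The path metric; its value is meaningful only for vertices joined by a path.\<close>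

definition path_dist :: "('a \<times> 'a) set \<Rightarrow> 'a \<Rightarrow> 'a \<Rightarrow> real" where
  "path_dist G x y = real (LEAST n. (x, y) \<in> G ^^ n)"

lemma sym_relpow_iff:
  assumes "sym G"
  shows "(x, y) \<in> G ^^ n \<longleftrightarrow> (y, x) \<in> G ^^ n"
proof -
  have *: "(y, x) \<in> G ^^ n" if "(x, y) \<in> G ^^ n" for x y
    using that
  proof (induction n arbitrary: y)
    case 0
    then show ?case by simp
  next
    case (Suc n)
    then obtain z where "(x, z) \<in> G ^^ n" "(z, y) \<in> G" by auto
    with Suc.IH assms have "(y, z) \<in> G" "(z, x) \<in> G ^^ n" by (auto dest: symD)
    then show ?case by (rule relpow_Suc_I2)
  qed
  show ?thesis by (blast intro: *)
qed

lemma Metric_space_path_dist: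
  assumes "connected_graph V G"
  shows "Metric_space V (path_dist G)"
proof
  have sym: "sym G" using assms by (simp add: connected_graph_def graph_on_def)
  have attained: "(x, y) \<in> G ^^ (LEAST n. (x, y) \<in> G ^^ n)" if "x \<in> V" "y \<in> V" for x y
  proof -
    have "(x, y) \<in> G\<^sup>*" using that assms by (simp add: connected_graph_def)
    then have "\<exists>n. (x, y) \<in> G ^^ n" by (simp add: rtrancl_power)
    then show ?thesis by (rule LeastI_ex)
  qed
  fix x y z
  show "0 \<le> path_dist G x y" by (simp add: path_dist_def)
  show "path_dist G x y = path_dist G y x"
    unfolding path_dist_def using sym_relpow_iff[OF sym, of x y] by simp
  show "path_dist G x y = 0 \<longleftrightarrow> x = y" if "x \<in> V" "y \<in> V"
  proof
    assume "path_dist G x y = 0"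
    with attained[OF that] show "x = y" by (simp add: path_dist_def)
  next
    assume "x = y"
    then show "path_dist G x y = 0" by (simp add: path_dist_def Least_eq_0)
  qed
  show "path_dist G x z \<le> path_dist G x y + path_dist G y z"
    if "x \<in> V" "y \<in> V" "z \<in> V"
  proof -
    have "(x, z) \<in> G ^^ ((LEAST n. (x, y) \<in> G ^^ n) + (LEAST n. (y, z) \<in> G ^^ n))"
      using attained[OF that(1,2)] attained[OF that(2,3)] by (auto simp: relpow_add)
    then show ?thesis
      unfolding path_dist_def of_nat_add[symmetric] of_nat_le_iff by (rule Least_le)
  qed
qed

lemma connected_graph_component:
  assumes "graph_on V G"
  shows "connected_graph (component G x) (induced_graph G (component G x))"
proof -
  let ?C = "component G x"
  let ?H = "induced_graph G ?C"
  have sym: "sym G" and irr: "irrefl G" using assms by (auto simp: graph_on_def)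
  have H: "graph_on ?C ?H"
    using sym irr by (auto simp: graph_on_def induced_graph_def sym_def irrefl_def)
  have from_x: "(x, y) \<in> ?H\<^sup>*" if "(x, y) \<in> G\<^sup>*" for y
    using that
  proof (induction rule: rtrancl_induct)
    case base
    show ?case by simp
  next
    case (step y z)
    then have "(y, z) \<in> ?H"
      by (auto simp: induced_graph_def component_def intro: rtrancl_into_rtrancl)
    with step.IH show ?case by (rule rtrancl_into_rtrancl)
  qed
  have "sym (?H\<^sup>*)" using H by (simp add: graph_on_def sym_rtrancl)
  then have "(y, z) \<in> ?H\<^sup>*" if "y \<in> ?C" "z \<in> ?C" for y z
    using that from_x[of y] from_x[of z]
    by (auto simp: component_def dest: symD intro: rtrancl_trans)
  with H show ?thesis by (simp add: connected_graph_def)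
qed


section \<open>Quasi-isometries and quasi-trees\<close>

definition quasi_isometry_on ::
  "'a set \<Rightarrow> ('a \<Rightarrow> 'a \<Rightarrow> real) \<Rightarrow> 'b set \<Rightarrow> ('b \<Rightarrow> 'b \<Rightarrow> real) \<Rightarrow> ('a \<Rightarrow> 'b) \<Rightarrow> bool" where
  "quasi_isometry_on X dX Y dY f \<longleftrightarrow>
     f \<in> X \<rightarrow> Y \<and>
     (\<exists>g K. g \<in> Y \<rightarrow> X \<and>
        (\<forall>x\<in>X. \<forall>x'\<in>X. dY (f x) (f x') \<le> K * dX x x' + K) \<and>
        (\<forall>y\<in>Y. \<forall>y'\<in>Y. dX (g y) (g y') \<le> K * dY y y' + K) \<and>
        (\<forall>x\<in>X. dX x (g (f x)) \<le> K) \<and>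
        (\<forall>y\<in>Y. dY y (f (g y)) \<le> K))"

text \<open>
  HOL cannot quantify over types inside a formula, so the type of the vertices of the tree is
  a parameter. In a theorem assuming \<open>quasi_tree TYPE('b) V G\<close> with \<open>'b\<close> a free type variable,
  trees on vertex sets of any type are allowed.
\<close>

definition quasi_tree :: "'b itself \<Rightarrow> 'a set \<Rightarrow> ('a \<times> 'a) set \<Rightarrow> bool" where
  "quasi_tree _ V G \<longleftrightarrow>
     connected_graph V G \<and>
     (\<exists>(W :: 'b set) T f. tree_graph W T \<and> quasi_isometry_on V (path_dist G) W (path_dist T) f)"


section \<open>Borel graphings and treeability\<close>

definition borel_graphing :: "'a measure \<Rightarrow> ('a \<times> 'a) set \<Rightarrow> ('a \<times> 'a) set \<Rightarrow> bool" where
  "borel_graphing M E G \<longleftrightarrow>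
     graph_on (space M) G \<and> G \<in> sets (M \<Otimes>\<^sub>M M) \<and> G\<^sup>* \<inter> space M \<times> space M = E"

definition borel_treeable :: "'a measure \<Rightarrow> ('a \<times> 'a) set \<Rightarrow> bool" where
  "borel_treeable M E \<longleftrightarrow> (\<exists>T. borel_graphing M E T \<and> acyclic_graph T)"

end

theory Submission
  imports Defs
begin

text \<open>
  Fix a component, a quasi-isometry to a tree and a large radius \<open>R\<close>. Removing a ball of radius \<open>R\<close>
  splits the component into finitely many pieces, and each piece with its complement is a wall. Only
  finitely many walls separate two given points, walls around disjoint balls are nested, and by
  comparison with the tree the number of walls separating two points tends to infinity with their
  distance. The consistent orientations of the walls that differ finitely from the one pointing
  towards a vertex form a partial cube (the median graph dual to the walls).

  Colour the walls with natural numbers so that walls of the same colour are nested. Among the edges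
  of the cube crossing a given wall \<open>A\<close>, identify those which agree on all other walls whose colour is
  at least that of \<open>A\<close>, and keep one edge from each class. The result is a spanning tree of the cube.
  Contracting the Voronoi cells of the vertices of the component in this tree, with ties broken by
  a Borel linear order, yields a tree on the component.

  All choices are definable with quantifiers over the countable component. They are Borel
  because a locally finite Borel graph is a countable union of graphs of Borel functions, which rests
  on the theorem that a finite-to-one Borel projection has a Borel image. The latter is derived from
  Novikov's separation theorem in the Baire space.
\<close>

section \<open>Borel sets as injective images of closed sets in the Baire space\<close>

text \<open>Quasi-isometries need not be Borel, so they may only serve to show that enough walls
  exist. The construction itself uses \<open>wide C G R\<close>, which speaks of finite lists of
  vertices alone. The least such \<open>R\<close> is Borel and constant on components, which cuts
  the space into countably many invariant Borel pieces of fixed radius. Walls around overlapping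
  balls may cross, so the cube is in general no tree and edges must be discarded. The choice must
  not depend on a base point of the component: hence each wall gets a canonical centre, from which
  orientations are numbered. The resulting tree lives on orientations, not on points. It can be
  brought back because \<open>wide\<close> makes the points proper in the cube: only finitely many
  lie within a given distance of a vertex, so ties between nearest points are finite and a linear
  order settles them, even if it is no well-order. Finite sections suffice for the projection
  theorem because a vertex has finitely many neighbours; the countable component is then reached by
  composing the functions that choose neighbours.\<close>

definition agree :: "nat \<Rightarrow> (nat \<Rightarrow> nat) \<Rightarrow> (nat \<Rightarrow> nat) \<Rightarrow> bool" where
  "agree n s t \<longleftrightarrow> (\<forall>i<n. s i = t i)"

text \<open>The product topology is handled through initial segments: the \<open>t\<close> with
  \<open>agree n s t\<close> form a basic clopen neighbourhood of \<open>s\<close>.\<close>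

definition bclosed :: "(nat \<Rightarrow> nat) set \<Rightarrow> bool" where
  "bclosed F \<longleftrightarrow> (\<forall>s. (\<forall>n. \<exists>t\<in>F. agree n s t) \<longrightarrow> s \<in> F)"

definition bcont :: "(nat \<Rightarrow> nat) set \<Rightarrow> ((nat \<Rightarrow> nat) \<Rightarrow> (nat \<Rightarrow> nat)) \<Rightarrow> bool" where
  "bcont F h \<longleftrightarrow> (\<forall>s\<in>F. \<forall>n. \<exists>m. \<forall>t\<in>F. agree m s t \<longrightarrow> agree n (h s) (h t))"

abbreviation baire :: "(nat \<Rightarrow> nat) measure" where
  "baire \<equiv> Pi\<^sub>M UNIV (\<lambda>_. count_space UNIV)"

lemma agree_mono: "agree m s t \<Longrightarrow> n \<le> m \<Longrightarrow> agree n s t"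
  by (auto simp: agree_def)

lemma bclosedD: "bclosed F \<Longrightarrow> (\<And>n. \<exists>t\<in>F. agree n s t) \<Longrightarrow> s \<in> F"
  by (auto simp: bclosed_def)

lemma bcontD: "bcont F h \<Longrightarrow> s \<in> F \<Longrightarrow> \<exists>m. \<forall>t\<in>F. agree m s t \<longrightarrow> agree n (h s) (h t)"
  by (auto simp: bcont_def)

lemma measurable_baire_coord [measurable]: "(\<lambda>s. s i) \<in> baire \<rightarrow>\<^sub>M count_space UNIV"
  by measurable

lemma space_baire [simp]: "space baire = UNIV"
  by (simp add: space_PiM PiE_def)

text \<open>Injectivity is kept for the sake of fibres: a map that is finite-to-one on
  \<open>A\<close> remains so after composition with \<open>h\<close>, and the image theorem for
  closed sets then covers Borel sets.\<close>

definition injrep :: "(nat \<Rightarrow> nat) set \<Rightarrow> bool" where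
  "injrep A \<longleftrightarrow> (\<exists>F h. bclosed F \<and> bcont F h \<and> inj_on h F \<and> h ` F = A)"

lemma injrep_clopen: "injrep {s. s i \<in> K}"
  unfolding injrep_def
proof (intro exI conjI)
  show "bclosed {s. s i \<in> K}"
    unfolding bclosed_def agree_def by (metis lessI mem_Collect_eq)
  show "bcont {s. s i \<in> K} id" by (auto simp: bcont_def)
qed auto

text \<open>The first coordinate names the piece, the remaining ones give a point of its closed set.
  Disjointness is what keeps the parametrisation injective across pieces.\<close>

lemma injrep_disjoint_UN:
  fixes A :: "nat \<Rightarrow> (nat \<Rightarrow> nat) set"
  assumes A: "\<And>n. injrep (A n)" and disj: "\<And>m n. m \<noteq> n \<Longrightarrow> A m \<inter> A n = {}"
  shows "injrep (\<Union>n. A n)"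
proof -
  obtain F h where F: "\<And>n. bclosed (F n)" and h: "\<And>n. bcont (F n) (h n)"
    and inj: "\<And>n. inj_on (h n) (F n)" and im: "\<And>n. h n ` F n = A n"
    using A unfolding injrep_def by metis
  define tl where "tl s = (\<lambda>k. s (Suc k))" for s :: "nat \<Rightarrow> nat"
  have agree_tl: "agree (Suc n) s t \<Longrightarrow> s 0 = t 0 \<and> agree n (tl s) (tl t)" for n s t
    by (auto simp: agree_def tl_def)
  define F' where "F' = {s. tl s \<in> F (s 0)}"
  define h' where "h' s = h (s 0) (tl s)" for s
  have "bclosed F'"
    unfolding bclosed_def
  proof (intro allI impI)
    fix s assume *: "\<forall>n. \<exists>t\<in>F'. agree n s t"
    have "tl s \<in> F (s 0)"
    proof (rule bclosedD[OF F])
      fix n obtain t where "t \<in> F'" "agree (Suc n) s t" using * by blast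
      then show "\<exists>t\<in>F (s 0). agree n (tl s) t"
        using agree_tl[of n s t] by (auto simp: F'_def)
    qed
    then show "s \<in> F'" by (simp add: F'_def)
  qed
  moreover have "bcont F' h'"
    unfolding bcont_def
  proof (intro ballI allI)
    fix s n assume s: "s \<in> F'"
    then obtain m where m: "\<forall>t\<in>F (s 0). agree m (tl s) t \<longrightarrow> agree n (h (s 0) (tl s)) (h (s 0) t)"
      using bcontD[OF h[of "s 0"], of "tl s" n] by (auto simp: F'_def)
    show "\<exists>m. \<forall>t\<in>F'. agree m s t \<longrightarrow> agree n (h' s) (h' t)"
    proof (intro exI ballI impI)
      fix t assume "t \<in> F'" "agree (Suc m) s t"
      then show "agree n (h' s) (h' t)"
        using m agree_tl[of m s t] by (auto simp: F'_def h'_def)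
    qed
  qed
  moreover have "inj_on h' F'"
  proof (rule inj_onI)
    fix s t assume st: "s \<in> F'" "t \<in> F'" "h' s = h' t"
    have "h' u \<in> A (u 0)" if "u \<in> F'" for u
      using that im[of "u 0"] by (auto simp: F'_def h'_def)
    then have "h' s \<in> A (s 0)" "h' s \<in> A (t 0)" using st by metis+
    then have 0: "s 0 = t 0" using disj by blast
    then have "tl s = tl t" using st inj[of "s 0"] by (auto simp: F'_def h'_def inj_on_def)
    with 0 show "s = t"
      unfolding tl_def fun_eq_iff by (metis not0_implies_Suc)
  qed
  moreover have "h' ` F' = (\<Union>n. A n)"
  proof -
    have "x \<in> h' ` F'" if x: "x \<in> A n" for x n
    proof -
      obtain t where t: "t \<in> F n" "x = h n t" using x im[of n] by blast
      define s where "s = case_nat n t"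
      have "tl s = t" "s 0 = n" by (auto simp: s_def tl_def)
      then show ?thesis using t by (auto simp: F'_def h'_def image_iff intro!: bexI[of _ s])
    qed
    moreover have "h' s \<in> A (s 0)" if "s \<in> F'" for s
      using that im[of "s 0"] by (auto simp: F'_def h'_def)
    ultimately show ?thesis by blast
  qed
  ultimately show ?thesis
    unfolding injrep_def by (intro exI[of _ F'] exI[of _ h'] conjI)
qed

text \<open>A sequence is read as countably many rows through \<open>prod_encode\<close>, row
  \<open>n\<close> being a preimage under \<open>h n\<close>. That all rows have the same image is a
  closed condition by continuity, and this image determines every row.\<close>

lemma injrep_INT:
  fixes A :: "nat \<Rightarrow> (nat \<Rightarrow> nat) set"
  assumes A: "\<And>n. injrep (A n)"
  shows "injrep (\<Inter>n. A n)"
proof -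
  obtain F h where F: "\<And>n. bclosed (F n)" and h: "\<And>n. bcont (F n) (h n)"
    and inj: "\<And>n. inj_on (h n) (F n)" and im: "\<And>n. h n ` F n = A n"
    using A unfolding injrep_def by metis
  define row where "row n s = (\<lambda>k. s (prod_encode (n, k)))" for n and s :: "nat \<Rightarrow> nat"
  have agree_row: "\<exists>m. \<forall>t. agree m s t \<longrightarrow> agree l (row n s) (row n t)" for l n s
  proof (intro exI allI impI)
    fix t assume *: "agree (Suc (\<Sum>k<l. prod_encode (n, k))) s t"
    show "agree l (row n s) (row n t)"
      unfolding agree_def
    proof (intro allI impI)
      fix i assume "i < l"
      then have "prod_encode (n, i) \<le> (\<Sum>k<l. prod_encode (n, k))"
        by (intro member_le_sum) auto
      then show "row n s i = row n t i" using * by (auto simp: agree_def row_def)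
    qed
  qed
  define F' where "F' = {s. \<forall>n. row n s \<in> F n \<and> h n (row n s) = h 0 (row 0 s)}"
  define h' where "h' s = h 0 (row 0 s)" for s
  have F'D: "row n s \<in> F n" "h n (row n s) = h 0 (row 0 s)" if "s \<in> F'" for s n
    using that unfolding F'_def by blast+
  have F'I: "s \<in> F'" if "\<And>n. row n s \<in> F n" "\<And>n. h n (row n s) = h 0 (row 0 s)" for s
    using that unfolding F'_def by blast
  have cont: "\<exists>m. \<forall>t\<in>F'. agree m s t \<longrightarrow> agree l (h n (row n s)) (h n (row n t))"
    if mem: "row n s \<in> F n" for s n l
  proof -
    obtain k where k: "\<forall>t\<in>F n. agree k (row n s) t \<longrightarrow> agree l (h n (row n s)) (h n t)"
      using bcontD[OF h[of n] mem, of l] by blast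
    obtain m where "\<forall>t. agree m s t \<longrightarrow> agree k (row n s) (row n t)" using agree_row by blast
    then have "\<forall>t\<in>F'. agree m s t \<longrightarrow> agree l (h n (row n s)) (h n (row n t))"
      using k F'D(1)[of _ n] by blast
    then show ?thesis ..
  qed
  have "bclosed F'"
    unfolding bclosed_def
  proof (intro allI impI)
    fix s assume *: "\<forall>n. \<exists>t\<in>F'. agree n s t"
    have row: "row n s \<in> F n" for n
    proof (rule bclosedD[OF F])
      fix l
      obtain m where "\<forall>t. agree m s t \<longrightarrow> agree l (row n s) (row n t)" using agree_row by blast
      moreover obtain t where "t \<in> F'" "agree m s t" using * by blast
      ultimately show "\<exists>t\<in>F n. agree l (row n s) t" using F'D(1) by blast
    qed
    have "h n (row n s) = h 0 (row 0 s)" for n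
    proof
      fix i
      obtain m where m: "\<forall>t\<in>F'. agree m s t \<longrightarrow> agree (Suc i) (h n (row n s)) (h n (row n t))"
        using cont[OF row] by blast
      obtain m' where m': "\<forall>t\<in>F'. agree m' s t \<longrightarrow> agree (Suc i) (h 0 (row 0 s)) (h 0 (row 0 t))"
        using cont[OF row] by blast
      obtain t where t: "t \<in> F'" "agree (max m m') s t" using * by blast
      then have "agree m s t" "agree m' s t" by (auto simp: agree_def)
      with m m' t have "h n (row n s) i = h n (row n t) i" "h 0 (row 0 s) i = h 0 (row 0 t) i"
        by (auto simp: agree_def)
      moreover have "h n (row n t) = h 0 (row 0 t)" using t(1) by (rule F'D(2))
      ultimately show "h n (row n s) i = h 0 (row 0 s) i" by simp
    qed
    with row show "s \<in> F'" by (rule F'I)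
  qed
  moreover have "bcont F' h'"
    unfolding bcont_def h'_def
  proof (intro ballI allI)
    fix s l assume "s \<in> F'"
    then have "row 0 s \<in> F 0" by (rule F'D(1))
    from cont[OF this] show "\<exists>m. \<forall>t\<in>F'. agree m s t \<longrightarrow> agree l (h 0 (row 0 s)) (h 0 (row 0 t))" .
  qed
  moreover have "inj_on h' F'"
  proof (rule inj_onI)
    fix s t assume st: "s \<in> F'" "t \<in> F'" "h' s = h' t"
    have rows: "row n s = row n t" for n
    proof (rule inj_onD[OF inj[of n]])
      show "h n (row n s) = h n (row n t)" using st(3) F'D(2)[OF st(1), of n] F'D(2)[OF st(2), of n] unfolding h'_def by metis
      show "row n s \<in> F n" "row n t \<in> F n" using F'D(1) st(1,2) by blast+
    qed
    show "s = t"
    proof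
      fix i
      have "row (fst (prod_decode i)) s (snd (prod_decode i)) = row (fst (prod_decode i)) t (snd (prod_decode i))"
        using rows by simp
      then show "s i = t i" by (simp add: row_def)
    qed
  qed
  moreover have "h' ` F' = (\<Inter>n. A n)"
  proof
    show "h' ` F' \<subseteq> (\<Inter>n. A n)"
    proof (intro subsetI INT_I)
      fix x n assume "x \<in> h' ` F'"
      then obtain s where "s \<in> F'" "x = h' s" by blast
      then have "x = h n (row n s)" "row n s \<in> F n" using F'D(1)[of s n] F'D(2)[of s n] unfolding h'_def by metis+
      then show "x \<in> A n" using im by blast
    qed
    show "(\<Inter>n. A n) \<subseteq> h' ` F'"
    proof
      fix x assume "x \<in> (\<Inter>n. A n)"
      then have "x \<in> h n ` F n" for n using im[of n] by blast
      then have "\<forall>n. \<exists>r. r \<in> F n \<and> h n r = x" by (metis imageE)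
      then obtain r where r: "\<And>n. r n \<in> F n" "\<And>n. h n (r n) = x" by metis
      define s where "s i = (case prod_decode i of (n, k) \<Rightarrow> r n k)" for i
      have row: "row n s = r n" for n by (simp add: s_def row_def)
      have "s \<in> F'" by (rule F'I) (simp_all add: row r)
      moreover have "h' s = x" by (simp add: row r h'_def)
      ultimately show "x \<in> h' ` F'" by blast
    qed
  qed
  ultimately show ?thesis
    unfolding injrep_def by (intro exI[of _ F'] exI[of _ h'] conjI)
qed

lemma injrep_Int:
  assumes "injrep A" "injrep B"
  shows "injrep (A \<inter> B)"
proof -
  have "injrep (\<Inter>n. if n = (0::nat) then A else B)"
    by (rule injrep_INT) (use assms in simp)
  moreover have "(\<Inter>n. if n = (0::nat) then A else B) = A \<inter> B"
  proof (intro equalityI subsetI)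
    fix x assume "x \<in> (\<Inter>n. if n = (0::nat) then A else B)"
    then have "x \<in> (if n = (0::nat) then A else B)" for n by blast
    from this[of 0] this[of 1] show "x \<in> A \<inter> B" by simp
  qed auto
  ultimately show ?thesis by (simp only:)
qed

text \<open>The induction carries a set together with its complement: the step for unions first
  makes the union disjoint, and for this it intersects with the complements of the earlier
  sets.\<close>

lemma injrep_borel:
  assumes "A \<in> sets baire"
  shows "injrep A"
proof -
  have gen: "sets baire = sigma_sets UNIV {{s. s i \<in> K} |i K. True}"
    unfolding sets_PiM_single by (simp add: PiE_def)
  have "A \<in> sigma_sets UNIV {{s. s i \<in> K} |i K. True}" using assms gen by simp
  then have "injrep A \<and> injrep (- A)"
  proof induction
    case (Basic a)
    then obtain i K where a: "a = {s. s i \<in> K}" by blast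
    then have "- a = {s. s i \<in> - K}" by auto
    then show ?case using a injrep_clopen by metis
  next
    case Empty
    then show ?case using injrep_clopen[of 0 "{}"] injrep_clopen[of 0 UNIV] by simp
  next
    case (Compl a)
    then show ?case by (simp add: Compl_eq_Diff_UNIV[symmetric])
  next
    case (Union a)
    define b where "b n = a n \<inter> (\<Inter>k. if k < n then - a k else UNIV)" for n
    have U: "injrep UNIV" using injrep_clopen[of 0 UNIV] by simp
    have "injrep (b n)" for n
      unfolding b_def using Union.IH U by (intro injrep_Int injrep_INT) auto
    moreover have "b m \<inter> b n = {}" if "m \<noteq> n" for m n
    proof -
      have lt: "b i \<inter> b j = {}" if "i < j" for i j
        using that by (auto simp: b_def)
      show ?thesis using lt[of m n] lt[of n m] that by (cases "m < n") auto
    qed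
    ultimately have "injrep (\<Union>n. b n)" by (intro injrep_disjoint_UN)
    moreover have "(\<Union>n. b n) = (\<Union>n. a n)"
    proof
      show "(\<Union>n. a n) \<subseteq> (\<Union>n. b n)"
      proof
        fix x assume "x \<in> (\<Union>n. a n)"
        then obtain n where "x \<in> a n" "\<And>k. k < n \<Longrightarrow> x \<notin> a k"
          using exists_least_iff[of "\<lambda>n. x \<in> a n"] by blast
        then have "x \<in> b n" by (auto simp: b_def)
        then show "x \<in> (\<Union>n. b n)" by blast
      qed
    qed (auto simp: b_def)
    moreover have "injrep (\<Inter>n. - a n)" using Union.IH by (intro injrep_INT) auto
    ultimately show ?case by simp
  qed
  then show ?thesis ..
qed

section \<open>Novikov separation and finite-to-one images\<close>

definition novikov_sep :: "((nat \<Rightarrow> nat) \<Rightarrow> nat \<Rightarrow> nat) \<Rightarrow> (nat \<Rightarrow> (nat \<Rightarrow> nat) set) \<Rightarrow> bool" where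
  "novikov_sep p S \<longleftrightarrow> (\<exists>B. (\<forall>k. B k \<in> sets baire \<and> p ` S k \<subseteq> B k) \<and> (\<Inter>k. B k) = {})"

text \<open>The separating sets of the pieces are united in slot \<open>i\<close> and intersected in
  all others. A common point would lie in some \<open>B n i\<close>, hence in \<open>B n k\<close>
  for every \<open>k\<close>. Read backwards: failure of separation survives fixing one more
  coordinate in one slot.\<close>

lemma novikov_sep_split:
  assumes "\<And>n. novikov_sep p (S(i := S i \<inter> {s. s j = n}))"
  shows "novikov_sep p S"
proof -
  obtain B where B: "\<And>n k. B n k \<in> sets baire"
    "\<And>n k. p ` (S(i := S i \<inter> {s. s j = n})) k \<subseteq> B n k" "\<And>n. (\<Inter>k. B n k) = {}"
    using assms unfolding novikov_sep_def by metis
  define B' where "B' k = (if k = i then \<Union>n. B n i else \<Inter>n. B n k)" for k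
  have "B' k \<in> sets baire" for k using B(1) by (auto simp: B'_def)
  moreover have "p ` S k \<subseteq> B' k" for k
  proof (cases "k = i")
    case True
    have "p s \<in> B (s j) i" if "s \<in> S i" for s using B(2)[of "s j" i] that by auto
    then show ?thesis using True by (auto simp: B'_def)
  next
    case False
    then have "p ` S k \<subseteq> B n k" for n using B(2)[of n k] by simp
    then show ?thesis using False by (auto simp: B'_def)
  qed
  moreover have "(\<Inter>k. B' k) = {}"
  proof -
    have False if z: "\<And>k. z \<in> B' k" for z
    proof -
      obtain n where "z \<in> B n i" using z[of i] by (auto simp: B'_def)
      then have "z \<in> B n k" for k using z[of k] by (auto simp: B'_def split: if_splits)
      then show False using B(3)[of n] by blast
    qed
    then show ?thesis by auto
  qed
  ultimately show ?thesis unfolding novikov_sep_def by (intro exI[of _ B']) simp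
qed

lemma baire_UNIV [simp]: "UNIV \<in> sets baire"
  by (metis space_baire sets.top)

lemma baire_clopen: "{z. z c = v} \<in> sets baire"
proof -
  have "{z \<in> space baire. z c = v} \<in> sets baire" by measurable
  then show ?thesis by simp
qed

text \<open>Suppose separation fails. Fixing coordinates one by one, in all slots, keeps it failing
  and leads to a limit point \<open>x k\<close> of each \<open>S k\<close>. The images of these
  points are not all equal, so two of them differ in one coordinate, and by continuity clopen sets
  separate the family at a finite stage already.\<close>

theorem novikov:
  assumes p: "bcont F p" and S: "\<And>k. bclosed (S k)" "\<And>k. S k \<subseteq> F"
    and empty: "(\<Inter>k. p ` S k) = {}"
  shows "novikov_sep p S"
proof (rule ccontr)
  assume nsep: "\<not> novikov_sep p S"
  \<comment> \<open>At stage \<open>m\<close> the coordinates numbered below \<open>m\<close> are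
    fixed, where \<open>prod_encode (k, j)\<close> is the number of coordinate \<open>j\<close> in
    slot \<open>k\<close>.\<close>
  define C where "C m v k = S k \<inter> {s. \<forall>i<m. fst (prod_decode i) = k \<longrightarrow> s (snd (prod_decode i)) = v i}"
    for m k and v :: "nat \<Rightarrow> nat"
  have "\<exists>f. \<forall>m. \<not> novikov_sep p (C m (f m)) \<and> (\<exists>n. f (Suc m) = (f m)(m := n))"
  proof (rule dependent_nat_choice)
    have "C 0 v = S" for v by (auto simp: C_def)
    then show "\<exists>v. \<not> novikov_sep p (C 0 v)" using nsep by simp
  next
    fix v m assume nsep: "\<not> novikov_sep p (C m v)"
    obtain i j where ij: "prod_decode m = (i, j)" by fastforce
    have "C (Suc m) (v(m := n)) = (C m v)(i := C m v i \<inter> {s. s j = n})" for n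
      using ij by (intro ext) (auto simp: C_def less_Suc_eq)
    then show "\<exists>v'. \<not> novikov_sep p (C (Suc m) v') \<and> (\<exists>n. v' = v(m := n))"
      using novikov_sep_split[of p "C m v" i j] nsep by metis
  qed
  then obtain f where f: "\<And>m. \<not> novikov_sep p (C m (f m))" "\<And>m. \<exists>n. f (Suc m) = (f m)(m := n)"
    by blast
  define v where "v i = f (Suc i) i" for i
  have fv: "f m i = v i" if "i < m" for m i
    using that
  proof (induction m)
    case (Suc m)
    obtain n where "f (Suc m) = (f m)(m := n)" using f(2) by blast
    then show ?case using Suc by (cases "i = m") (auto simp: v_def)
  qed simp
  have "C m (f m) = C m v" for m using fv by (intro ext) (auto simp: C_def)
  with f(1) have nsep: "\<not> novikov_sep p (C m v)" for m by metis
  define x where "x k = (\<lambda>j. v (prod_encode (k, j)))" for k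
  \<comment> \<open>From stage \<open>M k l\<close> on, the first \<open>l\<close> coordinates of
    slot \<open>k\<close> are fixed, since the sum bounds each of their numbers.\<close>
  define M where "M k l = Suc (\<Sum>j<l. prod_encode (k, j))" for k l
  have agree: "agree l (x k) t" if t: "t \<in> C m v k" and m: "M k l \<le> m" for l k t m
    unfolding agree_def
  proof (intro allI impI)
    fix j assume "j < l"
    then have "prod_encode (k, j) \<le> (\<Sum>j<l. prod_encode (k, j))"
      by (intro member_le_sum) auto
    then have "prod_encode (k, j) < m" using m by (simp add: M_def)
    then show "x k j = t j" using t by (auto simp: C_def x_def dest!: spec[of _ "prod_encode (k, j)"])
  qed
  have nonempty: "C m v k \<noteq> {}" for m k
  proof
    assume e: "C m v k = {}"
    have "novikov_sep p (C m v)"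
      unfolding novikov_sep_def by (intro exI[of _ "\<lambda>j. if j = k then {} else UNIV"]) (use e in auto)
    then show False using nsep by blast
  qed
  have xS: "x k \<in> S k" for k
  proof (rule bclosedD[OF S(1)])
    fix n obtain t where t: "t \<in> C (M k n) v k" using nonempty by blast
    then have "t \<in> S k" by (simp add: C_def)
    moreover have "agree n (x k) t" using agree[OF t] by simp
    ultimately show "\<exists>t\<in>S k. agree n (x k) t" by blast
  qed
  obtain i where i: "p (x i) \<noteq> p (x 0)"
  proof (rule ccontr)
    assume *: "\<not> thesis"
    then have "p (x 0) = p (x i)" for i using that by metis
    then have "p (x 0) \<in> p ` S i" for i using xS[of i] by (metis imageI)
    then show False using empty by blast
  qed
  then obtain c where c: "p (x i) c \<noteq> p (x 0) c" by blast
  have "\<exists>m. \<forall>t\<in>F. agree m (x k) t \<longrightarrow> agree (Suc c) (p (x k)) (p t)" for k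
    using bcontD[OF p] xS S(2) by blast
  then obtain m where m: "\<And>k t. t \<in> F \<Longrightarrow> agree (m k) (x k) t \<Longrightarrow> p t c = p (x k) c"
    unfolding agree_def by (metis lessI)
  define N where "N = max (M i (m i)) (M 0 (m 0))"
  have pc: "p t c = p (x k) c" if t: "t \<in> C N v k" and k: "k = i \<or> k = 0" for t k
  proof (rule m)
    show "t \<in> F" using t S(2) by (auto simp: C_def)
    show "agree (m k) (x k) t" using agree[OF t, of "m k"] k by (auto simp: N_def)
  qed
  have "novikov_sep p (C N v)"
    unfolding novikov_sep_def
  proof (intro exI conjI allI)
    let ?B = "\<lambda>k. if k = i \<or> k = 0 then {z. z c = p (x k) c} else UNIV"
    fix k
    show "?B k \<in> sets baire" using baire_clopen by simp
    show "p ` C N v k \<subseteq> ?B k" using pc by auto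
  next
    have False if "\<And>k. z \<in> (if k = i \<or> k = 0 then {z. z c = p (x k) c} else UNIV)" for z
      using that[of i] that[of 0] c by simp
    then show "(\<Inter>k. if k = i \<or> k = 0 then {z. z c = p (x k) c} else UNIV) = {}"
      by blast
  qed
  then show False using nsep by blast
qed

text \<open>The closure of an arbitrary set is Borel, because \<open>A\<close> enters only through
  the sets of its finite stems, which are countable.\<close>

lemma baire_closure_measurable: "{z. \<forall>n. \<exists>a\<in>A. agree n z a} \<in> sets baire"
proof -
  have "(\<exists>a\<in>A. agree n z a) \<longleftrightarrow> (\<exists>l. (\<exists>a\<in>A. l = map a [0..<n]) \<and> (\<forall>i<n. z i = l ! i))" for n z
    unfolding agree_def by fastforce
  moreover have "{z \<in> space baire. \<forall>n. \<exists>l. (\<exists>a\<in>A. l = map a [0..<n]) \<and> (\<forall>i<n. z i = l ! i)} \<in> sets baire"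
    by measurable
  ultimately show ?thesis by simp
qed

text \<open>
  The fibres being finite, only finitely many stems of each length reach a given point. Novikov
  separation provides Borel supersets of the images of the cylinders with the same property, and
  Koenig's lemma recovers a preimage from these supersets.
\<close>

theorem finite_to_one_image_borel:
  assumes F: "bclosed F" and p: "bcont F p" and fin: "\<And>z. finite {s \<in> F. p s = z}"
  shows "p ` F \<in> sets baire"
proof -
  define stem where "stem n s = map s [0..<n]" for n and s :: "nat \<Rightarrow> nat"
  have stem_agree: "stem n s = stem n t \<longleftrightarrow> agree n s t" for n s t
    by (auto simp: stem_def agree_def)
  \<comment> \<open>The stems of length \<open>n\<close> of the points in one finite fibre have
    bounded codes, so the images of the sets \<open>S n k\<close>, for all \<open>k\<close>, have no
    common point.\<close>
  define S where "S n k = F \<inter> {s. k \<le> to_nat (stem n s)}" for n k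
  have "\<exists>B. (\<forall>k. B k \<in> sets baire \<and> p ` S n k \<subseteq> B k) \<and> (\<Inter>k. B k) = {}" for n
    unfolding novikov_sep_def[symmetric]
  proof (rule novikov[OF p])
    fix k show "S n k \<subseteq> F" by (auto simp: S_def)
    show "bclosed (S n k)"
      unfolding bclosed_def
    proof (intro allI impI)
      fix s assume *: "\<forall>l. \<exists>t\<in>S n k. agree l s t"
      have "s \<in> F" by (rule bclosedD[OF F]) (use * in \<open>auto simp: S_def\<close>)
      moreover obtain t where "t \<in> S n k" "agree n s t" using * by blast
      ultimately show "s \<in> S n k" using stem_agree[of n s t] by (auto simp: S_def)
    qed
  next
    show "(\<Inter>k. p ` S n k) = {}"
    proof (rule equals0I)
      fix z assume "z \<in> (\<Inter>k. p ` S n k)"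
      then have z: "z \<in> p ` S n k" for k by (rule INT_D) simp
      define k where "k = Suc (\<Sum>s\<in>{s \<in> F. p s = z}. to_nat (stem n s))"
      obtain s where s: "s \<in> F" "p s = z" "k \<le> to_nat (stem n s)"
        using z[of k] by (auto simp: S_def)
      have "to_nat (stem n s) \<le> (\<Sum>s\<in>{s \<in> F. p s = z}. to_nat (stem n s))"
        using s fin by (intro member_le_sum) auto
      then show False using s(3) by (simp add: k_def)
    qed
  qed
  then have "\<forall>n. \<exists>B. (\<forall>k. B k \<in> sets baire \<and> p ` S n k \<subseteq> B k) \<and> (\<Inter>k. B k) = {}" by (rule allI)
  from choice[OF this] obtain D where
    "\<forall>n. (\<forall>k. D n k \<in> sets baire \<and> p ` S n k \<subseteq> D n k) \<and> (\<Inter>k. D n k) = {}" ..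
  then have D: "\<And>n k. D n k \<in> sets baire" "\<And>n k. p ` S n k \<subseteq> D n k"
    "\<And>n. (\<Inter>k. D n k) = {}" by simp_all
  \<comment> \<open>A point lying in \<open>E n l\<close> for infinitely many \<open>l\<close> would
    lie in every \<open>D n k\<close>; so the second factor leaves finitely many \<open>l\<close>
    for each point. The first factor, a closure, will supply approximate preimages.\<close>
  define E where "E n l = {z. \<forall>m. \<exists>a\<in>p ` {s \<in> F. stem n s = l}. agree m z a} \<inter> (\<Inter>j\<in>{..to_nat l}. D n j)"
    for n l
  have E_meas: "E n l \<in> sets baire" for n l
    unfolding E_def using D(1) by (intro sets.Int baire_closure_measurable sets.finite_INT) auto
  have E_image: "p s \<in> E n (stem n s)" if s: "s \<in> F" for s n
  proof -
    have "s \<in> S n j" if "j \<le> to_nat (stem n s)" for j using that s by (simp add: S_def)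
    then have "p s \<in> D n j" if "j \<le> to_nat (stem n s)" for j using that D(2)[of n j] by blast
    moreover have "\<forall>m. \<exists>a\<in>p ` {t \<in> F. stem n t = stem n s}. agree m (p s) a"
      using s by (auto simp: agree_def)
    ultimately show ?thesis by (simp add: E_def)
  qed
  have E_fin: "finite {l. z \<in> E n l}" for z n
  proof (rule ccontr)
    assume "infinite {l. z \<in> E n l}"
    then have "infinite (to_nat ` {l. z \<in> E n l})" by (simp add: finite_image_iff inj_on_def)
    then have "\<exists>l. z \<in> E n l \<and> k \<le> to_nat l" for k
      unfolding infinite_nat_iff_unbounded_le by auto
    then have "z \<in> D n k" for k unfolding E_def by blast
    then show False using D(3)[of n] by blast
  qed
  have "p ` F = {z \<in> space baire. \<forall>n. \<exists>l. length l = n \<and> (\<forall>j\<in>{..n}. z \<in> E j (take j l))}"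
    (is "_ = {z \<in> space baire. ?P z}")
  proof (intro equalityI subsetI)
    fix z assume "z \<in> p ` F"
    then obtain s where s: "s \<in> F" "z = p s" by blast
    have "?P z"
    proof
      fix n
      have "z \<in> E j (take j (stem n s))" if "j \<le> n" for j
      proof -
        have "take j (stem n s) = stem j s" using that by (simp add: stem_def take_map)
        then show ?thesis using E_image s by simp
      qed
      then show "\<exists>l. length l = n \<and> (\<forall>j\<in>{..n}. z \<in> E j (take j l))"
        by (intro exI[of _ "stem n s"]) (simp add: stem_def)
    qed
    then show "z \<in> {z \<in> space baire. ?P z}" by simp
  next
    fix z assume "z \<in> {z \<in> space baire. ?P z}"
    then have "z \<in> space baire \<and> ?P z" by (rule CollectD)
    then have "?P z" ..
    from choice[OF this] obtain L where
      "\<forall>n. length (L n) = n \<and> (\<forall>j\<in>{..n}. z \<in> E j (take j (L n)))" ..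
    then have L: "\<And>n. length (L n) = n" "\<And>n j. j \<le> n \<Longrightarrow> z \<in> E j (take j (L n))"
      by simp_all
    \<comment> \<open>A good node is an initial segment shared by infinitely many of the lists
      \<open>L m\<close>. Branching is finite because all segments of length \<open>Suc n\<close>
      belong to the finite set of \<open>l\<close> with \<open>z\<close> in
      \<open>E (Suc n) l\<close>.\<close>
    define good where "good n l \<longleftrightarrow> length l = n \<and> infinite {m. n \<le> m \<and> take n (L m) = l}" for n l
    have "\<exists>f. \<forall>n. good n (f n) \<and> (\<exists>a. f (Suc n) = f n @ [a])"
    proof (rule dependent_nat_choice)
      show "\<exists>l. good 0 l" by (auto simp: good_def)
    next
      fix l n assume "good n l"
      then have l: "length l = n" and inf: "infinite {m. n \<le> m \<and> take n (L m) = l}"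
        by (auto simp: good_def)
      \<comment> \<open>Without \<open>n\<close> itself, every remaining list is long enough to have
        a further entry.\<close>
      define I where "I = {m. n \<le> m \<and> take n (L m) = l} - {n}"
      have "infinite I" using inf by (simp add: I_def)
      moreover have "(\<lambda>m. take (Suc n) (L m)) ` I \<subseteq> {l. z \<in> E (Suc n) l}"
        using L(2) by (auto simp: I_def)
      then have "finite ((\<lambda>m. take (Suc n) (L m)) ` I)" using E_fin finite_subset by blast
      ultimately obtain m0 where m0: "m0 \<in> I"
        "infinite {m \<in> I. take (Suc n) (L m) = take (Suc n) (L m0)}"
        using pigeonhole_infinite[of I "\<lambda>m. take (Suc n) (L m)"] by blast
      have eq: "take (Suc n) (L m0) = l @ [L m0 ! n]"
        using m0(1) L(1)[of m0] by (auto simp: I_def take_Suc_conv_app_nth)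
      have "{m \<in> I. take (Suc n) (L m) = take (Suc n) (L m0)}
          \<subseteq> {m. Suc n \<le> m \<and> take (Suc n) (L m) = l @ [L m0 ! n]}"
        using eq by (auto simp: I_def)
      then have "good (Suc n) (l @ [L m0 ! n])"
        using m0(2) l by (auto simp: good_def dest: finite_subset)
      then show "\<exists>l'. good (Suc n) l' \<and> (\<exists>a. l' = l @ [a])" by blast
    qed
    then obtain f where f: "\<And>n. good n (f n)" "\<And>n. \<exists>a. f (Suc n) = f n @ [a]" by blast
    define s where "s i = last (f (Suc i))" for i
    have stem: "stem n s = f n" for n
    proof (induction n)
      case 0
      then show ?case using f(1)[of 0] by (simp add: stem_def good_def)
    next
      case (Suc n)
      obtain a where "f (Suc n) = f n @ [a]" using f(2) by blast
      then show ?case using Suc by (simp add: stem_def s_def)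
    qed
    have "z \<in> E n (f n)" for n
    proof -
      have "{m. n \<le> m \<and> take n (L m) = f n} \<noteq> {}"
        using f(1)[of n] unfolding good_def by (metis finite.emptyI)
      then show ?thesis using L(2) by force
    qed
    \<comment> \<open>Each node of the branch yields a point of \<open>F\<close> through that node
      whose image agrees with \<open>z\<close> up to \<open>n\<close>. Closedness puts the branch
      into \<open>F\<close>, and continuity identifies its image.\<close>
    then have "\<exists>t\<in>F. stem n t = f n \<and> agree n z (p t)" for n unfolding E_def by blast
    then obtain t where t: "\<And>n. t n \<in> F" "\<And>n. agree n s (t n)" "\<And>n. agree n z (p (t n))"
      using stem stem_agree by metis
    have sF: "s \<in> F" by (rule bclosedD[OF F]) (use t in blast)
    have "p s = z"
    proof
      fix c
      obtain m where m: "\<forall>t\<in>F. agree m s t \<longrightarrow> agree (Suc c) (p s) (p t)"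
        using bcontD[OF p sF] by blast
      define n where "n = max m (Suc c)"
      have "agree m s (t n)" using t(2)[of n] by (rule agree_mono) (simp add: n_def)
      then have "p s c = p (t n) c" using m t(1)[of n] by (auto simp: agree_def)
      moreover have "z c = p (t n) c" using t(3)[of n] by (auto simp: agree_def n_def)
      ultimately show "p s c = z c" by simp
    qed
    then show "z \<in> p ` F" using sF by blast
  qed
  also have "\<dots> \<in> sets baire"
    using E_meas by measurable
  finally show ?thesis .
qed

section \<open>Projections with finite sections in standard Borel spaces\<close>

definition code :: "(nat \<Rightarrow> 'a set) \<Rightarrow> 'a \<Rightarrow> nat \<Rightarrow> nat" where
  "code B x k = (if x \<in> B k then 1 else 0)"

text \<open>Separation from finite sets is what the later steps use: it isolates one neighbour of a
  vertex from the others, and a vertex from the finitely many vertices whose balls meet its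
  own.\<close>

definition separating_base :: "'a measure \<Rightarrow> (nat \<Rightarrow> 'a set) \<Rightarrow> bool" where
  "separating_base M B \<longleftrightarrow> (\<forall>k. B k \<in> sets M) \<and>
     (\<forall>F x. finite F \<longrightarrow> x \<in> space M - F \<longrightarrow> (\<exists>k. x \<in> B k \<and> B k \<inter> F = {}))"

lemma code_measurable:
  assumes "\<And>k. B k \<in> sets M"
  shows "code B \<in> M \<rightarrow>\<^sub>M baire"
proof -
  have "(\<lambda>x. code B x k) \<in> M \<rightarrow>\<^sub>M count_space UNIV" for k
    unfolding code_def using assms by measurable
  then have "(\<lambda>x k. code B x k) \<in> M \<rightarrow>\<^sub>M baire"
    by (intro measurable_PiM_single') (auto simp: PiE_def)
  then show ?thesis by simp
qed

text \<open>The right-hand side has only countable quantifiers over single coordinates, so the set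
  of codes is visibly Borel. Marked balls of small radius that pairwise meet have Cauchy centres,
  and completeness supplies the point; the last condition forces the marked balls to be exactly
  those containing it.\<close>

lemma (in Metric_space) code_image:
  fixes c :: "nat \<Rightarrow> 'a" and r :: "nat \<Rightarrow> real"
  assumes complete: "mcomplete" and c: "\<And>k. c k \<in> M" and r: "\<And>k. 0 < r k"
    and dense: "\<And>x e. x \<in> M \<Longrightarrow> 0 < e \<Longrightarrow> \<exists>k. d x (c k) < r k \<and> r k < e"
  shows "code (\<lambda>k. mball (c k) (r k)) ` M = {t. (\<forall>k. t k = 0 \<or> t k = 1) \<and>
           (\<forall>n. \<exists>k. t k = 1 \<and> r k < 1 / Suc n) \<and>
           (\<forall>k l. t k = 1 \<longrightarrow> t l = 1 \<longrightarrow> d (c k) (c l) < r k + r l) \<and>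
           (\<forall>k. t k = 1 \<longleftrightarrow> (\<exists>l. t l = 1 \<and> d (c k) (c l) + r l < r k))}"
    (is "?code ` M = ?R")
proof (intro equalityI subsetI)
  fix t assume "t \<in> ?code ` M"
  then obtain x where x: "x \<in> M" and t: "t = ?code x" by blast
  have t1: "t k = 1 \<longleftrightarrow> d x (c k) < r k" for k
    using c x by (simp add: t code_def commute)
  have small: "\<exists>k. t k = 1 \<and> r k < e" if "0 < e" for e
    using dense[OF x that] t1 by blast
  have meet: "d (c k) (c l) < r k + r l" if "t k = 1" "t l = 1" for k l
    using that triangle[of "c k" x "c l"] c x t1 commute by (metis add_strict_mono le_less_trans)
  have inner: "t k = 1 \<longleftrightarrow> (\<exists>l. t l = 1 \<and> d (c k) (c l) + r l < r k)" for k
  proof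
    assume "t k = 1"
    then have "0 < (r k - d x (c k)) / 2" using t1[of k] by simp
    from small[OF this] obtain l where l: "t l = 1" "r l < (r k - d x (c k)) / 2" by blast
    have "d (c k) (c l) \<le> d x (c k) + d x (c l)"
      using triangle[of "c k" x "c l"] c x commute by metis
    then show "\<exists>l. t l = 1 \<and> d (c k) (c l) + r l < r k"
      using l t1[of l] by (intro exI[of _ l]) (auto simp: field_simps)
  next
    assume "\<exists>l. t l = 1 \<and> d (c k) (c l) + r l < r k"
    then obtain l where l: "t l = 1" "d (c k) (c l) + r l < r k" by blast
    have "d x (c k) \<le> d x (c l) + d (c k) (c l)"
      using triangle[of x "c l" "c k"] c x commute by metis
    moreover have "d x (c l) < r l" using l(1) t1[of l] by simp
    ultimately have "d x (c k) < r k" using l(2) by linarith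
    then show "t k = 1" using t1[of k] by simp
  qed
  have t01: "t k = 0 \<or> t k = 1" for k by (simp add: t code_def)
  have small': "\<exists>k. t k = 1 \<and> r k < 1 / Suc n" for n by (rule small) simp
  show "t \<in> ?R"
    by (rule CollectI) (intro conjI allI impI t01 small' meet inner)
next
  fix t assume "t \<in> ?R"
  then have t01: "\<And>k. t k = 0 \<or> t k = 1" and small: "\<And>n. \<exists>k. t k = 1 \<and> r k < 1 / Suc n"
    and meet: "\<And>k l. t k = 1 \<Longrightarrow> t l = 1 \<Longrightarrow> d (c k) (c l) < r k + r l"
    and inner: "\<And>k. t k = 1 \<longleftrightarrow> (\<exists>l. t l = 1 \<and> d (c k) (c l) + r l < r k)"
    by blast+
  have "\<forall>n. \<exists>k. t k = 1 \<and> r k < 1 / Suc n" using small by (rule allI)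
  from choice[OF this] obtain k where "\<forall>n. t (k n) = 1 \<and> r (k n) < 1 / Suc n" ..
  then have k: "t (k n) = 1" "r (k n) < 1 / Suc n" for n by simp_all
  have inv: "\<exists>N. \<forall>n\<ge>N. 1 / real (Suc n) < e" if e: "0 < e" for e
  proof -
    obtain N where "1 / real (Suc N) < e" using e nat_approx_posE by blast
    moreover have "1 / real (Suc n) \<le> 1 / real (Suc N)" if "N \<le> n" for n
      using that by (simp add: frac_le)
    ultimately show ?thesis by (meson le_less_trans)
  qed
  have "MCauchy (\<lambda>n. c (k n))"
    unfolding MCauchy_def
  proof (intro conjI allI impI)
    fix e :: real assume "0 < e"
    then obtain N where N: "\<And>n. N \<le> n \<Longrightarrow> 1 / real (Suc n) < e / 2" using inv[of "e / 2"] by auto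
    have "d (c (k n)) (c (k n')) < e" if "N \<le> n" "N \<le> n'" for n n'
      using meet[OF k(1)[of n] k(1)[of n']] k(2)[of n] k(2)[of n'] N[OF that(1)] N[OF that(2)] by linarith
    then show "\<exists>N. \<forall>n n'. N \<le> n \<longrightarrow> N \<le> n' \<longrightarrow> d (c (k n)) (c (k n')) < e" by blast
  qed (use c in auto)
  then obtain x where lim: "limitin mtopology (\<lambda>n. c (k n)) x sequentially"
    using complete by (auto simp: mcomplete_def)
  then have x: "x \<in> M" by (simp add: limitin_metric)
  have near: "\<exists>n. d x (c (k n)) < e \<and> r (k n) < e" if e: "0 < e" for e
  proof -
    obtain N where N: "\<forall>n\<ge>N. 1 / real (Suc n) < e" using inv[OF e] ..
    have "\<forall>\<^sub>F n in sequentially. c (k n) \<in> M \<and> d (c (k n)) x < e"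
      using lim e by (simp add: limitin_metric)
    then obtain N' where N': "\<forall>n\<ge>N'. c (k n) \<in> M \<and> d (c (k n)) x < e"
      unfolding eventually_sequentially ..
    have "r (k (max N N')) < e" using k(2)[of "max N N'"] N by (meson less_trans max.cobounded1)
    moreover have "d x (c (k (max N N'))) < e" using N' commute by (metis max.cobounded2)
    ultimately show ?thesis by blast
  qed
  \<comment> \<open>Only the weak inequality survives in the limit; the strict one comes from a
    smaller marked ball well inside ball \<open>l\<close>.\<close>
  have le: "d x (c l) \<le> r l" if tl: "t l = 1" for l
  proof (rule field_le_epsilon)
    fix e :: real assume "0 < e"
    then obtain n where n: "d x (c (k n)) < e / 2" "r (k n) < e / 2" using near[of "e / 2"] by auto
    show "d x (c l) \<le> r l + e"
      using triangle[OF x c[of "k n"] c[of l]] meet[OF k(1)[of n] tl] n by linarith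
  qed
  have "t l = 1 \<longleftrightarrow> d x (c l) < r l" for l
  proof
    assume "t l = 1"
    then obtain m where m: "t m = 1" "d (c l) (c m) + r m < r l" using inner by blast
    then show "d x (c l) < r l" using le[OF m(1)] triangle[OF x c[of m] c[of l]] commute[of "c l" "c m"] by linarith
  next
    assume *: "d x (c l) < r l"
    then have "0 < (r l - d x (c l)) / 2" by simp
    from near[OF this] obtain n where
      n: "d x (c (k n)) < (r l - d x (c l)) / 2" "r (k n) < (r l - d x (c l)) / 2" by blast
    have "d (c l) (c (k n)) + r (k n) < r l"
      using triangle[OF c[of l] x c[of "k n"]] commute[of "c l" x] n by (simp add: field_simps)
    then show "t l = 1" using inner k(1) by blast
  qed
  then have "t l = ?code x l" for l
    using t01[of l] c x by (auto simp: code_def commute)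
  then show "t \<in> ?code ` M" using x by blast
qed

text \<open>Balls around a dense sequence form a countable base and hence generate the sets of
  \<open>M\<close>. Measurability of \<open>dec\<close> therefore needs to be checked on these balls
  only, where it is read off one coordinate of the code.\<close>

lemma standard_borel_coding:
  assumes "standard_borel M" and "space M \<noteq> {}"
  obtains B dec where "separating_base M B" "code B ` space M \<in> sets baire"
    "dec \<in> baire \<rightarrow>\<^sub>M M" "\<And>x. x \<in> space M \<Longrightarrow> dec (code B x) = x"
proof -
  obtain T where T: "topspace T = space M" "completely_metrizable_space T" "second_countable T"
    "sets M = sigma_sets (topspace T) {U. openin T U}"
    using assms(1) unfolding standard_borel_def by blast
  obtain S d where S: "Metric_space S d" "Metric_space.mcomplete S d" "T = Metric_space.mtopology S d"
    using T(2) unfolding completely_metrizable_space_def by blast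
  interpret Metric_space S d by (rule S(1))
  have sp: "space M = S" using T(1) S(3) by simp
  have "separable_space T" using T(3) by (rule second_countable_imp_separable_space)
  then obtain D where D: "countable D" "D \<subseteq> S" "mtopology closure_of D = S"
    unfolding separable_space_def S(3) by auto
  have "D \<noteq> {}" using D(3) assms(2) sp by auto
  then obtain e :: "nat \<Rightarrow> 'a" where e: "range e = D" using D(1) by (metis uncountable_def)
  \<comment> \<open>The index codes a pair: a member of the dense sequence and a radius
    \<open>1 / Suc n\<close>.\<close>
  define c where "c k = e (fst (prod_decode k))" for k
  define r where "r k = 1 / real (Suc (snd (prod_decode k)))" for k
  define B where "B k = mball (c k) (r k)" for k
  have c: "c k \<in> S" for k using e D(2) by (auto simp: c_def)
  have r: "0 < r k" for k by (simp add: r_def)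
  have dense: "\<exists>k. d x (c k) < r k \<and> r k < h" if x: "x \<in> S" and h: "0 < h" for x h
  proof -
    obtain n where n: "1 / real (Suc n) < h" using h nat_approx_posE by blast
    have "0 < 1 / real (Suc n)" by simp
    then obtain y where "y \<in> D" "y \<in> mball x (1 / real (Suc n))"
      using D(3) x unfolding metric_closure_of by blast
    then obtain i where "d x (e i) < 1 / real (Suc n)" using e by auto
    then show ?thesis using n by (intro exI[of _ "prod_encode (i, n)"]) (simp add: c_def r_def)
  qed
  have base: "\<exists>k. x \<in> B k \<and> B k \<subseteq> U" if "openin T U" "x \<in> U" for U x
  proof -
    obtain h where h: "0 < h" "mball x h \<subseteq> U" "x \<in> S"
      using \<open>openin T U\<close> \<open>x \<in> U\<close> unfolding S(3) openin_mtopology by blast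
    then obtain k where k: "d x (c k) < r k" "r k < h / 2" using dense[of x "h / 2"] by auto
    have "B k \<subseteq> mball x h"
    proof
      fix y assume "y \<in> B k"
      then have "y \<in> S" "d (c k) y < r k" by (auto simp: B_def)
      then show "y \<in> mball x h" using triangle[OF h(3) c[of k], of y] k h(3) by auto
    qed
    moreover have "x \<in> B k" using k(1) h(3) c by (simp add: B_def commute)
    ultimately show ?thesis using h(2) by blast
  qed
  have B_open: "openin T (B k)" for k unfolding S(3) B_def by (rule openin_mball)
  then have B_sets: "B k \<in> sets M" for k unfolding T(4) by blast
  have gen: "sets M = sigma_sets S (range B)"
  proof -
    have "U \<in> sigma_sets S (range B)" if "openin T U" for U
    proof -
      have "U = (\<Union>k\<in>{k. B k \<subseteq> U}. B k)" using base[OF that] by blast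
      moreover have "(\<Union>k\<in>{k. B k \<subseteq> U}. B k) \<in> sigma_sets S (range B)"
        by (rule sigma_sets_UNION) auto
      ultimately show ?thesis by simp
    qed
    then have "sigma_sets S {U. openin T U} \<subseteq> sigma_sets S (range B)"
      by (intro sigma_sets_mono) auto
    moreover have "sigma_sets S (range B) \<subseteq> sigma_sets S {U. openin T U}"
      using B_open by (intro sigma_sets_mono') auto
    ultimately show ?thesis using T(1,4) sp by simp
  qed
  have sep: "separating_base M B"
    unfolding separating_base_def
  proof (intro conjI allI impI)
    fix F x assume "finite F" "x \<in> space M - F"
    then have x: "x \<in> S - F \<inter> S" by (auto simp: sp)
    have "closedin mtopology (F \<inter> S)"
      by (rule closedin_Hausdorff_finite[OF Hausdorff_space_mtopology]) (use \<open>finite F\<close> in auto)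
    then have "openin T (S - F \<inter> S)" unfolding S(3) by (rule openin_diff[OF open_in_mspace])
    from base[OF this x] obtain k where k: "x \<in> B k" "B k \<subseteq> S - F \<inter> S" by blast
    moreover have "B k \<inter> F = {}" using k(2) by blast
    ultimately show "\<exists>k. x \<in> B k \<and> B k \<inter> F = {}" by blast
  qed (rule B_sets)
  have B_eq: "B = (\<lambda>k. mball (c k) (r k))" by (simp add: B_def fun_eq_iff)
  define I where "I = code B ` S"
  have I: "I \<in> sets baire"
  proof -
    have "{t \<in> space baire. (\<forall>k. t k = 0 \<or> t k = 1) \<and>
           (\<forall>n. \<exists>k. t k = 1 \<and> r k < 1 / Suc n) \<and>
           (\<forall>k l. t k = 1 \<longrightarrow> t l = 1 \<longrightarrow> d (c k) (c l) < r k + r l) \<and>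
           (\<forall>k. t k = 1 \<longleftrightarrow> (\<exists>l. t l = 1 \<and> d (c k) (c l) + r l < r k))} \<in> sets baire"
      by measurable
    then show ?thesis
      unfolding I_def B_eq using code_image[of c r] S(2) c r dense by simp
  qed
  have inj: "inj_on (code B) S"
  proof (rule inj_onI, rule ccontr)
    fix x y assume xy: "x \<in> S" "y \<in> S" "code B x = code B y" "x \<noteq> y"
    then have "finite {y}" "x \<in> space M - {y}" by (simp_all add: sp)
    then obtain k where "x \<in> B k" "B k \<inter> {y} = {}" using sep unfolding separating_base_def by meson
    then have "x \<in> B k" "y \<notin> B k" by simp_all
    then show False using fun_cong[OF xy(3), of k] by (simp add: code_def)
  qed
  obtain x0 where x0: "x0 \<in> S" using assms(2) sp by blast
  \<comment> \<open>\<open>x0\<close> is the default for sequences that are no codes; this is where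
    the space must be nonempty.\<close>
  define dec where "dec t = (if t \<in> I then the_inv_into S (code B) t else x0)" for t
  have dec: "dec (code B x) = x" if "x \<in> S" for x
    using that inj by (simp add: dec_def I_def the_inv_into_f_f)
  have "dec \<in> baire \<rightarrow>\<^sub>M M"
  proof (rule measurable_sigma_sets[OF gen])
    show "range B \<subseteq> Pow S" by (auto simp: B_def)
    have "dec t \<in> S" for t using dec x0 by (cases "t \<in> I") (auto simp: I_def, simp add: dec_def I_def)
    then show "dec \<in> space baire \<rightarrow> S" by blast
    fix U assume "U \<in> range B"
    then obtain k where U: "U = B k" by blast
    have "dec t \<in> B k \<longleftrightarrow> t \<in> I \<and> t k = 1 \<or> t \<notin> I \<and> x0 \<in> B k" for t
    proof (cases "t \<in> I")
      case True
      then obtain x where "x \<in> S" "t = code B x" by (auto simp: I_def)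
      then show ?thesis using dec True by (simp add: code_def)
    qed (simp add: dec_def)
    then have "dec -` U \<inter> space baire = {t \<in> space baire. t \<in> I \<and> t k = 1 \<or> t \<notin> I \<and> x0 \<in> B k}"
      by (auto simp: U)
    also have "\<dots> \<in> sets baire" using I by measurable
    finally show "dec -` U \<inter> space baire \<in> sets baire" .
  qed
  then show thesis using that[OF sep _ _ dec] I by (simp add: I_def sp)
qed

definition interleave :: "(nat \<Rightarrow> nat) \<Rightarrow> (nat \<Rightarrow> nat) \<Rightarrow> nat \<Rightarrow> nat" where
  "interleave s t n = (if even n then s (n div 2) else t (n div 2))"

text \<open>\<open>Q\<close> is moved to the set \<open>Q'\<close> of interleaved codes and written
  as an injective continuous image of a closed set. Followed by \<open>ev\<close>, which recovers
  the first code, this map is finite-to-one because the part of \<open>Q'\<close> above a code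
  injects into a section of \<open>Q\<close>.\<close>

theorem finite_section_projection:
  assumes "standard_borel M" and Q: "Q \<in> sets (M \<Otimes>\<^sub>M M)"
    and fin: "\<And>x. x \<in> space M \<Longrightarrow> finite (Q `` {x})"
  shows "{x \<in> space M. \<exists>y. (x, y) \<in> Q} \<in> sets M"
proof (cases "space M = {}")
  case False
  with assms(1) obtain B dec where B: "separating_base M B" and I: "code B ` space M \<in> sets baire"
    and [measurable]: "dec \<in> baire \<rightarrow>\<^sub>M M" and dec: "\<And>x. x \<in> space M \<Longrightarrow> dec (code B x) = x"
    by (rule standard_borel_coding) blast
  define I where "I = code B ` space M"
  define ev od where "ev t = (\<lambda>n. t (2 * n))" and "od t = (\<lambda>n. t (2 * n + 1))" for t :: "nat \<Rightarrow> nat"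
  have [simp]: "ev (interleave s t) = s" "od (interleave s t) = t" "interleave (ev u) (od u) = u" for s t u
    by (auto simp: ev_def od_def interleave_def fun_eq_iff)
  have [measurable]: "ev \<in> baire \<rightarrow>\<^sub>M baire" "od \<in> baire \<rightarrow>\<^sub>M baire"
    unfolding ev_def[abs_def] od_def[abs_def] by (auto intro!: measurable_PiM_single' simp: PiE_def)
  define Q' where "Q' = {t. ev t \<in> I \<and> od t \<in> I \<and> (dec (ev t), dec (od t)) \<in> Q}"
  have "{t \<in> space baire. ev t \<in> I \<and> od t \<in> I \<and> (dec (ev t), dec (od t)) \<in> Q} \<in> sets baire"
    using I[folded I_def] Q by measurable
  then have "Q' \<in> sets baire" by (simp add: Q'_def)
  then obtain F h where F: "bclosed F" and h: "bcont F h" "inj_on h F" "h ` F = Q'"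
    using injrep_borel unfolding injrep_def by blast
  have fin': "finite {t \<in> Q'. ev t = z}" for z
  proof (cases "z \<in> I")
    case True
    then have z: "dec z \<in> space M" using dec by (auto simp: I_def)
    have "{t \<in> Q'. ev t = z} \<subseteq> (\<lambda>y. interleave z (code B y)) ` (Q `` {dec z})"
    proof
      fix t assume t: "t \<in> {t \<in> Q'. ev t = z}"
      then obtain y where "y \<in> space M" "od t = code B y" by (auto simp: Q'_def I_def)
      moreover have "interleave (ev t) (od t) = t" by simp
      moreover have "ev t = z" "(dec (ev t), dec (od t)) \<in> Q" using t unfolding Q'_def by blast+
      ultimately have "t = interleave z (code B y)" "(dec z, y) \<in> Q" using dec by simp_all
      then show "t \<in> (\<lambda>y. interleave z (code B y)) ` (Q `` {dec z})" by blast
    qed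
    then show ?thesis using fin[OF z] by (rule finite_subset[OF _ finite_imageI])
  next
    case False
    then have "{t \<in> Q'. ev t = z} = {}" unfolding Q'_def by blast
    then show ?thesis by (simp only: finite.emptyI)
  qed
  have "(ev \<circ> h) ` F \<in> sets baire"
  proof (rule finite_to_one_image_borel[OF F])
    show "bcont F (ev \<circ> h)"
      unfolding bcont_def
    proof (intro ballI allI)
      fix s n assume "s \<in> F"
      then obtain m where "\<forall>t\<in>F. agree m s t \<longrightarrow> agree (2 * n) (h s) (h t)"
        using bcontD[OF h(1)] by blast
      moreover have "agree n (ev u) (ev v)" if "agree (2 * n) u v" for u v
        using that by (simp add: agree_def ev_def)
      ultimately have "\<forall>t\<in>F. agree m s t \<longrightarrow> agree n ((ev \<circ> h) s) ((ev \<circ> h) t)" by simp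
      then show "\<exists>m. \<forall>t\<in>F. agree m s t \<longrightarrow> agree n ((ev \<circ> h) s) ((ev \<circ> h) t)" ..
    qed
    fix z
    show "finite {s \<in> F. (ev \<circ> h) s = z}"
    proof (rule inj_on_finite[OF _ _ fin'])
      show "inj_on h {s \<in> F. (ev \<circ> h) s = z}" using h(2) by (rule inj_on_subset) auto
      show "h ` {s \<in> F. (ev \<circ> h) s = z} \<subseteq> {t \<in> Q'. ev t = z}" using h(3) by auto
    qed
  qed
  moreover have "(ev \<circ> h) ` F = ev ` Q'" unfolding h(3)[symmetric] by (rule image_comp[symmetric])
  ultimately have P: "ev ` Q' \<in> sets baire" by (simp only:)
  have "{x \<in> space M. \<exists>y. (x, y) \<in> Q} = {x \<in> space M. code B x \<in> ev ` Q'}"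
  proof (intro Collect_cong conj_cong refl)
    fix x assume x: "x \<in> space M"
    show "(\<exists>y. (x, y) \<in> Q) \<longleftrightarrow> code B x \<in> ev ` Q'"
    proof
      assume "\<exists>y. (x, y) \<in> Q"
      then obtain y where y: "(x, y) \<in> Q" by blast
      moreover have "y \<in> space M" using sets.sets_into_space[OF Q] y by (auto simp: space_pair_measure)
      ultimately have "interleave (code B x) (code B y) \<in> Q'" using x dec by (simp add: Q'_def I_def)
      then show "code B x \<in> ev ` Q'" by (rule rev_image_eqI) simp
    next
      assume "code B x \<in> ev ` Q'"
      then obtain t where "t \<in> Q'" "ev t = code B x" by (metis imageE)
      then have "(x, dec (od t)) \<in> Q" using dec[OF x] by (simp add: Q'_def)
      then show "\<exists>y. (x, y) \<in> Q" ..
    qed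
  qed
  also have "\<dots> \<in> sets M"
  proof -
    have [measurable]: "code B \<in> M \<rightarrow>\<^sub>M baire"
      using B by (intro code_measurable) (simp add: separating_base_def)
    show ?thesis using P by measurable
  qed
  finally show ?thesis .
qed simp

section \<open>Borel enumeration of the components of a locally finite graph\<close>

lemma separating_baseD:
  assumes "separating_base M B"
  shows "B k \<in> sets M" "finite F \<Longrightarrow> x \<in> space M \<Longrightarrow> x \<notin> F \<Longrightarrow> \<exists>k. x \<in> B k \<and> B k \<inter> F = {}"
  using assms by (auto simp: separating_base_def)

lemma standard_borel_separating_base:
  assumes "standard_borel M"
  obtains B where "separating_base M B"
proof (cases "space M = {}")
  case True
  then have "separating_base M (\<lambda>_. {})" by (simp add: separating_base_def)
  then show thesis by (rule that)
next
  case False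
  with assms show thesis by (rule standard_borel_coding) (rule that)
qed

text \<open>Every edge is caught by one of countably many Borel functions: \<open>g k x\<close> is
  the neighbour of \<open>x\<close> in \<open>B k\<close> when there is exactly one. Their
  composites along finite lists reach the whole component.\<close>

theorem locally_finite_enumeration:
  assumes M: "standard_borel M" and B: "separating_base M B"
    and G: "G \<in> sets (M \<Otimes>\<^sub>M M)" "locally_finite (space M) G"
  obtains f :: "nat \<Rightarrow> 'a \<Rightarrow> 'a" where "\<And>i. f i \<in> M \<rightarrow>\<^sub>M M"
    "\<And>x. x \<in> space M \<Longrightarrow> component G x = range (\<lambda>i. f i x)"
proof -
  have [measurable]: "B k \<in> sets M" for k using separating_baseD(1)[OF B] .
  have GM: "G \<subseteq> space M \<times> space M" using sets.sets_into_space[OF G(1)] by (simp add: space_pair_measure)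
  have fin: "finite (G `` {x})" if "x \<in> space M" for x
    using G(2) that by (simp add: locally_finite_def)
  define P where "P A = {x \<in> space M. \<exists>y. (x, y) \<in> G \<inter> space M \<times> A}" for A
  have P [measurable]: "P A \<in> sets M" if "A \<in> sets M" for A
    unfolding P_def
  proof (rule finite_section_projection[OF M])
    show "G \<inter> space M \<times> A \<in> sets (M \<Otimes>\<^sub>M M)" using G(1) that by auto
    show "finite ((G \<inter> space M \<times> A) `` {x})" if "x \<in> space M" for x
      by (rule finite_subset[OF _ fin[OF that]]) auto
  qed
  have PI: "x \<in> P A \<longleftrightarrow> (\<exists>y\<in>A. (x, y) \<in> G)" for x A
    using GM by (auto simp: P_def)
  \<comment> \<open>Exactly one neighbour lies in \<open>B k\<close>, as two of them would be split
    by some \<open>B l\<close>. In this form uniqueness is expressed by the sets \<open>P\<close>,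
    which are projections with finite sections.\<close>
  define U where "U k = {x \<in> space M. x \<in> P (B k) \<and> \<not> (\<exists>l. x \<in> P (B k \<inter> B l) \<and> x \<in> P (B k - B l))}" for k
  have U [measurable]: "U k \<in> sets M" for k unfolding U_def by measurable
  have uniq: "y = y'" if "x \<in> U k" "(x, y) \<in> G" "(x, y') \<in> G" "y \<in> B k" "y' \<in> B k" for x k y y'
  proof (rule ccontr)
    assume "y \<noteq> y'"
    then obtain l where "y \<in> B l" "B l \<inter> {y'} = {}"
      using separating_baseD(2)[OF B, of "{y'}" y] GM \<open>(x, y) \<in> G\<close> by auto
    then have "x \<in> P (B k \<inter> B l)" "x \<in> P (B k - B l)"
      using that unfolding PI by auto
    then show False using \<open>x \<in> U k\<close> by (auto simp: U_def)
  qed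
  \<comment> \<open>Being the identity off \<open>U k\<close>, \<open>g k\<close> is total and its
    composites never leave the component.\<close>
  define g where "g k x = (if x \<in> U k then THE y. (x, y) \<in> G \<and> y \<in> B k else x)" for k x
  have gU: "(x, g k x) \<in> G \<and> g k x \<in> B k" if "x \<in> U k" for k x
  proof -
    obtain y where y: "(x, y) \<in> G \<and> y \<in> B k"
      using \<open>x \<in> U k\<close> by (auto simp: U_def PI)
    have "(THE y. (x, y) \<in> G \<and> y \<in> B k) = y"
      by (rule the_equality) (use y uniq[OF that] in blast)+
    then show ?thesis using y that by (simp add: g_def)
  qed
  have g_meas: "g k \<in> M \<rightarrow>\<^sub>M M" for k
  proof (rule measurableI)
    fix x assume "x \<in> space M"
    then show "g k x \<in> space M" using gU[of x k] GM by (cases "x \<in> U k") (auto simp: g_def)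
  next
    fix A assume A[measurable]: "A \<in> sets M"
    have "g k x \<in> A \<longleftrightarrow> x \<in> P (B k \<inter> A)" if "x \<in> U k" for x
      using gU[OF that] uniq[OF that] by (auto simp: PI)
    moreover have "g k x \<in> A \<longleftrightarrow> x \<in> A" if "x \<notin> U k" for x using that by (simp add: g_def)
    ultimately have "g k -` A \<inter> space M = {x \<in> space M. x \<in> U k \<and> x \<in> P (B k \<inter> A) \<or> x \<notin> U k \<and> x \<in> A}"
      by blast
    also have "\<dots> \<in> sets M" by measurable
    finally show "g k -` A \<inter> space M \<in> sets M" .
  qed
  have g_cover: "\<exists>k. g k x = y" if xy: "(x, y) \<in> G" for x y
  proof -
    have x: "x \<in> space M" and y: "y \<in> space M" using xy GM by auto
    have "finite (G `` {x} - {y})" using fin[OF x] by simp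
    then obtain k where k: "y \<in> B k" "B k \<inter> (G `` {x} - {y}) = {}"
      using separating_baseD(2)[OF B _ y, of "G `` {x} - {y}"] by auto
    have "x \<in> U k" using k xy x by (auto simp: U_def PI)
    then have "g k x = y" using gU k by auto
    then show ?thesis ..
  qed
  define f where "f i x = foldr g (from_nat i) x" for i x
  have fold_meas: "foldr g l \<in> M \<rightarrow>\<^sub>M M" for l
  proof (induction l)
    case (Cons a l)
    then have "g a \<circ> foldr g l \<in> M \<rightarrow>\<^sub>M M" using g_meas by (rule measurable_comp)
    then show ?case by (simp add: comp_def)
  qed (simp add: id_def)
  have "component G x = range (\<lambda>i. f i x)" if "x \<in> space M" for x
  proof (intro equalityI subsetI)
    fix y assume "y \<in> component G x"
    then have "(x, y) \<in> G\<^sup>*" by (simp add: component_def)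
    then have "\<exists>l. foldr g l x = y"
    proof induction
      case base
      have "foldr g [] x = x" by simp
      then show ?case by blast
    next
      case (step y z)
      then obtain l k where "foldr g l x = y" "g k y = z" using g_cover by blast
      then have "foldr g (k # l) x = z" by simp
      then show ?case by blast
    qed
    then show "y \<in> range (\<lambda>i. f i x)" by (metis f_def from_nat_to_nat rangeI)
  next
    fix y assume "y \<in> range (\<lambda>i. f i x)"
    then obtain l where l: "y = foldr g l x" by (auto simp: f_def)
    have "(z, g k z) \<in> G\<^sup>*" for k z using gU[of z k] by (cases "z \<in> U k") (auto simp: g_def)
    then have "(x, foldr g l x) \<in> G\<^sup>*" by (induction l) (auto intro: rtrancl_trans)
    then show "y \<in> component G x" by (simp add: component_def l)
  qed
  moreover have "f i \<in> M \<rightarrow>\<^sub>M M" for i unfolding f_def[abs_def] by (rule fold_meas)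
  ultimately show thesis using that by blast
qed

section \<open>Bridges and cycles\<close>

text \<open>Acyclicity expressed edge by edge. This form passes easily to contractions, where a
  detour can be lifted; simple cycles would have to be rebuilt.\<close>

definition bridges :: "('a \<times> 'a) set \<Rightarrow> bool" where
  "bridges T \<longleftrightarrow> (\<forall>x y. (x, y) \<in> T \<longrightarrow> (y, x) \<notin> (T - {(x, y), (y, x)})\<^sup>*)"

lemma rtrancl_simple_path:
  assumes "(x, y) \<in> R\<^sup>*"
  obtains p :: "nat \<Rightarrow> 'a" and m where "p 0 = x" "p m = y" "\<And>i. i < m \<Longrightarrow> (p i, p (Suc i)) \<in> R"
    "inj_on p {..m}"
proof -
  obtain m where m: "(x, y) \<in> R ^^ m" and least: "\<And>k. k < m \<Longrightarrow> (x, y) \<notin> R ^^ k"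
    using assms exists_least_iff[of "\<lambda>n. (x, y) \<in> R ^^ n"] by (auto simp: rtrancl_power)
  obtain p where p: "p 0 = x" "p m = y" "\<And>i. i < m \<Longrightarrow> (p i, p (Suc i)) \<in> R"
    using m by (auto simp: relpow_fun_conv)
  have "p i \<noteq> p j" if ij: "i < j" "j \<le> m" for i j
  proof
    assume eq: "p i = p j"
    have sub: "(p a, p b) \<in> R ^^ (b - a)" if "a \<le> b" "b \<le> m" for a b
      unfolding relpow_fun_conv
      using that p(3) by (intro exI[of _ "\<lambda>k. p (a + k)"]) auto
    have "(p 0, p i) \<in> R ^^ i" "(p j, p m) \<in> R ^^ (m - j)" using sub[of 0 i] sub[of j m] ij by auto
    then have "(x, y) \<in> R ^^ (i + (m - j))" using eq p(1,2) by (auto simp: relpow_add)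
    moreover have "i + (m - j) < m" using ij by linarith
    ultimately show False using least by blast
  qed
  then have "inj_on p {..m}" by (auto simp: inj_on_def) (metis nat_neq_iff)
  with p show thesis by (rule that)
qed

text \<open>A shortest detour repeats no vertex. Its length is not 0 because there are no loops, and
  not 1 because the edge itself has been removed.\<close>

lemma nonbridge_simple_cycle:
  assumes "irrefl T" "(x, y) \<in> T" "(y, x) \<in> (T - {(x, y), (y, x)})\<^sup>*"
  obtains p :: "nat \<Rightarrow> 'a" and m where "2 \<le> m" "inj_on p {..m}" "p 0 = y" "p m = x"
    "\<And>i. i < m \<Longrightarrow> (p i, p (Suc i)) \<in> T"
proof -
  obtain p :: "nat \<Rightarrow> 'a" and m where p: "p 0 = y" "p m = x"
    "\<And>i. i < m \<Longrightarrow> (p i, p (Suc i)) \<in> T - {(x, y), (y, x)}" "inj_on p {..m}"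
    using assms(3) by (rule rtrancl_simple_path) blast
  have "m \<noteq> 0" using p(1,2) assms(1,2) by (metis irreflD)
  moreover have "m \<noteq> 1" using p(1,2) p(3)[of 0] by auto
  ultimately have "2 \<le> m" by simp
  then show thesis using p by (intro that[of m p]) auto
qed

lemma acyclic_graph_bridges:
  assumes "sym T" "irrefl T" "acyclic_graph T"
  shows "bridges T"
  unfolding bridges_def
proof (intro allI impI notI)
  fix x y assume xy: "(x, y) \<in> T" "(y, x) \<in> (T - {(x, y), (y, x)})\<^sup>*"
  obtain p :: "nat \<Rightarrow> 'a" and m where p: "2 \<le> m" "inj_on p {..m}" "p 0 = y" "p m = x"
    "\<And>i. i < m \<Longrightarrow> (p i, p (Suc i)) \<in> T"
    using assms(2) xy by (rule nonbridge_simple_cycle) blast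
  define q where "q = map p [0..<Suc m]"
  have "graph_cycle T q"
    unfolding graph_cycle_def
  proof (intro conjI allI impI)
    show "3 \<le> length q" using p(1) by (simp add: q_def)
    show "distinct q" using p(2) by (auto simp: q_def distinct_map inj_on_def simp del: upt_Suc)
    fix i assume "i < length q"
    then have i: "i \<le> m" by (simp add: q_def)
    have nth: "q ! k = p k" if "k \<le> m" for k using that by (simp add: q_def del: upt_Suc)
    have len: "length q = Suc m" by (simp add: q_def)
    show "(q ! i, q ! (Suc i mod length q)) \<in> T"
    proof (cases "i = m")
      case True
      then show ?thesis using nth[of m] nth[of 0] xy(1) p(3,4) len by simp
    next
      case False
      then show ?thesis using i nth[of i] nth[of "Suc i"] p(5)[of i] len by simp
    qed
  qed
  then show False using assms(3) by (auto simp: acyclic_graph_def)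
qed

lemma bridges_acyclic_graph:
  assumes "bridges T" "sym T"
  shows "acyclic_graph T"
  unfolding acyclic_graph_def
proof
  assume "\<exists>p. graph_cycle T p"
  then obtain p where p: "3 \<le> length p" "distinct p"
    "\<And>i. i < length p \<Longrightarrow> (p ! i, p ! (Suc i mod length p)) \<in> T"
    by (auto simp: graph_cycle_def)
  define n where "n = length p - 1"
  have n: "length p = Suc n" "2 \<le> n" using p(1) by (auto simp: n_def)
  let ?T' = "T - {(p ! n, p ! 0), (p ! 0, p ! n)}"
  have "(p ! 0, p ! k) \<in> ?T'\<^sup>*" if "k \<le> n" for k
    using that
  proof (induction k)
    case (Suc k)
    then have k: "k < length p" "Suc k < length p" using n by auto
    have "(p ! k, p ! Suc k) \<in> T" using p(3)[OF k(1)] k by simp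
    moreover have "p ! k \<noteq> p ! n" "k = 0 \<Longrightarrow> p ! Suc k \<noteq> p ! n"
      using k n p(2) by (auto simp: nth_eq_iff_index_eq)
    moreover have "k \<noteq> 0 \<Longrightarrow> p ! k \<noteq> p ! 0" using k n p(2) by (subst nth_eq_iff_index_eq) auto
    ultimately have "(p ! k, p ! Suc k) \<in> ?T'" by auto
    with Suc show ?case by (auto intro: rtrancl_into_rtrancl)
  qed simp
  then have "(p ! 0, p ! n) \<in> ?T'\<^sup>*" by blast
  moreover have "(p ! n, p ! 0) \<in> T" using p(3)[of n] n by simp
  ultimately show False using assms(1) unfolding bridges_def by blast
qed

lemma relation_path_change:
  assumes "(x, y) \<in> R\<^sup>*" "P x" "\<not> P y"
  shows "\<exists>u v. (u, v) \<in> R \<and> P u \<and> \<not> P v"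
  using assms by (induction rule: converse_rtrancl_induct) blast+

section \<open>Spanning trees of partial cubes with coloured walls\<close>

text \<open>\<open>H\<close> consists of the half-spaces, \<open>neg\<close> passes to the other
  side of a wall, and a vertex is the set of half-spaces it selects. \<open>geodesic\<close> makes
  \<open>V\<close> a partial cube; \<open>nested\<close> says that of the four quadrants of two
  walls with equal colour one is empty. \<open>key A\<close> numbers the vertices so that edges
  across \<open>A\<close> can be compared.\<close>

locale coloured_cube =
  fixes V :: "'h set set" and H :: "'h set" and neg :: "'h \<Rightarrow> 'h" and col :: "'h \<Rightarrow> nat"
    and key :: "'h \<Rightarrow> 'h set \<Rightarrow> nat"
  assumes neg_H: "A \<in> H \<Longrightarrow> neg A \<in> H" and neg_neg: "A \<in> H \<Longrightarrow> neg (neg A) = A"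
    and col_neg: "A \<in> H \<Longrightarrow> col (neg A) = col A" and key_neg: "A \<in> H \<Longrightarrow> key (neg A) = key A"
    and V_H: "u \<in> V \<Longrightarrow> u \<subseteq> H"
    and V_neg: "u \<in> V \<Longrightarrow> A \<in> H \<Longrightarrow> neg A \<in> u \<longleftrightarrow> A \<notin> u"
    and finite_diff: "u \<in> V \<Longrightarrow> v \<in> V \<Longrightarrow> finite (sym_diff u v)"
    and geodesic: "u \<in> V \<Longrightarrow> v \<in> V \<Longrightarrow> u \<noteq> v \<Longrightarrow>
      \<exists>A w. w \<in> V \<and> A \<in> sym_diff u v \<and> sym_diff u w = {A, neg A}"
    and nested: "A \<in> H \<Longrightarrow> B \<in> H \<Longrightarrow> B \<notin> {A, neg A} \<Longrightarrow> col A = col B \<Longrightarrow>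
      \<exists>a b. \<forall>u\<in>V. \<not> ((A \<in> u) = a \<and> (B \<in> u) = b)"
    and key_inj: "A \<in> H \<Longrightarrow> inj_on (key A) V"
begin

definition adj :: "'h \<Rightarrow> 'h set \<Rightarrow> 'h set \<Rightarrow> bool" where
  "adj A u v \<longleftrightarrow> u \<in> V \<and> v \<in> V \<and> sym_diff u v = {A, neg A}"

text \<open>Related vertices differ at most in the wall \<open>A\<close> and in walls of smaller
  colour, and the latter are what an induction on the colour can deal with.\<close>

definition sim :: "'h \<Rightarrow> 'h set \<Rightarrow> 'h set \<Rightarrow> bool" where
  "sim A u w \<longleftrightarrow> (\<forall>B\<in>H. col A \<le> col B \<longrightarrow> B \<notin> {A, neg A} \<longrightarrow> (B \<in> u \<longleftrightarrow> B \<in> w))"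

text \<open>In each class of edges across \<open>A\<close> the one with the least endpoint key is
  kept. Since \<open>w\<close> may be either endpoint of a competing edge, the condition compares
  the minima over both endpoints and does not depend on the direction of edges.\<close>

definition tree :: "('h set \<times> 'h set) set" where
  "tree = {(u, v). \<exists>A\<in>H. adj A u v \<and>
     (\<forall>w w'. adj A w w' \<longrightarrow> sim A u w \<longrightarrow> min (key A u) (key A v) \<le> key A w)}"

lemma adj_sym: "adj A u v \<Longrightarrow> adj A v u"
  by (auto simp: adj_def)

lemma adj_H: "adj A u v \<Longrightarrow> A \<in> H"
  using V_H by (fastforce simp: adj_def)

lemma adj_iff: "adj A u v \<Longrightarrow> B \<in> u \<longleftrightarrow> (B \<in> v) \<noteq> (B \<in> {A, neg A})"
  unfolding adj_def by blast

lemma sim_sym: "sim A u w \<Longrightarrow> sim A w u"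
  by (auto simp: sim_def)

lemma sim_trans: "sim A u v \<Longrightarrow> sim A v w \<Longrightarrow> sim A u w"
  by (auto simp: sim_def)

lemma adj_sim: "adj A u v \<Longrightarrow> sim A u v"
  unfolding sim_def using adj_iff by blast

lemma adj_unique: "adj A u v \<Longrightarrow> adj A u w \<Longrightarrow> v = w"
  using adj_iff[of A u v] adj_iff[of A u w] by blast

lemma adj_neg: "A \<in> H \<Longrightarrow> adj (neg A) u v \<longleftrightarrow> adj A u v"
  by (simp add: adj_def neg_neg insert_commute)

lemma sim_neg: "A \<in> H \<Longrightarrow> sim (neg A) u v \<longleftrightarrow> sim A u v"
  by (simp add: sim_def neg_neg col_neg insert_commute)

lemma tree_sym: "sym tree"
proof (rule symI)
  fix u v assume "(u, v) \<in> tree"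
  then obtain A where A: "A \<in> H" "adj A u v"
    "\<And>w w'. adj A w w' \<Longrightarrow> sim A u w \<Longrightarrow> min (key A u) (key A v) \<le> key A w"
    by (auto simp: tree_def)
  have "min (key A v) (key A u) \<le> key A w" if "adj A w w'" "sim A v w" for w w'
    using A(3)[OF that(1) sim_trans[OF adj_sim[OF A(2)] that(2)]] by (simp add: min.commute)
  then show "(v, u) \<in> tree" using A(1) adj_sym[OF A(2)] by (auto simp: tree_def)
qed

lemma tree_V: "tree \<subseteq> V \<times> V"
  by (auto simp: tree_def adj_def)

lemma tree_irrefl: "irrefl tree"
  by (auto simp: irrefl_def tree_def adj_def)

text \<open>The walk from \<open>u\<close> to \<open>v\<close> reverses one separating wall at a
  time, and each of these has colour below \<open>n\<close>. The number of separating half-spaces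
  drops at every step.\<close>

lemma tree_connects_low:
  assumes low: "\<And>A u v. adj A u v \<Longrightarrow> col A < n \<Longrightarrow> (u, v) \<in> tree\<^sup>*"
  shows "u \<in> V \<Longrightarrow> v \<in> V \<Longrightarrow> (\<And>B. B \<in> sym_diff u v \<Longrightarrow> col B < n) \<Longrightarrow> (u, v) \<in> tree\<^sup>*"
proof (induction "card (sym_diff u v)" arbitrary: u rule: less_induct)
  case less
  show ?case
  proof (cases "u = v")
    case False
    then obtain A w where w: "w \<in> V" "A \<in> sym_diff u v" "sym_diff u w = {A, neg A}"
      using geodesic[OF less.prems(1,2) False] by blast
    then have adj: "adj A u w" using less.prems by (simp add: adj_def)
    then have AH: "A \<in> H" by (rule adj_H)
    have negA: "neg A \<in> sym_diff u v" using w(2) V_neg[OF less.prems(1) AH] V_neg[OF less.prems(2) AH] by blast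
    have sd: "sym_diff w v = sym_diff u v - {A, neg A}"
    proof (rule set_eqI)
      fix B
      show "B \<in> sym_diff w v \<longleftrightarrow> B \<in> sym_diff u v - {A, neg A}"
      proof (cases "B \<in> {A, neg A}")
        case True
        then have "B \<in> sym_diff u v" using negA w(2) by auto
        then show ?thesis using adj_iff[OF adj, of B] True by auto
      next
        case False
        then have "B \<in> u \<longleftrightarrow> B \<in> w" using adj_iff[OF adj, of B] by simp
        then show ?thesis using False by simp
      qed
    qed
    have "sym_diff w v \<subset> sym_diff u v" using sd w(2) by blast
    then have "card (sym_diff w v) < card (sym_diff u v)"
      using finite_diff less.prems by (intro psubset_card_mono)
    moreover have "col B < n" if "B \<in> sym_diff w v" for B
      using less.prems(3) that unfolding sd by blast
    ultimately have "(w, v) \<in> tree\<^sup>*" using less.hyps[of w] w(1) less.prems(2) by blast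
    moreover have "(u, w) \<in> tree\<^sup>*" using low[OF adj] less.prems(3) w(2) by blast
    ultimately show ?thesis by (meson rtrancl_trans)
  qed simp
qed

text \<open>Induction on the colour of \<open>A\<close>. The edge kept in the class of the given one
  also crosses \<open>A\<close>; its endpoint on the side of \<open>u\<close> differs from
  \<open>u\<close> only in walls of smaller colour, and likewise on the side of
  \<open>v\<close>.\<close>

lemma tree_connects_adj: "adj A u v \<Longrightarrow> (u, v) \<in> tree\<^sup>*"
proof (induction "col A" arbitrary: A u v rule: less_induct)
  case less
  have AH: "A \<in> H" using less.prems by (rule adj_H)
  have low: "(x, y) \<in> tree\<^sup>*" if "x \<in> V" "y \<in> V" "\<And>B. B \<in> sym_diff x y \<Longrightarrow> col B < col A" for x y
    using less.hyps by (rule tree_connects_low[OF _ that]) auto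
  define S where "S = {w. \<exists>w'. adj A w w' \<and> sim A u w}"
  have "u \<in> S" using less.prems by (auto simp: S_def sim_def)
  then obtain w where w: "w \<in> S" "\<And>x. x \<in> S \<Longrightarrow> key A w \<le> key A x"
    using ex_has_least_nat[of "\<lambda>x. x \<in> S" u "key A"] by blast
  then obtain w' where w': "adj A w w'" "sim A u w" by (auto simp: S_def)
  have "key A w \<le> key A x" if "adj A x x'" "sim A w x" for x x'
    using w(2) that sim_trans[OF w'(2)] by (auto simp: S_def)
  then have ww': "(w, w') \<in> tree" using w'(1) AH by (fastforce simp: tree_def min_le_iff_disj)
  have V: "u \<in> V" "v \<in> V" "w \<in> V" "w' \<in> V" using less.prems w' by (auto simp: adj_def)
  have same: "(x, y) \<in> tree\<^sup>*" if "x \<in> V" "y \<in> V" "sim A x y" "A \<in> x \<longleftrightarrow> A \<in> y" for x y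
  proof (rule low[OF that(1,2)])
    fix B assume B: "B \<in> sym_diff x y"
    then have "B \<in> H" using V_H that(1,2) by blast
    moreover have "neg A \<in> x \<longleftrightarrow> neg A \<in> y" using V_neg that AH by blast
    then have "B \<notin> {A, neg A}" using B that(4) by auto
    ultimately show "col B < col A" using B that(3) unfolding sim_def by (metis Diff_iff Un_iff not_le)
  qed
  have sims: "sim A u w'" "sim A v w" "sim A v w'"
    using w' less.prems adj_sim sim_trans sim_sym by blast+
  have Aflip: "A \<in> u \<longleftrightarrow> A \<notin> v" "A \<in> w \<longleftrightarrow> A \<notin> w'"
    using adj_iff[OF less.prems, of A] adj_iff[OF w'(1), of A] by auto
  have symT: "(y, x) \<in> tree\<^sup>*" if "(x, y) \<in> tree\<^sup>*" for x y
    using that sym_rtrancl[OF tree_sym] by (auto dest: symD)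
  show ?case
  proof (cases "A \<in> u \<longleftrightarrow> A \<in> w")
    case True
    then have "(u, w) \<in> tree\<^sup>*" "(v, w') \<in> tree\<^sup>*"
      using same V sims w'(2) Aflip by blast+
    then show ?thesis using ww' symT by (meson r_into_rtrancl rtrancl_trans)
  next
    case False
    then have "(u, w') \<in> tree\<^sup>*" "(v, w) \<in> tree\<^sup>*"
      using same V sims w'(2) Aflip by blast+
    then show ?thesis using ww' symT by (meson r_into_rtrancl rtrancl_trans)
  qed
qed

lemma tree_connected:
  assumes "u \<in> V" "v \<in> V"
  shows "(u, v) \<in> tree\<^sup>*"
proof -
  define n where "n = Suc (\<Sum>B\<in>sym_diff u v. col B)"
  have "col B < n" if "B \<in> sym_diff u v" for B
    using member_le_sum[OF that, of col] finite_diff[OF assms] by (simp add: n_def)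
  then show ?thesis using tree_connects_low[of n u v] tree_connects_adj assms by blast
qed

text \<open>A closed sequence that changes once must change back.\<close>

lemma cyclic_change:
  fixes P :: "nat \<Rightarrow> bool"
  assumes "P 0 = P (Suc m)" "i \<le> m" "P i \<noteq> P (Suc i)"
  shows "\<exists>j\<le>m. j \<noteq> i \<and> P j \<noteq> P (Suc j)"
proof (rule ccontr)
  assume "\<not> ?thesis"
  then have *: "P j = P (Suc j)" if "j \<le> m" "j \<noteq> i" for j using that by blast
  have "k \<le> i \<longrightarrow> P k = P 0" for k by (induction k) (use * assms(2) in auto)
  then have "P i = P 0" by blast
  moreover have "Suc i + k \<le> Suc m \<longrightarrow> P (Suc i + k) = P (Suc i)" for k
  proof (induction k)
    case (Suc k)
    then show ?case using *[of "Suc i + k"] by simp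
  qed simp
  from this[of "m - i"] have "P (Suc m) = P (Suc i)" using assms(2) by simp
  ultimately show False using assms(1,3) by simp
qed

text \<open>The wall of an edge is determined up to the choice of a side, and \<open>adj\<close>,
  \<open>sim\<close> and \<open>key\<close> do not depend on this choice.\<close>

lemma tree_edge:
  assumes "(u, v) \<in> tree" "A \<in> H" "A \<in> u \<longleftrightarrow> A \<notin> v"
  shows "adj A u v" "\<And>w w'. adj A w w' \<Longrightarrow> sim A u w \<Longrightarrow> min (key A u) (key A v) \<le> key A w"
proof -
  obtain A' where A': "A' \<in> H" "adj A' u v"
    "\<And>w w'. adj A' w w' \<Longrightarrow> sim A' u w \<Longrightarrow> min (key A' u) (key A' v) \<le> key A' w"
    using assms(1) by (auto simp: tree_def)
  have "A \<in> {A', neg A'}" using adj_iff[OF A'(2), of A] assms(3) by blast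
  then have "A = A' \<or> A = neg A'" by simp
  then have "adj A u v \<and> (\<forall>w w'. adj A w w' \<longrightarrow> sim A u w \<longrightarrow> min (key A u) (key A v) \<le> key A w)"
    using A' by (elim disjE) (simp_all add: adj_neg sim_neg key_neg)
  then show "adj A u v" "\<And>w w'. adj A w w' \<Longrightarrow> sim A u w \<Longrightarrow> min (key A u) (key A v) \<le> key A w"
    by blast+
qed

text \<open>
  Of the walls crossed by a cycle take one of the largest colour. It is crossed by two edges of the
  cycle, and these are separated by a wall of at least that colour, which the cycle also crosses and
  which crosses the given wall, so that its colour is larger.
\<close>

lemma tree_bridges: "bridges tree"
  unfolding bridges_def
proof (intro allI impI notI)
  fix u0 v0 assume e0: "(u0, v0) \<in> tree" "(v0, u0) \<in> (tree - {(u0, v0), (v0, u0)})\<^sup>*"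
  obtain p :: "nat \<Rightarrow> 'h set" and m where p: "2 \<le> m" "inj_on p {..m}" "p 0 = v0" "p m = u0"
    "\<And>i. i < m \<Longrightarrow> (p i, p (Suc i)) \<in> tree"
    using tree_irrefl e0 by (rule nonbridge_simple_cycle) blast
  \<comment> \<open>Closes the path up: the step from \<open>m\<close> to \<open>Suc m\<close> is
    the edge from \<open>u0\<close> back to \<open>v0\<close>.\<close>
  define q where "q k = (if k \<le> m then p k else p 0)" for k
  have q0: "q (Suc m) = q 0" by (simp add: q_def)
  have edge: "(q i, q (Suc i)) \<in> tree" if "i \<le> m" for i
  proof (cases "i = m")
    case True
    then show ?thesis using e0(1) p(3,4) by (simp add: q_def)
  next
    case False
    then show ?thesis using p(5)[of i] that by (simp add: q_def)
  qed
  have qV: "q i \<in> V" for i using edge tree_V by (metis SigmaD1 le0 nle_le q0 q_def subsetD)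
  have inj: "q i = q j \<longleftrightarrow> i = j" if "i \<le> m" "j \<le> m" for i j
    using that p(2) by (auto simp: q_def inj_on_def)
  have distinct: "\<not> (q i = q (Suc j) \<and> q (Suc i) = q j)" "q i \<noteq> q j" if "i \<le> m" "j \<le> m" "i \<noteq> j" for i j
  proof -
    show "q i \<noteq> q j" using that inj by blast
    show "\<not> (q i = q (Suc j) \<and> q (Suc i) = q j)"
    proof
      assume *: "q i = q (Suc j) \<and> q (Suc i) = q j"
      have "i = Suc j \<or> j = m \<and> i = 0"
        using * that inj[of i "Suc j"] inj[of i 0] q0 by (cases "j = m") auto
      moreover have "j = Suc i \<or> i = m \<and> j = 0"
        using * that inj[of "Suc i" j] inj[of 0 j] q0 by (cases "i = m") auto
      ultimately show False using p(1) by auto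
    qed
  qed
  have "\<exists>A. \<forall>i\<le>m. adj (A i) (q i) (q (Suc i))"
    using edge unfolding tree_def by (intro choice) blast
  then obtain A where A: "\<And>i. i \<le> m \<Longrightarrow> adj (A i) (q i) (q (Suc i))" by blast
  have "\<exists>i\<le>m. \<forall>j\<le>m. col (A j) \<le> col (A i)"
  proof -
    let ?f = "\<lambda>i. col (A i)"
    have "finite (?f ` {..m})" "?f ` {..m} \<noteq> {}" by auto
    from Max_in[OF this] obtain i where i: "i \<le> m" "Max (?f ` {..m}) = ?f i" by (metis (no_types) imageE atMost_iff)
    have "\<forall>j\<le>m. ?f j \<le> ?f i" unfolding i(2)[symmetric] by (intro allI impI Max_ge) auto
    then show ?thesis using i(1) by blast
  qed
  then obtain i where i: "i \<le> m" "\<And>j. j \<le> m \<Longrightarrow> col (A j) \<le> col (A i)" by blast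
  define W where "W = A i"
  have adj_i: "adj W (q i) (q (Suc i))" using A i(1) by (simp add: W_def)
  then have WH: "W \<in> H" by (rule adj_H)
  have flip_i: "W \<in> q i \<longleftrightarrow> W \<notin> q (Suc i)" using adj_iff[OF adj_i, of W] by auto
  obtain j where j: "j \<le> m" "j \<noteq> i" "W \<in> q j \<longleftrightarrow> W \<notin> q (Suc j)"
    using cyclic_change[of "\<lambda>k. W \<in> q k" m i] q0 i(1) flip_i by auto
  have adj_j: "adj W (q j) (q (Suc j))" using tree_edge(1)[OF edge[OF j(1)] WH j(3)] .
  \<comment> \<open>Two kept edges of one class have the same least key. As the key is injective
    they share an endpoint, hence they coincide, and the cycle would not be simple.\<close>
  have "\<not> sim W (q i) (q j)"
  proof
    assume sim: "sim W (q i) (q j)"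
    have sim': "sim W (q i) (q (Suc j))" "sim W (q j) (q (Suc i))"
      using sim adj_sim[OF adj_j] adj_sim[OF adj_i] sim_trans sim_sym by blast+
    let ?k = "key W"
    have "min (?k (q i)) (?k (q (Suc i))) \<le> ?k (q j)"
      using tree_edge(2)[OF edge[OF i(1)] WH flip_i adj_j sim] .
    moreover have "min (?k (q i)) (?k (q (Suc i))) \<le> ?k (q (Suc j))"
      using tree_edge(2)[OF edge[OF i(1)] WH flip_i adj_sym[OF adj_j] sim'(1)] .
    moreover have "min (?k (q j)) (?k (q (Suc j))) \<le> ?k (q i)"
      using tree_edge(2)[OF edge[OF j(1)] WH j(3) adj_i sim_sym[OF sim]] .
    moreover have "min (?k (q j)) (?k (q (Suc j))) \<le> ?k (q (Suc i))"
      using tree_edge(2)[OF edge[OF j(1)] WH j(3) adj_sym[OF adj_i] sim'(2)] .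
    ultimately have "?k (q i) = ?k (q j) \<or> ?k (q i) = ?k (q (Suc j)) \<or>
        ?k (q (Suc i)) = ?k (q j) \<or> ?k (q (Suc i)) = ?k (q (Suc j))"
      by (auto simp: min_def split: if_splits)
    then have "q i = q j \<or> q i = q (Suc j) \<or> q (Suc i) = q j \<or> q (Suc i) = q (Suc j)"
      using key_inj[OF WH] qV by (auto simp: inj_on_def)
    then have "q i = q j \<and> q (Suc i) = q (Suc j) \<or> q i = q (Suc j) \<and> q (Suc i) = q j"
      using adj_unique[OF adj_i] adj_unique[OF adj_sym[OF adj_i]] adj_j adj_sym[OF adj_j] by metis
    then show False using distinct[OF i(1) j(1)] j(2) by blast
  qed
  then obtain B where B: "B \<in> H" "col W \<le> col B" "B \<notin> {W, neg W}" "B \<in> q i \<longleftrightarrow> B \<notin> q j"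
    unfolding sim_def by blast
  have B_i: "B \<in> q i \<longleftrightarrow> B \<in> q (Suc i)" and B_j: "B \<in> q j \<longleftrightarrow> B \<in> q (Suc j)"
    using adj_iff[OF adj_i, of B] adj_iff[OF adj_j, of B] B(3) by blast+
  \<comment> \<open>All four quadrants of \<open>W\<close> and \<open>B\<close> are met: both edges
    cross \<open>W\<close>, neither crosses \<open>B\<close>, and they lie on different sides of
    \<open>B\<close>.\<close>
  have "\<exists>u\<in>V. (W \<in> u) = a \<and> (B \<in> u) = b" for a b
    using qV flip_i j(3) B_i B_j B(4) by metis
  then have "col W \<noteq> col B" using nested[OF WH B(1,3)] by blast
  then have less: "col W < col B" using B(2) by simp
  have "\<exists>k\<le>m. (B \<in> q k) \<noteq> (B \<in> q (Suc k))"
  proof (rule ccontr)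
    assume "\<not> ?thesis"
    then have "k \<le> m \<longrightarrow> (B \<in> q k) = (B \<in> q 0)" for k by (induction k) auto
    then show False using B(4) i(1) j(1) by blast
  qed
  then obtain k where k: "k \<le> m" "(B \<in> q k) \<noteq> (B \<in> q (Suc k))" by blast
  then have "B \<in> {A k, neg (A k)}" using adj_iff[OF A[OF k(1)], of B] by blast
  then have "col B = col (A k)" using col_neg[OF adj_H[OF A[OF k(1)]]] by auto
  then show False using i(2)[OF k(1)] less by (simp add: W_def)
qed

end

section \<open>Contracting Voronoi cells of a tree\<close>

text \<open>\<open>emb\<close> places the points of \<open>X\<close> in the tree.
  \<open>less\<close> is any linear order; \<open>finite_near\<close> ensures that among the nearest
  points there is a least one.\<close>

locale voronoi =
  fixes V :: "'v set" and T :: "('v \<times> 'v) set" and X :: "'a set" and emb :: "'a \<Rightarrow> 'v"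
    and less :: "'a \<Rightarrow> 'a \<Rightarrow> bool"
  assumes T_V: "T \<subseteq> V \<times> V" and T_sym: "sym T" and T_irrefl: "irrefl T" and T_bridges: "bridges T"
    and T_connected: "u \<in> V \<Longrightarrow> v \<in> V \<Longrightarrow> (u, v) \<in> T\<^sup>*"
    and emb: "x \<in> X \<Longrightarrow> emb x \<in> V" and emb_inj: "inj_on emb X" and X: "X \<noteq> {}"
    and finite_near: "u \<in> V \<Longrightarrow> finite {x \<in> X. (u, emb x) \<in> T ^^ n}"
    and less_irrefl: "\<not> less x x" and less_trans: "less x y \<Longrightarrow> less y z \<Longrightarrow> less x z"
    and less_total: "x \<in> X \<Longrightarrow> y \<in> X \<Longrightarrow> x \<noteq> y \<Longrightarrow> less x y \<or> less y x"
begin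

definition near :: "nat \<Rightarrow> 'v \<Rightarrow> 'a \<Rightarrow> bool" where
  "near n u x \<longleftrightarrow> x \<in> X \<and> (u, emb x) \<in> T ^^ n \<and> (\<forall>y\<in>X. \<forall>m<n. (u, emb y) \<notin> T ^^ m)"

definition cell :: "'v \<Rightarrow> 'a \<Rightarrow> bool" where
  "cell u x \<longleftrightarrow> (\<exists>n. near n u x \<and> (\<forall>y. near n u y \<longrightarrow> \<not> less y x))"

definition contraction :: "('a \<times> 'a) set" where
  "contraction = {(x, y). x \<noteq> y \<and> (\<exists>u v. (u, v) \<in> T \<and> cell u x \<and> cell v y)}"

lemma near_unique: "near m u x \<Longrightarrow> near n u y \<Longrightarrow> m = n"
  unfolding near_def by (metis nat_neq_iff)

lemma cell_unique: "cell u x \<Longrightarrow> cell u y \<Longrightarrow> x = y"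
  unfolding cell_def using near_unique less_total by (metis near_def)

lemma cell_ex:
  assumes "u \<in> V"
  shows "\<exists>x. cell u x"
proof -
  obtain x0 where "x0 \<in> X" using X by blast
  then have "(u, emb x0) \<in> T\<^sup>*" using T_connected assms emb by blast
  then have "\<exists>n. \<exists>x\<in>X. (u, emb x) \<in> T ^^ n" using \<open>x0 \<in> X\<close> by (auto simp: rtrancl_power)
  then obtain n x where "x \<in> X" "(u, emb x) \<in> T ^^ n" "\<And>m. m < n \<Longrightarrow> \<not> (\<exists>x\<in>X. (u, emb x) \<in> T ^^ m)"
    using exists_least_iff[of "\<lambda>n. \<exists>x\<in>X. (u, emb x) \<in> T ^^ n"] by blast
  then have "near n u x" by (auto simp: near_def)
  have "finite {x. near n u x}"
    by (rule finite_subset[OF _ finite_near[OF assms, of n]]) (auto simp: near_def)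
  moreover have "{x. near n u x} \<noteq> {}" using \<open>near n u x\<close> by blast
  moreover have "F \<subseteq> X \<Longrightarrow> \<exists>x\<in>F. \<forall>y\<in>F. \<not> less y x" if "finite F" "F \<noteq> {}" for F
    using that
  proof (induction rule: finite_ne_induct)
    case (singleton x)
    then show ?case using less_irrefl by auto
  next
    case (insert x F)
    then obtain z where "z \<in> F" "\<forall>y\<in>F. \<not> less y z" by auto
    then show ?case
      using less_irrefl less_trans by (cases "less x z") (metis insert_iff)+
  qed
  ultimately obtain z where "near n u z" "\<forall>y. near n u y \<longrightarrow> \<not> less y z"
    unfolding near_def by (smt (verit) mem_Collect_eq subsetI)
  then show ?thesis by (auto simp: cell_def)
qed

lemma cell_emb: "x \<in> X \<Longrightarrow> cell (emb x) x"
  unfolding cell_def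
proof (intro exI[of _ 0] conjI allI impI)
  assume "x \<in> X"
  then show "near 0 (emb x) x" by (simp add: near_def)
  fix y assume "near 0 (emb x) y"
  then have "y = x" using emb_inj \<open>x \<in> X\<close> by (auto simp: near_def inj_on_def)
  then show "\<not> less y x" using less_irrefl by simp
qed

definition fibre :: "'a \<Rightarrow> ('v \<times> 'v) set" where
  "fibre x = {(u, v) \<in> T. cell u x \<and> cell v x}"

text \<open>Cells are connected: a step from \<open>u\<close> towards its chosen point
  \<open>x\<close> stays in the cell, because a point preferable to \<open>x\<close> at the new
  vertex would have been preferable at \<open>u\<close> as well.\<close>

lemma cell_fibre: "cell u x \<Longrightarrow> (u, emb x) \<in> (fibre x)\<^sup>*"
proof -
  have "near n u x \<Longrightarrow> \<forall>y. near n u y \<longrightarrow> \<not> less y x \<Longrightarrow> (u, emb x) \<in> (fibre x)\<^sup>*" for n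
  proof (induction n arbitrary: u)
    case (Suc n)
    obtain v where v: "(u, v) \<in> T" "(v, emb x) \<in> T ^^ n"
      using Suc.prems(1) unfolding near_def by (metis relpow_Suc_D2)
    have "(v, emb y) \<notin> T ^^ m" if "y \<in> X" "m < n" for y m
    proof
      assume "(v, emb y) \<in> T ^^ m"
      then have "(u, emb y) \<in> T ^^ Suc m" using v(1) by (meson relpow_Suc_I2)
      then show False using Suc.prems(1) that unfolding near_def by (meson Suc_less_eq)
    qed
    then have near: "near n v x" using v Suc.prems(1) unfolding near_def by blast
    have min: "\<not> less y x" if "near n v y" for y
    proof -
      have "(u, emb y) \<in> T ^^ Suc n" using v(1) that unfolding near_def by (meson relpow_Suc_I2)
      then have "near (Suc n) u y" using that Suc.prems(1) unfolding near_def by blast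
      then show ?thesis using Suc.prems(2) by blast
    qed
    have "(u, v) \<in> fibre x"
      using v(1) Suc.prems near min unfolding fibre_def cell_def by blast
    then show ?case using Suc.IH[OF near] min by (meson converse_rtrancl_into_rtrancl)
  qed (simp add: near_def)
  then show "cell u x \<Longrightarrow> (u, emb x) \<in> (fibre x)\<^sup>*" unfolding cell_def by blast
qed

lemma fibre_sym: "sym (fibre x)"
  using T_sym by (auto simp: sym_def fibre_def)

lemma cell_fibre': "cell u x \<Longrightarrow> (emb x, u) \<in> (fibre x)\<^sup>*"
  using cell_fibre sym_rtrancl[OF fibre_sym] by (meson symD)

lemma contraction_sym: "sym contraction"
  using T_sym by (fastforce simp: sym_def contraction_def)

lemma cell_X: "cell u x \<Longrightarrow> x \<in> X"
  by (auto simp: cell_def near_def)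

lemma contraction_X: "contraction \<subseteq> X \<times> X"
  by (auto simp: contraction_def cell_X)

lemma contraction_irrefl: "irrefl contraction"
  by (auto simp: contraction_def irrefl_def)

lemma contraction_connected:
  assumes "x \<in> X" "y \<in> X"
  shows "(x, y) \<in> contraction\<^sup>*"
proof -
  have "(x, z) \<in> contraction\<^sup>*" if "(emb x, u) \<in> T\<^sup>*" "cell u z" for u z
    using that
  proof (induction arbitrary: z rule: rtrancl_induct)
    case base
    then show ?case using cell_unique cell_emb assms(1) by blast
  next
    case (step v u)
    obtain z' where z': "cell v z'" using cell_ex step(2) T_V by blast
    have "(z', z) \<in> contraction \<or> z' = z"
      using step(2,4) z' by (auto simp: contraction_def)
    then show ?case using step.IH[OF z'] by (auto intro: rtrancl_into_rtrancl)
  qed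
  then show ?thesis using T_connected emb assms cell_emb by blast
qed

text \<open>A detour around the edge \<open>x\<close>, \<open>y\<close> lifts to a detour around the
  tree edge \<open>u\<close>, \<open>v\<close> behind it. Moves inside a cell follow its fibre,
  which does not contain that edge since the edge joins two cells; moves between cells differ from
  it since the detour avoids the pair \<open>x\<close>, \<open>y\<close>.\<close>

lemma contraction_bridges: "bridges contraction"
  unfolding bridges_def
proof (intro allI impI notI)
  fix x y assume xy: "(x, y) \<in> contraction" "(y, x) \<in> (contraction - {(x, y), (y, x)})\<^sup>*"
  then obtain u v where uv: "(u, v) \<in> T" "cell u x" "cell v y" "x \<noteq> y"
    by (auto simp: contraction_def)
  let ?T = "T - {(u, v), (v, u)}"
  have fibre: "fibre z \<subseteq> ?T" for z
  proof -
    have "(u, v) \<notin> fibre z" "(v, u) \<notin> fibre z" using uv cell_unique unfolding fibre_def by blast+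
    then show ?thesis unfolding fibre_def by blast
  qed
  have path: "(s, t) \<in> ?T\<^sup>*" if "cell s z" "cell t z" for s t z
    using cell_fibre[OF that(1)] cell_fibre'[OF that(2)] rtrancl_mono[OF fibre[of z]]
    by (meson rtrancl_trans subsetD)
  have "(v, t) \<in> ?T\<^sup>*" if "(y, z) \<in> (contraction - {(x, y), (y, x)})\<^sup>*" "cell t z" for t z
    using that
  proof (induction arbitrary: t rule: rtrancl_induct)
    case base
    then show ?case using path uv(3) by blast
  next
    case (step a b)
    then obtain r s where rs: "(r, s) \<in> T" "cell r a" "cell s b" by (auto simp: contraction_def)
    have "(r, s) \<notin> {(u, v), (v, u)}"
      using step(2) rs uv cell_unique by blast
    then have "(r, s) \<in> ?T" using rs by blast
    then show ?case using step.IH[OF rs(2)] path[OF rs(3) step(4)]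
      by (meson rtrancl.rtrancl_into_rtrancl rtrancl_trans)
  qed
  then have "(v, u) \<in> ?T\<^sup>*" using xy(2) uv(2) by blast
  then show False using T_bridges uv(1) by (auto simp: bridges_def)
qed

end

section \<open>Walls in a locally finite connected graph\<close>

definition gball :: "('a \<times> 'a) set \<Rightarrow> nat \<Rightarrow> 'a \<Rightarrow> 'a set" where
  "gball G R x = {y. \<exists>n\<le>R. (x, y) \<in> G ^^ n}"

text \<open>
  The singletons, which \<open>half\<close> yields when \<open>z\<close> lies in the ball, are walls as well: they make
  \<open>towards\<close> below injective.
\<close>

definition half :: "('a \<times> 'a) set \<Rightarrow> nat \<Rightarrow> 'a \<Rightarrow> 'a \<Rightarrow> 'a set" where
  "half G R x z = (if z \<in> gball G R x then {x} else component (induced_graph G (- gball G R x)) z)"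

fun shalf :: "'a set \<Rightarrow> ('a \<times> 'a) set \<Rightarrow> nat \<Rightarrow> 'a \<times> 'a \<times> bool \<Rightarrow> 'a set" where
  "shalf C G R (x, z, s) = (if s then half G R x z else C - half G R x z)"

definition halves :: "'a set \<Rightarrow> ('a \<times> 'a) set \<Rightarrow> nat \<Rightarrow> 'a set set" where
  "halves C G R = shalf C G R ` (C \<times> C \<times> UNIV)"

definition towards :: "'a set \<Rightarrow> ('a \<times> 'a) set \<Rightarrow> nat \<Rightarrow> 'a \<Rightarrow> 'a set set" where
  "towards C G R x = {A \<in> halves C G R. x \<in> A}"

text \<open>The ultrafilters on the half-spaces that are almost equal to a principal one, that is,
  the vertices of the cube complex dual to a space with walls. The quantifier over all
  \<open>x\<close> avoids a base point; \<open>towards\<close> at two points of \<open>C\<close>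
  will be seen to differ finitely.\<close>

definition orientations :: "'a set \<Rightarrow> ('a \<times> 'a) set \<Rightarrow> nat \<Rightarrow> 'a set set set" where
  "orientations C G R = {u. u \<subseteq> halves C G R \<and> (\<forall>A\<in>halves C G R. C - A \<in> u \<longleftrightarrow> A \<notin> u) \<and>
     (\<forall>A\<in>u. \<forall>B\<in>u. A \<inter> B \<noteq> {}) \<and> (\<forall>x\<in>C. finite (sym_diff u (towards C G R x)))}"

text \<open>
  Reverse at the listed walls the orientation towards \<open>x\<close>. With the lists of \<open>pairs\<close> this codes the
  vertices of the cube by countably many finite lists of numbers.
\<close>

definition orient :: "'a set \<Rightarrow> ('a \<times> 'a) set \<Rightarrow> nat \<Rightarrow> 'a \<Rightarrow> ('a \<times> 'a) list \<Rightarrow> 'a set set" where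
  "orient C G R x L =
     sym_diff (towards C G R x) (\<Union>(y, z)\<in>set L. {half G R y z, C - half G R y z})"

definition centres :: "'a set \<Rightarrow> ('a \<times> 'a) set \<Rightarrow> nat \<Rightarrow> 'a set \<Rightarrow> 'a set" where
  "centres C G R A = {x \<in> C. \<exists>z\<in>C. \<exists>s. A = shalf C G R (x, z, s)}"

text \<open>One wall can arise from several balls. The least colour of a possible centre depends on
  the wall alone, and it is the same for both sides.\<close>

definition wall_colour :: "'a set \<Rightarrow> ('a \<times> 'a) set \<Rightarrow> nat \<Rightarrow> ('a \<Rightarrow> nat) \<Rightarrow> 'a set \<Rightarrow> nat" where
  "wall_colour C G R kap A = (LEAST n. \<exists>x\<in>centres C G R A. kap x = n)"

definition centre :: "'a set \<Rightarrow> ('a \<times> 'a) set \<Rightarrow> nat \<Rightarrow> ('a \<Rightarrow> nat) \<Rightarrow> 'a set \<Rightarrow> 'a" where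
  "centre C G R kap A = (THE x. x \<in> centres C G R A \<and> kap x = wall_colour C G R kap A)"

definition pairs :: "(nat \<Rightarrow> 'a \<Rightarrow> 'a) \<Rightarrow> 'a \<Rightarrow> (nat \<times> nat) list \<Rightarrow> ('a \<times> 'a) list" where
  "pairs f x c = map (\<lambda>(i, j). (f i x, f j x)) c"

text \<open>
  \<open>centre\<close> picks a point of each wall (a unique one exists when points with the same colour are far
  apart), relative to which the codes of orientations can be compared.
\<close>

definition wall_key :: "'a set \<Rightarrow> ('a \<times> 'a) set \<Rightarrow> nat \<Rightarrow> ('a \<Rightarrow> nat) \<Rightarrow> (nat \<Rightarrow> 'a \<Rightarrow> 'a) \<Rightarrow>
    'a set \<Rightarrow> 'a set set \<Rightarrow> nat" where
  "wall_key C G R kap f A u =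
     (LEAST n. orient C G R (centre C G R kap A) (pairs f (centre C G R kap A) (from_nat n)) = u)"

definition separators :: "'a set \<Rightarrow> ('a \<times> 'a) set \<Rightarrow> nat \<Rightarrow> 'a \<Rightarrow> 'a \<Rightarrow> ('a \<times> 'a) list \<Rightarrow> bool" where
  "separators C G R p q hs \<longleftrightarrow> set hs \<subseteq> C \<times> C \<and> distinct (map (\<lambda>h. half G R (fst h) (snd h)) hs) \<and>
     (\<forall>h\<in>set hs. p \<in> half G R (fst h) (snd h) \<and> q \<notin> half G R (fst h) (snd h))"

text \<open>
  The number of walls separating \<open>p\<close> from \<open>q\<close> tends to infinity with \<open>q\<close>. All quantifiers range over
  vertices, numbers and finite lists of vertices, so that this is a Borel condition.
\<close>

definition wide :: "'a set \<Rightarrow> ('a \<times> 'a) set \<Rightarrow> nat \<Rightarrow> bool" where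
  "wide C G R \<longleftrightarrow> (\<forall>p\<in>C. \<forall>n. \<exists>L. set L \<subseteq> C \<and>
     (\<forall>q\<in>C. q \<in> set L \<or> (\<exists>hs. length hs = n \<and> separators C G R p q hs)))"

lemma orient_mem: "A \<in> orient C G R x L \<longleftrightarrow>
    (A \<in> towards C G R x) \<noteq> (\<exists>p\<in>set L. A = half G R (fst p) (snd p) \<or> A = C - half G R (fst p) (snd p))"
proof -
  have "A \<in> (\<Union>(y, z)\<in>set L. {half G R y z, C - half G R y z}) \<longleftrightarrow>
      (\<exists>p\<in>set L. A = half G R (fst p) (snd p) \<or> A = C - half G R (fst p) (snd p))"
    by (simp add: case_prod_beta)
  then show ?thesis unfolding orient_def by blast
qed

lemma gballI: "(x, y) \<in> G ^^ n \<Longrightarrow> n \<le> R \<Longrightarrow> y \<in> gball G R x"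
  by (auto simp: gball_def)

lemma gballE:
  assumes "y \<in> gball G R x"
  obtains n where "n \<le> R" "(x, y) \<in> G ^^ n"
  using assms by (auto simp: gball_def)

lemma gball_self [simp]: "x \<in> gball G R x"
  by (rule gballI[where n = 0]) auto

lemma gball_mono: "R \<le> R' \<Longrightarrow> gball G R x \<subseteq> gball G R' x"
  by (meson gballE gballI le_trans subsetI)

lemma gball_step: "y \<in> gball G R x \<Longrightarrow> (y, z) \<in> G \<Longrightarrow> z \<in> gball G (Suc R) x"
  by (meson Suc_le_mono gballE gballI relpow_Suc_I)

lemma gball_sym: "sym G \<Longrightarrow> y \<in> gball G R x \<longleftrightarrow> x \<in> gball G R y"
  by (simp add: gball_def sym_relpow_iff[of G x y])

text \<open>\<open>G\<close> is the graph on the whole space. Since \<open>C\<close> is closed under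
  it, balls and halves around points of \<open>C\<close> can be computed in \<open>G\<close>
  itself.\<close>

locale connected_component =
  fixes C :: "'a set" and G :: "('a \<times> 'a) set"
  assumes sym_G: "sym G" and irrefl_G: "irrefl G"
    and closed: "x \<in> C \<Longrightarrow> (x, y) \<in> G \<Longrightarrow> y \<in> C"
    and connected: "x \<in> C \<Longrightarrow> y \<in> C \<Longrightarrow> (x, y) \<in> G\<^sup>*"
    and loc_finite: "x \<in> C \<Longrightarrow> finite (G `` {x})" and nonempty: "C \<noteq> {}"
begin

lemma gball_C: "x \<in> C \<Longrightarrow> gball G R x \<subseteq> C"
proof -
  have "(x, y) \<in> G ^^ n \<Longrightarrow> x \<in> C \<Longrightarrow> y \<in> C" for n y
    by (induction n arbitrary: y) (auto intro: closed)
  then show "x \<in> C \<Longrightarrow> gball G R x \<subseteq> C" by (auto simp: gball_def)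
qed

lemma finite_gball: "x \<in> C \<Longrightarrow> finite (gball G R x)"
proof (induction R)
  case 0
  have "gball G 0 x = {x}" by (auto simp: gball_def)
  then show ?case by simp
next
  case (Suc R)
  have "gball G (Suc R) x \<subseteq> gball G R x \<union> (\<Union>y\<in>gball G R x. G `` {y})"
  proof
    fix z assume "z \<in> gball G (Suc R) x"
    then obtain n where n: "n \<le> Suc R" "(x, z) \<in> G ^^ n" by (auto simp: gball_def)
    show "z \<in> gball G R x \<union> (\<Union>y\<in>gball G R x. G `` {y})"
    proof (cases "n \<le> R")
      case True
      then show ?thesis using n by (auto simp: gball_def)
    next
      case False
      then have "(x, z) \<in> G ^^ Suc R" using n by (simp add: le_Suc_eq)
      then obtain y where "(x, y) \<in> G ^^ R" "(y, z) \<in> G" by auto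
      then show ?thesis by (auto simp: gball_def)
    qed
  qed
  moreover have "finite (gball G R x \<union> (\<Union>y\<in>gball G R x. G `` {y}))"
    using Suc loc_finite gball_C by blast
  ultimately show ?case by (rule finite_subset)
qed

lemma gball_connected:
  assumes "y \<in> gball G R x"
  shows "(x, y) \<in> (induced_graph G (gball G R x))\<^sup>*"
proof -
  have "(x, y) \<in> G ^^ n \<Longrightarrow> n \<le> R \<Longrightarrow> (x, y) \<in> (induced_graph G (gball G R x))\<^sup>*" for n y
  proof (induction n arbitrary: y)
    case (Suc n)
    then obtain z where z: "(x, z) \<in> G ^^ n" "(z, y) \<in> G" by auto
    then have "z \<in> gball G R x" "y \<in> gball G R x"
      using Suc.prems gballI[where n = n and y = z] gballI[where n = "Suc n" and y = y] by auto
    then have "(z, y) \<in> induced_graph G (gball G R x)" using z by (simp add: induced_graph_def)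
    then show ?case using Suc.IH[OF z(1)] Suc.prems(2) by (meson Suc_leD rtrancl.rtrancl_into_rtrancl)
  qed simp
  then show ?thesis using assms by (auto simp: gball_def)
qed

lemma induced_sym: "sym ((induced_graph G S)\<^sup>*)"
  using sym_G by (intro sym_rtrancl) (auto simp: induced_graph_def sym_def)

lemma induced_mono: "S \<subseteq> S' \<Longrightarrow> (x, y) \<in> (induced_graph G S)\<^sup>* \<Longrightarrow> (x, y) \<in> (induced_graph G S')\<^sup>*"
  by (rule subsetD[OF rtrancl_mono]) (auto simp: induced_graph_def)

lemma half_inside: "z \<in> gball G R x \<Longrightarrow> half G R x z = {x}"
  by (simp add: half_def)

lemma half_outside: "z \<notin> gball G R x \<Longrightarrow> p \<in> half G R x z \<longleftrightarrow> (z, p) \<in> (induced_graph G (- gball G R x))\<^sup>*"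
  by (simp add: half_def component_def)

lemma half_avoids: "z \<notin> gball G R x \<Longrightarrow> p \<in> half G R x z \<Longrightarrow> p \<notin> gball G R x"
  unfolding half_outside by (erule rtranclE) (auto simp: induced_graph_def)

lemma half_path:
  assumes "z \<notin> gball G R x" "p \<in> half G R x z" "(p, q) \<in> (induced_graph G S)\<^sup>*" "S \<inter> gball G R x = {}"
  shows "q \<in> half G R x z"
proof -
  have "(p, q) \<in> (induced_graph G (- gball G R x))\<^sup>*"
    using assms(3) by (rule induced_mono[rotated]) (use assms(4) in auto)
  then show ?thesis using assms(1,2) by (auto simp: half_outside)
qed

lemma half_eq:
  assumes z: "z \<notin> gball G R x" and p: "p \<in> half G R x z"
  shows "half G R x p = half G R x z"
proof (rule set_eqI)
  fix q
  let ?H = "(induced_graph G (- gball G R x))\<^sup>*"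
  have zp: "(z, p) \<in> ?H" using p half_outside[OF z] by blast
  then have pz: "(p, z) \<in> ?H" by (rule symD[OF induced_sym])
  have "q \<in> half G R x p \<longleftrightarrow> (p, q) \<in> ?H" by (rule half_outside[OF half_avoids[OF z p]])
  also have "\<dots> \<longleftrightarrow> (z, q) \<in> ?H" using zp pz by (meson rtrancl_trans)
  also have "\<dots> \<longleftrightarrow> q \<in> half G R x z" by (rule half_outside[OF z, symmetric])
  finally show "q \<in> half G R x p \<longleftrightarrow> q \<in> half G R x z" .
qed

lemma half_C: "x \<in> C \<Longrightarrow> z \<in> C \<Longrightarrow> half G R x z \<subseteq> C"
proof -
  have "(z, p) \<in> (induced_graph G S)\<^sup>* \<Longrightarrow> z \<in> C \<Longrightarrow> p \<in> C" for p S
    by (induction rule: rtrancl_induct) (auto simp: induced_graph_def intro: closed)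
  then show "x \<in> C \<Longrightarrow> z \<in> C \<Longrightarrow> half G R x z \<subseteq> C"
    by (cases "z \<in> gball G R x") (auto simp: half_inside half_outside)
qed

text \<open>A half that is a component off the ball can only be left into the ball, so the inner
  endpoint of such an edge is at most one step beyond radius \<open>R\<close>. An edge leaving a
  singleton half starts at the centre.\<close>

lemma half_boundary:
  assumes "(p, q) \<in> G" "p \<in> half G R x z" "q \<notin> half G R x z"
  shows "p \<in> gball G (Suc R) x" "q \<in> gball G (Suc R) x" "z \<notin> gball G R x \<Longrightarrow> q \<in> gball G R x"
proof -
  have sub: "gball G R x \<subseteq> gball G (Suc R) x" by (rule gball_mono) simp
  show q: "q \<in> gball G R x" if "z \<notin> gball G R x"
  proof (rule ccontr)
    assume "q \<notin> gball G R x"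
    then have "(p, q) \<in> induced_graph G (- gball G R x)"
      using assms that half_avoids by (auto simp: induced_graph_def)
    then show False using half_path[OF that assms(2), of q "- gball G R x"] assms(3) by auto
  qed
  have qp: "(q, p) \<in> G" using assms(1) sym_G by (rule symD[rotated])
  show "p \<in> gball G (Suc R) x" "q \<in> gball G (Suc R) x"
  proof (atomize(full), cases "z \<in> gball G R x")
    case True
    then have "p = x" using assms(2) by (simp add: half_inside)
    then show "p \<in> gball G (Suc R) x \<and> q \<in> gball G (Suc R) x" using assms(1) gball_step[of x G R x q] by simp
  next
    case False
    then show "p \<in> gball G (Suc R) x \<and> q \<in> gball G (Suc R) x"
      using q[OF False] sub gball_step[OF _ qp] by blast
  qed
qed

text \<open>A path from \<open>x\<close> may pass through the half, but it comes out in the ball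
  around \<open>x\<close>, which is connected and disjoint from the half.\<close>

lemma half_complement_connected:
  assumes x: "x \<in> C" and z: "z \<notin> gball G R x" and p: "p \<in> C - half G R x z"
  shows "(x, p) \<in> (induced_graph G (C - half G R x z))\<^sup>*"
proof -
  have "(x, p) \<in> G\<^sup>*" using connected x p by blast
  then have "p \<notin> half G R x z \<longrightarrow> (x, p) \<in> (induced_graph G (C - half G R x z))\<^sup>*" and "p \<in> C"
  proof (induction rule: rtrancl_induct)
    case (step a b)
    show "b \<in> C" using step closed by blast
    show "b \<notin> half G R x z \<longrightarrow> (x, b) \<in> (induced_graph G (C - half G R x z))\<^sup>*"
    proof
      assume b: "b \<notin> half G R x z"
      show "(x, b) \<in> (induced_graph G (C - half G R x z))\<^sup>*"
      proof (cases "a \<in> half G R x z")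
        case True
        then have "b \<in> gball G R x" using half_boundary(3)[OF step(2) _ b z] by blast
        moreover have "gball G R x \<subseteq> C - half G R x z"
          using gball_C[OF x, of R] half_avoids[OF z] by blast
        ultimately show ?thesis using gball_connected induced_mono by blast
      next
        case False
        then have "(a, b) \<in> induced_graph G (C - half G R x z)"
          using step b closed by (auto simp: induced_graph_def)
        then show ?thesis using step.IH False by (meson rtrancl.rtrancl_into_rtrancl)
      qed
    qed
  qed (use x in auto)
  then show ?thesis using p by blast
qed

lemma half_connected:
  assumes "z \<notin> gball G R x" "p \<in> half G R x z" "q \<in> half G R x z"
  shows "(p, q) \<in> (induced_graph G (half G R x z))\<^sup>*"
proof -
  let ?H = "induced_graph G (- gball G R x)"
  have half: "half G R x z = component ?H z" using assms(1) by (simp add: half_def)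
  have "graph_on UNIV ?H"
    using sym_G irrefl_G by (auto simp: graph_on_def induced_graph_def sym_def irrefl_def)
  from connected_graph_component[OF this, of z]
  have "(p, q) \<in> (induced_graph ?H (component ?H z))\<^sup>*"
    using assms(2,3) unfolding half connected_graph_def by blast
  then show ?thesis
    unfolding half by (rule subsetD[OF rtrancl_mono, rotated]) (auto simp: induced_graph_def)
qed

text \<open>A connected set that misses the ball around \<open>y\<close> lies on one side of
  \<open>W\<close>. If \<open>y\<close> is in \<open>Z\<close>, then so is its whole ball, and
  \<open>C - Z\<close> is such a set; otherwise \<open>Z\<close> is.\<close>

lemma halves_nested_aux:
  assumes x: "x \<in> C" and y: "y \<in> C" and z: "z \<notin> gball G R x" and w: "w \<notin> gball G R y"
    and disj: "gball G R x \<inter> gball G R y = {}"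
  defines "Z \<equiv> half G R x z" and "W \<equiv> half G R y w"
  shows "Z \<inter> W = {} \<or> Z \<inter> (C - W) = {} \<or> (C - Z) \<inter> W = {} \<or> (C - Z) \<inter> (C - W) = {}"
proof (cases "y \<in> Z")
  case True
  have "gball G R y \<subseteq> Z"
    using half_path[OF z True[unfolded Z_def] gball_connected] disj unfolding Z_def by blast
  then have disj': "(C - Z) \<inter> gball G R y = {}" by blast
  have "q \<in> W" if p: "p \<in> C - Z" "p \<in> W" and q: "q \<in> C - Z" for p q
  proof -
    have "(p, x) \<in> (induced_graph G (C - Z))\<^sup>*" "(x, q) \<in> (induced_graph G (C - Z))\<^sup>*"
      using half_complement_connected[OF x z] p q symD[OF induced_sym] unfolding Z_def by blast+
    then have "(p, q) \<in> (induced_graph G (C - Z))\<^sup>*" by (rule rtrancl_trans)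
    then show ?thesis using half_path[OF w p(2)[unfolded W_def]] disj' unfolding W_def by blast
  qed
  then show ?thesis by blast
next
  case False
  have disj': "Z \<inter> gball G R y = {}"
  proof (rule ccontr)
    assume "Z \<inter> gball G R y \<noteq> {}"
    then obtain p where p: "p \<in> Z" "p \<in> gball G R y" by blast
    then have "(p, y) \<in> (induced_graph G (gball G R y))\<^sup>*"
      using symD[OF induced_sym gball_connected] by blast
    then have "y \<in> Z" using half_path[OF z p(1)[unfolded Z_def]] disj unfolding Z_def by blast
    then show False using False by blast
  qed
  have "q \<in> W" if p: "p \<in> Z" "p \<in> W" and q: "q \<in> Z" for p q
  proof -
    have "(p, q) \<in> (induced_graph G Z)\<^sup>*" using half_connected[OF z] p q unfolding Z_def by blast
    then show ?thesis using half_path[OF w p(2)[unfolded W_def]] disj' unfolding W_def by blast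
  qed
  then show ?thesis by blast
qed

lemma halves_nested:
  assumes x: "x \<in> C" and y: "y \<in> C" and z: "z \<in> C" and w: "w \<in> C"
    and disj: "x = y \<or> gball G R x \<inter> gball G R y = {}"
  defines "Z \<equiv> half G R x z" and "W \<equiv> half G R y w"
  shows "Z \<inter> W = {} \<or> Z \<inter> (C - W) = {} \<or> (C - Z) \<inter> W = {} \<or> (C - Z) \<inter> (C - W) = {}"
proof (cases "z \<in> gball G R x \<or> w \<in> gball G R y")
  case True
  then have "(\<exists>a. Z = {a}) \<or> (\<exists>a. W = {a})" by (auto simp: Z_def W_def half_inside)
  then show ?thesis by auto
next
  case False
  then have zw: "z \<notin> gball G R x" "w \<notin> gball G R y" by auto
  show ?thesis
  proof (cases "x = y")
    case True
    have "Z = W" if "p \<in> Z" "p \<in> W" for p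
      using half_eq[of z R x p] half_eq[of w R y p] zw that True unfolding Z_def W_def by simp
    then show ?thesis by blast
  next
    case False
    then have "gball G R x \<inter> gball G R y = {}" using disj by blast
    from halves_nested_aux[OF x y zw this] show ?thesis unfolding Z_def W_def .
  qed
qed

lemma shalf_neg: "x \<in> C \<Longrightarrow> z \<in> C \<Longrightarrow> C - shalf C G R (x, z, s) = shalf C G R (x, z, \<not> s)"
  using half_C[of x z R] by auto

lemma halvesI: "x \<in> C \<Longrightarrow> z \<in> C \<Longrightarrow> shalf C G R (x, z, s) \<in> halves C G R"
  unfolding halves_def by blast

lemma halvesE:
  assumes "A \<in> halves C G R"
  obtains x z s where "x \<in> C" "z \<in> C" "A = shalf C G R (x, z, s)"
  using assms unfolding halves_def by blast

lemma halves_C: "A \<in> halves C G R \<Longrightarrow> A \<subseteq> C"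
  by (erule halvesE) (use half_C in \<open>auto split: if_splits\<close>)

lemma neg_halves: "A \<in> halves C G R \<Longrightarrow> C - A \<in> halves C G R"
  by (erule halvesE) (simp only: shalf_neg halvesI)

lemma neg_neg: "A \<in> halves C G R \<Longrightarrow> C - (C - A) = A"
  using halves_C by blast

section \<open>Walls between points, and orientations as vertices of a partial cube\<close>

text \<open>A wall between adjacent \<open>p\<close> and \<open>q\<close> has its centre within
  \<open>Suc R\<close> of \<open>p\<close>, and its half is the component of \<open>p\<close>, the
  component of \<open>q\<close>, or the singleton of the centre. This leaves finitely many
  possibilities.\<close>

lemma finite_towards_diff_edge:
  assumes "p \<in> C" "(p, q) \<in> G"
  shows "finite (sym_diff (towards C G R p) (towards C G R q))"
proof -
  have q: "q \<in> C" using assms closed by blast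
  have qp: "(q, p) \<in> G" using assms(2) sym_G by (rule symD[rotated])
  let ?F = "shalf C G R ` (\<Union>x\<in>gball G (Suc R) p. {x} \<times> {p, q, x} \<times> UNIV)"
  have "sym_diff (towards C G R p) (towards C G R q) \<subseteq> ?F"
  proof
    fix A assume "A \<in> sym_diff (towards C G R p) (towards C G R q)"
    then have A: "A \<in> halves C G R" "(p \<in> A) \<noteq> (q \<in> A)" by (auto simp: towards_def)
    then obtain x z s where xz: "x \<in> C" "z \<in> C" "A = shalf C G R (x, z, s)" by (elim halvesE)
    have ne: "(p \<in> half G R x z) \<noteq> (q \<in> half G R x z)"
      using A(2) assms(1) q xz(3) by (cases s) auto
    then have "p \<in> gball G (Suc R) x"
      using half_boundary(1,2)[of p q R x z] half_boundary(1,2)[of q p R x z] assms(2) qp by blast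
    then have x: "x \<in> gball G (Suc R) p" using gball_sym[OF sym_G] by blast
    have "\<exists>w\<in>{p, q, x}. half G R x z = half G R x w"
    proof (cases "z \<in> gball G R x")
      case True
      then show ?thesis by (auto simp: half_inside)
    next
      case False
      then show ?thesis using half_eq[OF False] ne by blast
    qed
    then obtain w where w: "w \<in> {p, q, x}" "half G R x z = half G R x w" by blast
    then have "A = shalf C G R (x, w, s)" using xz(3) by simp
    then show "A \<in> ?F" using x w(1) by blast
  qed
  moreover have "finite ?F"
    using finite_gball[OF assms(1)] by (intro finite_imageI finite_UN_I finite_cartesian_product) auto
  ultimately show ?thesis by (rule finite_subset)
qed

lemma finite_towards_diff:
  assumes "p \<in> C" "q \<in> C"
  shows "finite (sym_diff (towards C G R p) (towards C G R q))"
proof -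
  have "finite (sym_diff (towards C G R p) (towards C G R q)) \<and> q \<in> C"
    using connected[OF assms]
  proof (induction rule: rtrancl_induct)
    case (step a b)
    have "sym_diff (towards C G R p) (towards C G R b) \<subseteq>
        sym_diff (towards C G R p) (towards C G R a) \<union> sym_diff (towards C G R a) (towards C G R b)"
      by blast
    moreover have "finite (sym_diff (towards C G R a) (towards C G R b))"
      using finite_towards_diff_edge step by blast
    ultimately show ?case using step closed by (meson finite_UnI finite_subset)
  qed (use assms in simp)
  then show ?thesis ..
qed

lemma towards_neg: "x \<in> C \<Longrightarrow> A \<in> halves C G R \<Longrightarrow> C - A \<in> towards C G R x \<longleftrightarrow> A \<notin> towards C G R x"
  using neg_halves by (auto simp: towards_def)

lemma towards_orientation: "x \<in> C \<Longrightarrow> towards C G R x \<in> orientations C G R"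
  unfolding orientations_def
  using towards_neg finite_towards_diff by (auto simp: towards_def)

lemma orientationD:
  assumes "u \<in> orientations C G R"
  shows "u \<subseteq> halves C G R" "A \<in> halves C G R \<Longrightarrow> C - A \<in> u \<longleftrightarrow> A \<notin> u"
    "A \<in> u \<Longrightarrow> B \<in> u \<Longrightarrow> A \<inter> B \<noteq> {}" "x \<in> C \<Longrightarrow> finite (sym_diff u (towards C G R x))"
  using assms unfolding orientations_def by blast+

lemma finite_orientation_diff:
  assumes "u \<in> orientations C G R" "v \<in> orientations C G R"
  shows "finite (sym_diff u v)"
proof -
  obtain x where "x \<in> C" using nonempty by blast
  then have "finite (sym_diff u (towards C G R x) \<union> sym_diff v (towards C G R x))"
    using assms orientationD(4) by blast
  then show ?thesis by (rule finite_subset[rotated]) blast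
qed

text \<open>Reverse an inclusion-minimal \<open>A\<close> in \<open>u - v\<close>. A member of
  \<open>u\<close> disjoint from \<open>C - A\<close> and other than \<open>A\<close> lies inside
  \<open>A\<close>, so by minimality it belongs to \<open>v\<close>, which also contains
  \<open>C - A\<close>: this contradicts consistency of \<open>v\<close>.\<close>

lemma orientation_geodesic:
  assumes u: "u \<in> orientations C G R" and v: "v \<in> orientations C G R" and "u \<noteq> v"
  shows "\<exists>A w. w \<in> orientations C G R \<and> A \<in> sym_diff u v \<and> sym_diff u w = {A, C - A}"
proof -
  note uD = orientationD[OF u] and vD = orientationD[OF v]
  have "u - v \<noteq> {}"
  proof
    assume "u - v = {}"
    then obtain B where B: "B \<in> v" "B \<notin> u" using \<open>u \<noteq> v\<close> by blast
    then have "B \<in> halves C G R" using vD(1) by blast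
    then have "C - B \<in> u" "C - B \<notin> v" using uD(2) vD(2) B by blast+
    then show False using \<open>u - v = {}\<close> by blast
  qed
  moreover have "finite (u - v)" using finite_orientation_diff[OF u v] by simp
  ultimately obtain A where A: "A \<in> u - v" and min: "\<And>B. B \<in> u - v \<Longrightarrow> B \<subseteq> A \<Longrightarrow> B = A"
    using finite_has_minimal[of "u - v"] by metis
  have AH: "A \<in> halves C G R" using A uD(1) by blast
  have nA: "C - A \<in> halves C G R" "C - A \<in> v" "C - A \<notin> u"
    using neg_halves[OF AH] uD(2)[OF AH] vD(2)[OF AH] A by blast+
  define w where "w = insert (C - A) (u - {A})"
  have sd: "sym_diff u w = {A, C - A}" using A nA(3) by (auto simp: w_def)
  have cons: "(C - A) \<inter> B \<noteq> {}" if B: "B \<in> u" "B \<noteq> A" for B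
  proof
    assume "(C - A) \<inter> B = {}"
    then have "B \<subseteq> A" using halves_C uD(1) B(1) by blast
    then have "B \<in> v" using min B by blast
    then show False using vD(3)[OF nA(2)] \<open>(C - A) \<inter> B = {}\<close> by blast
  qed
  have "w \<in> orientations C G R"
    unfolding orientations_def
  proof (intro CollectI conjI ballI)
    show "w \<subseteq> halves C G R" using uD(1) nA(1) by (auto simp: w_def)
  next
    fix B assume B: "B \<in> halves C G R"
    have "C - B = A \<longleftrightarrow> B = C - A" using B AH halves_C by blast
    moreover have "C - B = C - A \<longleftrightarrow> B = A" using B AH halves_C by blast
    ultimately show "C - B \<in> w \<longleftrightarrow> B \<notin> w" using uD(2)[OF B] A nA(3) unfolding w_def by auto
  next
    fix B D assume "B \<in> w" "D \<in> w"
    moreover have "(C - A) \<inter> (C - A) \<noteq> {}" using vD(3)[OF nA(2) nA(2)] .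
    moreover have "B \<inter> D \<noteq> {}" if "B \<in> u" "D \<in> u" using uD(3) that by blast
    ultimately show "B \<inter> D \<noteq> {}" using cons[of B] cons[of D] unfolding w_def by blast
  next
    fix x assume "x \<in> C"
    then have "finite (sym_diff u (towards C G R x) \<union> {A, C - A})" using uD(4) by blast
    then show "finite (sym_diff w (towards C G R x))"
      by (rule finite_subset[rotated]) (auto simp: w_def)
  qed
  then show ?thesis using A sd by blast
qed

text \<open>The difference from \<open>towards C G R x\<close> is finite and closed under
  complements, hence a finite union of pairs of opposite half-spaces, each given by two
  vertices.\<close>

lemma orient_surj:
  assumes u: "u \<in> orientations C G R" and x: "x \<in> C" and f: "C = range (\<lambda>i. f i x)"
  shows "\<exists>c. orient C G R x (pairs f x c) = u"
proof -
  let ?D = "sym_diff u (towards C G R x)"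
  have "finite ?D" using orientationD(4)[OF u x] .
  then obtain l where l: "set l = ?D" using finite_list by blast
  have "\<exists>c. A = half G R (f (fst c) x) (f (snd c) x) \<or> C - A = half G R (f (fst c) x) (f (snd c) x)"
    if "A \<in> ?D" for A
  proof -
    have "A \<in> halves C G R" using that orientationD(1)[OF u] by (auto simp: towards_def)
    then obtain y z s where yz: "y \<in> C" "z \<in> C" "A = shalf C G R (y, z, s)" by (elim halvesE)
    obtain i j where ij: "y = f i x" "z = f j x" using yz(1,2) f by blast
    have "A = half G R y z \<or> C - A = half G R y z"
      using yz half_C[OF yz(1,2), of R] by (cases s) auto
    then show ?thesis using ij by (intro exI[of _ "(i, j)"]) simp
  qed
  then obtain g where g: "\<And>A. A \<in> ?D \<Longrightarrow>
      A = half G R (f (fst (g A)) x) (f (snd (g A)) x) \<or> C - A = half G R (f (fst (g A)) x) (f (snd (g A)) x)"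
    by metis
  have D_neg: "C - A \<in> ?D" "C - (C - A) = A" if "A \<in> ?D" for A
  proof -
    have "A \<in> halves C G R" using that orientationD(1)[OF u] by (auto simp: towards_def)
    then show "C - A \<in> ?D" "C - (C - A) = A"
      using that orientationD(2)[OF u] towards_neg[OF x] neg_neg by blast+
  qed
  define a where "a A = half G R (f (fst (g A)) x) (f (snd (g A)) x)" for A
  have a: "A = a A \<or> C - A = a A" if "A \<in> ?D" for A using g[OF that] unfolding a_def .
  have mem: "(\<exists>p\<in>set (pairs f x (map g l)). B = half G R (fst p) (snd p) \<or> B = C - half G R (fst p) (snd p))
      \<longleftrightarrow> (\<exists>A\<in>?D. B = a A \<or> B = C - a A)" for B
    unfolding l[symmetric] by (simp add: pairs_def a_def case_prod_beta)
  have "(\<exists>A\<in>?D. B = a A \<or> B = C - a A) \<longleftrightarrow> B \<in> ?D" for B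
  proof
    assume "\<exists>A\<in>?D. B = a A \<or> B = C - a A"
    then obtain A where A: "A \<in> ?D" "B = a A \<or> B = C - a A" by blast
    then have "B = A \<or> B = C - A" using a[OF A(1)] D_neg(2)[OF A(1)] by metis
    then show "B \<in> ?D" using A(1) D_neg(1) by blast
  next
    assume B: "B \<in> ?D"
    then have "B = a B \<or> B = C - a B" using a[OF B] D_neg(2)[OF B] by metis
    then show "\<exists>A\<in>?D. B = a A \<or> B = C - a A" using B by blast
  qed
  then have "B \<in> orient C G R x (pairs f x (map g l)) \<longleftrightarrow> B \<in> u" for B
    unfolding orient_mem mem by blast
  then show ?thesis by blast
qed

lemma orient_halves:
  assumes "set L \<subseteq> C \<times> C"
  shows "orient C G R x L \<subseteq> halves C G R"
proof -
  have "half G R y z \<in> halves C G R" "C - half G R y z \<in> halves C G R" if "(y, z) \<in> set L" for y z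
    using halvesI[of y z R True] halvesI[of y z R False] that assms by auto
  then show ?thesis unfolding orient_def towards_def by blast
qed

lemma orient_neg:
  assumes x: "x \<in> C" and L: "set L \<subseteq> C \<times> C" and A: "A \<in> halves C G R"
  shows "C - A \<in> orient C G R x L \<longleftrightarrow> A \<notin> orient C G R x L"
proof -
  let ?U = "\<Union>(y, z)\<in>set L. {half G R y z, C - half G R y z}"
  have "C - A \<in> ?U \<longleftrightarrow> A \<in> ?U"
  proof -
    have "C - A \<in> {half G R y z, C - half G R y z} \<longleftrightarrow> A \<in> {half G R y z, C - half G R y z}"
      if "(y, z) \<in> set L" for y z
      using that L half_C[of y z R] halves_C[OF A] by blast
    then show ?thesis by fastforce
  qed
  then show ?thesis using towards_neg[OF x A] unfolding orient_def by blast
qed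

text \<open>Reversing finitely many walls preserves everything except consistency, so consistency is
  all that remains to be expressed when Borelness is proved.\<close>

lemma orient_orientation_iff:
  assumes x: "x \<in> C" and L: "set L \<subseteq> C \<times> C"
  shows "orient C G R x L \<in> orientations C G R \<longleftrightarrow>
    (\<forall>A\<in>halves C G R. \<forall>B\<in>halves C G R. A \<in> orient C G R x L \<longrightarrow> B \<in> orient C G R x L \<longrightarrow> A \<inter> B \<noteq> {})"
proof -
  let ?U = "\<Union>(y, z)\<in>set L. {half G R y z, C - half G R y z}"
  have "finite (sym_diff (orient C G R x L) (towards C G R y))" if "y \<in> C" for y
  proof -
    have "finite (?U \<union> sym_diff (towards C G R x) (towards C G R y))"
      using finite_towards_diff[OF x that] by auto
    then show ?thesis by (rule finite_subset[rotated]) (auto simp: orient_def)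
  qed
  then show ?thesis
    using orient_halves[OF L] orient_neg[OF x L] unfolding orientations_def by blast
qed

text \<open>Properness of the points in the cube: \<open>Suc n\<close> distinct separating halves
  already make the symmetric difference larger than \<open>n\<close>.\<close>

lemma wide_finite:
  assumes "wide C G R" "x \<in> C"
  shows "finite {y \<in> C. card (sym_diff (towards C G R x) (towards C G R y)) \<le> n}"
proof -
  obtain L where L: "\<forall>q\<in>C. q \<in> set L \<or> (\<exists>hs. length hs = Suc n \<and> separators C G R x q hs)"
    using assms unfolding wide_def by blast
  have "q \<in> set L" if q: "q \<in> C" "card (sym_diff (towards C G R x) (towards C G R q)) \<le> n" for q
  proof (rule ccontr)
    assume "q \<notin> set L"
    then obtain hs where hs: "length hs = Suc n" "separators C G R x q hs" using L q(1) by blast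
    let ?h = "\<lambda>h. half G R (fst h) (snd h)"
    have "set (map ?h hs) \<subseteq> sym_diff (towards C G R x) (towards C G R q)"
    proof
      fix A assume "A \<in> set (map ?h hs)"
      then obtain h where h: "h \<in> set hs" "A = ?h h" by auto
      then have "fst h \<in> C" "snd h \<in> C" "x \<in> A" "q \<notin> A"
        using hs(2) unfolding separators_def by auto
      moreover from this have "A \<in> halves C G R"
        using halvesI[of "fst h" "snd h" R True] h(2) by simp
      ultimately show "A \<in> sym_diff (towards C G R x) (towards C G R q)" by (auto simp: towards_def)
    qed
    then have "card (set (map ?h hs)) \<le> card (sym_diff (towards C G R x) (towards C G R q))"
      by (rule card_mono[OF finite_towards_diff[OF assms(2) q(1)]])
    moreover have "card (set (map ?h hs)) = Suc n"
      using hs unfolding separators_def by (metis distinct_card length_map)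
    ultimately show False using q(2) by simp
  qed
  then show ?thesis by (intro finite_subset[OF _ finite_set[of L]]) blast
qed

end

section \<open>The spanning tree of the cube of orientations\<close>

text \<open>The colouring uses radius \<open>Suc R\<close> because an edge across a wall may reach
  one step beyond the ball. This gives more than nestedness: two centres of one wall never have the
  same colour.\<close>

locale walled_component = connected_component +
  fixes R :: nat and kap :: "'a \<Rightarrow> nat" and f :: "nat \<Rightarrow> 'a \<Rightarrow> 'a" and less :: "'a \<Rightarrow> 'a \<Rightarrow> bool"
  assumes wide: "wide C G R"
    and kap: "x \<in> C \<Longrightarrow> y \<in> C \<Longrightarrow> x \<noteq> y \<Longrightarrow> kap x = kap y \<Longrightarrow>
      gball G (Suc R) x \<inter> gball G (Suc R) y = {}"
    and enum: "x \<in> C \<Longrightarrow> C = range (\<lambda>i. f i x)"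
    and less_irrefl: "\<not> less x x" and less_trans: "less x y \<Longrightarrow> less y z \<Longrightarrow> less x z"
    and less_total: "x \<in> C \<Longrightarrow> y \<in> C \<Longrightarrow> x \<noteq> y \<Longrightarrow> less x y \<or> less y x"
begin

lemma centres_neg:
  assumes "A \<in> halves C G R"
  shows "centres C G R (C - A) = centres C G R A"
proof -
  have sub: "centres C G R B \<subseteq> centres C G R (C - B)" for B
  proof
    fix x assume "x \<in> centres C G R B"
    then obtain z s where xz: "x \<in> C" "z \<in> C" "B = shalf C G R (x, z, s)" unfolding centres_def by blast
    then have "C - B = shalf C G R (x, z, \<not> s)" using shalf_neg by blast
    then show "x \<in> centres C G R (C - B)" using xz unfolding centres_def by blast
  qed
  show ?thesis using sub[of A] sub[of "C - A"] neg_neg[OF assms] by auto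
qed

lemma boundary_centre:
  assumes "(a, b) \<in> G" "a \<in> A" "b \<notin> A" "a \<in> C" "x \<in> centres C G R A"
  shows "a \<in> gball G (Suc R) x"
proof -
  obtain z s where A: "A = shalf C G R (x, z, s)" using assms(5) unfolding centres_def by blast
  have ba: "(b, a) \<in> G" using assms(1) sym_G by (rule symD[rotated])
  have "b \<in> C" using assms(1,4) closed by blast
  then have "(a \<in> half G R x z) \<noteq> (b \<in> half G R x z)" using assms A by (cases s) auto
  then show ?thesis using half_boundary(1)[OF assms(1)] half_boundary(2)[OF ba] by blast
qed

text \<open>An edge that crosses the wall starts within \<open>Suc R\<close> of every centre. If
  there is no crossing edge, one side is empty, which forces \<open>C\<close> to be a single
  vertex.\<close>

lemma centres_meet:
  assumes x: "x \<in> centres C G R A" and y: "y \<in> centres C G R A"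
  shows "gball G (Suc R) x \<inter> gball G (Suc R) y \<noteq> {}"
proof (cases "\<exists>p q. p \<in> A \<and> p \<in> C \<and> q \<in> C - A")
  case True
  then obtain p q where pq: "p \<in> A" "p \<in> C" "q \<in> C - A" by blast
  let ?H = "G \<inter> C \<times> C"
  have "(p, b) \<in> ?H\<^sup>* \<and> b \<in> C" if "(p, b) \<in> G\<^sup>*" for b
    using that
  proof (induction rule: rtrancl_induct)
    case (step b c)
    then have "(b, c) \<in> ?H" using closed by blast
    then show ?case using step by (auto intro: rtrancl_into_rtrancl)
  qed (use pq in simp)
  then have "(p, q) \<in> ?H\<^sup>*" using connected pq by blast
  then obtain a b where "(a, b) \<in> ?H" "a \<in> A" "b \<notin> A"
    using relation_path_change[of p q ?H "\<lambda>v. v \<in> A"] pq by blast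
  then have "a \<in> gball G (Suc R) x" "a \<in> gball G (Suc R) y"
    using boundary_centre x y by blast+
  then show ?thesis by blast
next
  case False
  have "\<exists>u. C = {u}" if vA: "v \<in> centres C G R A" for v
  proof -
    obtain z s where v: "v \<in> C" "z \<in> C" and A: "A = shalf C G R (v, z, s)"
      using vA unfolding centres_def by blast
    have ne: "\<exists>p\<in>C. p \<in> half G R v z"
      using v by (cases "z \<in> gball G R v") (auto simp: half_inside half_outside)
    have "C \<subseteq> half G R v z"
      using False ne A by (cases s) auto
    then have "v \<in> half G R v z" using v by blast
    then have "z \<in> gball G R v" using half_avoids[of z R v v] by auto
    then show ?thesis using \<open>C \<subseteq> half G R v z\<close> v by (auto simp: half_inside)
  qed
  then have "x = y" using x y unfolding centres_def by blast
  moreover have "x \<in> gball G (Suc R) x" by simp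
  ultimately show ?thesis by blast
qed

lemma centre:
  assumes "A \<in> halves C G R"
  shows "centre C G R kap A \<in> centres C G R A" "kap (centre C G R kap A) = wall_colour C G R kap A"
    "\<And>x. x \<in> centres C G R A \<Longrightarrow> kap x = wall_colour C G R kap A \<Longrightarrow> x = centre C G R kap A"
proof -
  obtain x0 z s where "x0 \<in> C" "z \<in> C" "A = shalf C G R (x0, z, s)" using assms by (rule halvesE)
  then have "x0 \<in> centres C G R A" unfolding centres_def by blast
  then have "\<exists>n. \<exists>x\<in>centres C G R A. kap x = n" by blast
  then have "\<exists>x\<in>centres C G R A. kap x = wall_colour C G R kap A"
    unfolding wall_colour_def by (rule LeastI_ex)
  then obtain x where x: "x \<in> centres C G R A" "kap x = wall_colour C G R kap A" by blast
  have uniq: "y = x" if "y \<in> centres C G R A" "kap y = wall_colour C G R kap A" for y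
  proof (rule ccontr)
    assume "y \<noteq> x"
    moreover have "x \<in> C" "y \<in> C" using x that unfolding centres_def by blast+
    ultimately show False using kap[of y x] centres_meet[OF that(1) x(1)] x(2) that(2) by simp
  qed
  have "centre C G R kap A = x"
    unfolding centre_def by (rule the_equality) (use x uniq in blast)+
  then show "centre C G R kap A \<in> centres C G R A" "kap (centre C G R kap A) = wall_colour C G R kap A"
    "\<And>x. x \<in> centres C G R A \<Longrightarrow> kap x = wall_colour C G R kap A \<Longrightarrow> x = centre C G R kap A"
    using x uniq by blast+
qed

text \<open>Centres of equal colour coincide or have disjoint balls, so some choice of sides is
  disjoint, and a consistent orientation cannot contain both of these sides.\<close>

lemma wall_nested:
  assumes A: "A \<in> halves C G R" and B: "B \<in> halves C G R"
    and col: "wall_colour C G R kap A = wall_colour C G R kap B"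
  shows "\<exists>a b. \<forall>u\<in>orientations C G R. \<not> ((A \<in> u) = a \<and> (B \<in> u) = b)"
proof -
  define x y where "x = centre C G R kap A" and "y = centre C G R kap B"
  have xC: "x \<in> centres C G R A" and yC: "y \<in> centres C G R B" using centre A B unfolding x_def y_def by blast+
  obtain z s where xz: "x \<in> C" "z \<in> C" "A = shalf C G R (x, z, s)" using xC unfolding centres_def by blast
  obtain w t where yw: "y \<in> C" "w \<in> C" "B = shalf C G R (y, w, t)" using yC unfolding centres_def by blast
  have "kap x = kap y" using centre A B col unfolding x_def y_def by simp
  then have "x = y \<or> gball G (Suc R) x \<inter> gball G (Suc R) y = {}" using kap xz(1) yw(1) by blast
  moreover have "gball G R v \<subseteq> gball G (Suc R) v" for v by (rule gball_mono) simp
  ultimately have "x = y \<or> gball G R x \<inter> gball G R y = {}" by blast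
  from halves_nested[OF xz(1) yw(1) xz(2) yw(2) this]
  obtain a b where ab: "shalf C G R (x, z, a) \<inter> shalf C G R (y, w, b) = {}"
    by (metis shalf.simps)
  have mem: "(shalf C G R (x', z', a') \<in> u) = ((shalf C G R (x', z', s') \<in> u) = (a' = s'))"
    if u: "u \<in> orientations C G R" and "x' \<in> C" "z' \<in> C" for u x' z' a' s'
  proof (cases "a' = s'")
    case False
    then have a': "a' = (\<not> s')" by auto
    have "shalf C G R (x', z', a') = C - shalf C G R (x', z', s')"
      unfolding a' by (rule shalf_neg[OF that(2,3), symmetric])
    then show ?thesis using orientationD(2)[OF u halvesI[OF that(2,3)], of s'] False by simp
  qed simp
  have "\<not> ((A \<in> u) = (a = s) \<and> (B \<in> u) = (b = t))" if u: "u \<in> orientations C G R" for u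
    using orientationD(3)[OF u] ab mem[OF u xz(1,2), of a s] mem[OF u yw(1,2), of b t] xz(3) yw(3) by metis
  then show ?thesis by blast
qed

lemma wall_key_inj:
  assumes A: "A \<in> halves C G R"
  shows "inj_on (wall_key C G R kap f A) (orientations C G R)"
proof (rule inj_onI)
  define x where "x = centre C G R kap A"
  have x: "x \<in> C" using centre(1)[OF A] unfolding centres_def x_def by blast
  have key: "orient C G R x (pairs f x (from_nat (wall_key C G R kap f A u))) = u"
    if u: "u \<in> orientations C G R" for u
  proof -
    obtain c where "orient C G R x (pairs f x c) = u" using orient_surj[where f = f, OF u x enum[OF x]] by blast
    then have "\<exists>n. orient C G R x (pairs f x (from_nat n)) = u" by (metis from_nat_to_nat)
    then show ?thesis unfolding wall_key_def x_def[symmetric] by (rule LeastI_ex)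
  qed
  fix u v assume "u \<in> orientations C G R" "v \<in> orientations C G R"
    "wall_key C G R kap f A u = wall_key C G R kap f A v"
  then show "u = v" using key by metis
qed

sublocale cube: coloured_cube "orientations C G R" "halves C G R" "\<lambda>A. C - A"
  "wall_colour C G R kap" "wall_key C G R kap f"
proof
  fix A assume A: "A \<in> halves C G R"
  show "C - A \<in> halves C G R" using A by (rule neg_halves)
  show "C - (C - A) = A" using A by (rule neg_neg)
  show col: "wall_colour C G R kap (C - A) = wall_colour C G R kap A"
    unfolding wall_colour_def centres_neg[OF A] ..
  have "centre C G R kap (C - A) = centre C G R kap A"
    unfolding centre_def centres_neg[OF A] col ..
  then show "wall_key C G R kap f (C - A) = wall_key C G R kap f A"
    unfolding wall_key_def by simp
  show "inj_on (wall_key C G R kap f A) (orientations C G R)" using A by (rule wall_key_inj)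
next
  fix u assume u: "u \<in> orientations C G R"
  show "u \<subseteq> halves C G R" using orientationD(1)[OF u] .
  fix A assume "A \<in> halves C G R"
  then show "C - A \<in> u \<longleftrightarrow> A \<notin> u" using orientationD(2)[OF u] by blast
next
  fix u v assume "u \<in> orientations C G R" "v \<in> orientations C G R"
  then show "finite (sym_diff u v)" by (rule finite_orientation_diff)
next
  fix u v assume "u \<in> orientations C G R" "v \<in> orientations C G R" "u \<noteq> v"
  then show "\<exists>A w. w \<in> orientations C G R \<and> A \<in> sym_diff u v \<and> sym_diff u w = {A, C - A}"
    by (rule orientation_geodesic)
next
  fix A B assume "A \<in> halves C G R" "B \<in> halves C G R" "B \<notin> {A, C - A}"
    "wall_colour C G R kap A = wall_colour C G R kap B"
  then show "\<exists>a b. \<forall>u\<in>orientations C G R. \<not> ((A \<in> u) = a \<and> (B \<in> u) = b)"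
    using wall_nested by blast
qed

text \<open>A tree edge reverses one wall, that is, two half-spaces; hence the factor 2.\<close>

lemma tree_pow_diff:
  assumes "(u, v) \<in> cube.tree ^^ n" "u \<in> orientations C G R"
  shows "v \<in> orientations C G R \<and> card (sym_diff u v) \<le> 2 * n"
  using assms(1)
proof (induction n arbitrary: v)
  case (Suc n)
  then obtain w where w: "(u, w) \<in> cube.tree ^^ n" "(w, v) \<in> cube.tree" by auto
  then obtain A where A: "w \<in> orientations C G R" "v \<in> orientations C G R" "sym_diff w v = {A, C - A}"
    by (auto simp: cube.tree_def cube.adj_def)
  have "sym_diff u v \<subseteq> sym_diff u w \<union> {A, C - A}" unfolding A(3)[symmetric] by blast
  then have "card (sym_diff u v) \<le> card (sym_diff u w \<union> {A, C - A})"
    using finite_orientation_diff[OF assms(2) A(1)] by (intro card_mono) auto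
  also have "\<dots> \<le> card (sym_diff u w) + card {A, C - A}" by (rule card_Un_le)
  also have "\<dots> \<le> 2 * n + 2"
    using Suc.IH[OF w(1)] by (intro add_mono) (auto simp: card_insert_if)
  finally show ?case using A(2) by simp
qed (use assms in simp)

sublocale cells: voronoi "orientations C G R" cube.tree C "towards C G R" less
proof
  show "cube.tree \<subseteq> orientations C G R \<times> orientations C G R" by (rule cube.tree_V)
  show "sym cube.tree" by (rule cube.tree_sym)
  show "irrefl cube.tree" by (rule cube.tree_irrefl)
  show "bridges cube.tree" by (rule cube.tree_bridges)
  show "\<And>u v. u \<in> orientations C G R \<Longrightarrow> v \<in> orientations C G R \<Longrightarrow> (u, v) \<in> cube.tree\<^sup>*"
    by (rule cube.tree_connected)
  show "\<And>x. x \<in> C \<Longrightarrow> towards C G R x \<in> orientations C G R" by (rule towards_orientation)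
  show "inj_on (towards C G R) C"
  proof (rule inj_onI)
    fix x y assume xy: "x \<in> C" "y \<in> C" "towards C G R x = towards C G R y"
    have "{x} \<in> halves C G R" using halvesI[OF xy(1,1), of R True] by (simp add: half_inside)
    then have "{x} \<in> towards C G R x" by (simp add: towards_def)
    then have "{x} \<in> towards C G R y" by (simp only: xy(3))
    then show "x = y" by (simp add: towards_def)
  qed
  show "C \<noteq> {}" by (rule nonempty)
  show "finite {x \<in> C. (u, towards C G R x) \<in> cube.tree ^^ n}" (is "finite ?S")
    if u: "u \<in> orientations C G R" for u n
  proof (cases "?S = {}")
    case False
    then obtain x where x: "x \<in> C" "(u, towards C G R x) \<in> cube.tree ^^ n" by blast
    \<comment> \<open>Both points are reached from \<open>u\<close> by \<open>n\<close> tree edges,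
      each path contributing at most \<open>2 * n\<close>.\<close>
    have "?S \<subseteq> {y \<in> C. card (sym_diff (towards C G R x) (towards C G R y)) \<le> 4 * n}"
    proof
      fix y assume y: "y \<in> ?S"
      have "sym_diff (towards C G R x) (towards C G R y) \<subseteq>
          sym_diff u (towards C G R x) \<union> sym_diff u (towards C G R y)" by blast
      then have "card (sym_diff (towards C G R x) (towards C G R y)) \<le>
          card (sym_diff u (towards C G R x) \<union> sym_diff u (towards C G R y))"
        using x y orientationD(4)[OF u] by (intro card_mono) auto
      also have "\<dots> \<le> card (sym_diff u (towards C G R x)) + card (sym_diff u (towards C G R y))"
        by (rule card_Un_le)
      also have "\<dots> \<le> 2 * n + 2 * n"
        using x y tree_pow_diff[OF _ u] by (intro add_mono) auto
      finally show "y \<in> {y \<in> C. card (sym_diff (towards C G R x) (towards C G R y)) \<le> 4 * n}"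
        using y by simp
    qed
    then show ?thesis using wide_finite[OF wide x(1)] by (rule finite_subset)
  next
    case True
    show ?thesis unfolding True by (rule finite.emptyI)
  qed
  show "\<And>x. \<not> less x x" by (rule less_irrefl)
  show "\<And>x y z. less x y \<Longrightarrow> less y z \<Longrightarrow> less x z" by (rule less_trans)
  show "\<And>x y. x \<in> C \<Longrightarrow> y \<in> C \<Longrightarrow> x \<noteq> y \<Longrightarrow> less x y \<or> less y x" by (rule less_total)
qed

end

section \<open>Walls in quasi-trees\<close>

text \<open>A walk avoiding \<open>P k\<close>, completed by the two remaining parts of the path,
  would join \<open>P k\<close> to \<open>P (Suc k)\<close> without using the edge between them,
  which is a bridge.\<close>

lemma tree_geodesic_separates:
  fixes P :: "nat \<Rightarrow> 'b"
  assumes T: "sym T" "bridges T" and P: "\<And>i. i < n \<Longrightarrow> (P i, P (Suc i)) \<in> T" "inj_on P {..n}"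
    and k: "k < n"
  shows "(P 0, P n) \<notin> (induced_graph T (- {P k}))\<^sup>*"
proof
  assume walk: "(P 0, P n) \<in> (induced_graph T (- {P k}))\<^sup>*"
  let ?T = "T - {(P (Suc k), P k), (P k, P (Suc k))}"
  have symT: "(y, x) \<in> ?T\<^sup>*" if "(x, y) \<in> ?T\<^sup>*" for x y
  proof -
    have "sym ?T" using T(1) by (auto simp: sym_def)
    then show ?thesis using that by (meson sym_rtrancl symD)
  qed
  have inj: "P i = P j \<longleftrightarrow> i = j" if "i \<le> n" "j \<le> n" for i j
    using P(2) that by (auto simp: inj_on_def)
  have edge: "(P i, P (Suc i)) \<in> ?T" if "i < n" "i \<noteq> k" for i
    using that P(1)[of i] k inj[of i k] inj[of i "Suc k"] inj[of "Suc i" k] by auto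
  have "(P 0, P i) \<in> ?T\<^sup>*" if "i \<le> k" for i
    using that
  proof (induction i)
    case (Suc i)
    then show ?case using edge[of i] k by (auto intro: rtrancl_into_rtrancl)
  qed simp
  then have "(P k, P 0) \<in> ?T\<^sup>*" using symT by blast
  moreover have "(P 0, P n) \<in> ?T\<^sup>*"
    by (rule subsetD[OF rtrancl_mono walk]) (auto simp: induced_graph_def)
  moreover have "(P (Suc k), P (Suc k + i)) \<in> ?T\<^sup>*" if "Suc k + i \<le> n" for i
    using that
  proof (induction i)
    case (Suc i)
    then show ?case using edge[of "Suc k + i"] by (auto intro: rtrancl_into_rtrancl)
  qed simp
  from this[of "n - Suc k"] have "(P n, P (Suc k)) \<in> ?T\<^sup>*" using symT k by simp
  ultimately have "(P k, P (Suc k)) \<in> ?T\<^sup>*" by (meson rtrancl_trans)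
  moreover have "(P (Suc k), P k) \<in> T" using P(1)[OF k] T(1) by (auto dest: symD)
  ultimately show False using T(2) unfolding bridges_def by blast
qed

lemma path_dist_attained:
  assumes "connected_graph V H" "x \<in> V" "y \<in> V"
  obtains n where "path_dist H x y = real n" "(x, y) \<in> H ^^ n" "\<And>m. (x, y) \<in> H ^^ m \<Longrightarrow> n \<le> m"
proof -
  have "(x, y) \<in> H\<^sup>*" using assms by (simp add: connected_graph_def)
  then have "\<exists>n. (x, y) \<in> H ^^ n" by (simp add: rtrancl_power)
  then have "(x, y) \<in> H ^^ (LEAST n. (x, y) \<in> H ^^ n)" by (rule LeastI_ex)
  then show thesis by (intro that[of "LEAST n. (x, y) \<in> H ^^ n"]) (auto simp: path_dist_def intro: Least_le)
qed

lemma path_dist_le: "(x, y) \<in> H ^^ n \<Longrightarrow> path_dist H x y \<le> real n"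
  by (simp add: path_dist_def Least_le)

lemma geodesic_exists:
  assumes H: "connected_graph V H" and xy: "x \<in> V" "y \<in> V"
  obtains P n where "P 0 = x" "P n = y" "path_dist H x y = real n"
    "\<And>i. i < n \<Longrightarrow> (P i, P (Suc i)) \<in> H" "\<And>i. i \<le> n \<Longrightarrow> P i \<in> V"
    "\<And>i j. i \<le> j \<Longrightarrow> j \<le> n \<Longrightarrow> path_dist H (P i) (P j) = real (j - i)"
proof -
  obtain n where n: "path_dist H x y = real n" "(x, y) \<in> H ^^ n" "\<And>m. (x, y) \<in> H ^^ m \<Longrightarrow> n \<le> m"
    using path_dist_attained[OF assms] by blast
  obtain P where P: "P 0 = x" "P n = y" "\<And>i. i < n \<Longrightarrow> (P i, P (Suc i)) \<in> H"
    using n(2) by (auto simp: relpow_fun_conv)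
  have HV: "H \<subseteq> V \<times> V" using H by (simp add: connected_graph_def graph_on_def)
  have PV: "P i \<in> V" if "i \<le> n" for i
  proof (cases i)
    case (Suc j)
    then have "(P j, P i) \<in> H" using P(3)[of j] that by simp
    then show ?thesis using HV by blast
  qed (use P(1) xy(1) in simp)
  have sub: "(P i, P j) \<in> H ^^ (j - i)" if "i \<le> j" "j \<le> n" for i j
    unfolding relpow_fun_conv
    using that P(3) by (intro exI[of _ "\<lambda>k. P (i + k)"]) auto
  have "path_dist H (P i) (P j) = real (j - i)" if ij: "i \<le> j" "j \<le> n" for i j
  proof (rule antisym)
    show "path_dist H (P i) (P j) \<le> real (j - i)" using sub[OF ij] by (rule path_dist_le)
    have "P i \<in> V" "P j \<in> V" using PV ij by auto
    from path_dist_attained[OF H this] obtain m where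
      m: "path_dist H (P i) (P j) = real m" "(P i, P j) \<in> H ^^ m" by blast
    have "(x, y) \<in> H ^^ (i + m + (n - j))"
    proof -
      have "(x, P i) \<in> H ^^ i" "(P j, y) \<in> H ^^ (n - j)"
        using sub[of 0 i] sub[of j n] ij P(1,2) by simp_all
      then show ?thesis using m(2) unfolding relpow_add by blast
    qed
    then have "n \<le> i + m + (n - j)" by (rule n(3))
    then have "j - i \<le> m" using ij by linarith
    then show "real (j - i) \<le> path_dist H (P i) (P j)" unfolding m(1) by simp
  qed
  with P n(1) PV show thesis by (intro that[of P n]) auto
qed

context connected_component
begin

lemma induced_relpow: "x \<in> C \<Longrightarrow> (x, y) \<in> induced_graph G C ^^ n \<longleftrightarrow> (x, y) \<in> G ^^ n"
proof (induction n arbitrary: y)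
  case (Suc n)
  have "z \<in> C" if "(x, z) \<in> G ^^ n" for z
    using that gballI[OF that order_refl] gball_C[OF Suc.prems] by blast
  then have "(x, z) \<in> G ^^ n \<and> (z, y) \<in> induced_graph G C \<longleftrightarrow> (x, z) \<in> G ^^ n \<and> (z, y) \<in> G" for z
    using closed by (auto simp: induced_graph_def)
  then show ?case using Suc by (simp add: relcomp_unfold)
qed simp

lemma connected_graph_C: "connected_graph C (induced_graph G C)"
proof -
  have "graph_on C (induced_graph G C)"
    using sym_G irrefl_G by (auto simp: graph_on_def induced_graph_def sym_def irrefl_def)
  moreover have "(x, y) \<in> (induced_graph G C)\<^sup>*" if "x \<in> C" "y \<in> C" for x y
    using connected[OF that] induced_relpow[OF that(1)] by (simp add: rtrancl_power)
  ultimately show ?thesis by (simp add: connected_graph_def)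
qed

lemma path_dist_gball:
  assumes "x \<in> C" "y \<in> C"
  shows "path_dist (induced_graph G C) x y \<le> real n \<longleftrightarrow> y \<in> gball G n x"
proof
  assume "path_dist (induced_graph G C) x y \<le> real n"
  then show "y \<in> gball G n x"
    using path_dist_attained[OF connected_graph_C assms] induced_relpow[OF assms(1)]
    by (metis gballI of_nat_le_iff)
next
  assume "y \<in> gball G n x"
  then obtain m where "m \<le> n" "(x, y) \<in> G ^^ m" by (rule gballE)
  then show "path_dist (induced_graph G C) x y \<le> real n"
    using path_dist_le[where H = "induced_graph G C" and x = x and y = y and n = m] induced_relpow[OF assms(1)] by simp
qed

text \<open>Vertices outside the ball have images farther than \<open>2 * K\<close> from
  \<open>P k\<close>, while adjacent vertices have images at most \<open>2 * K\<close> apart. Tree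
  geodesics between consecutive images thus miss \<open>P k\<close>, and a path around the ball
  would become a walk around \<open>P k\<close>.\<close>

lemma quasi_tree_separation:
  fixes T :: "('b \<times> 'b) set" and h :: "'a \<Rightarrow> 'b" and g :: "'b \<Rightarrow> 'a" and P :: "nat \<Rightarrow> 'b"
  defines "dC \<equiv> path_dist (induced_graph G C)" and "dT \<equiv> path_dist T"
  assumes T: "tree_graph W T" and h: "h \<in> C \<rightarrow> W" and g: "g \<in> W \<rightarrow> C"
    and hK: "\<And>x x'. x \<in> C \<Longrightarrow> x' \<in> C \<Longrightarrow> dT (h x) (h x') \<le> K * dC x x' + K"
    and gK: "\<And>y y'. y \<in> W \<Longrightarrow> y' \<in> W \<Longrightarrow> dC (g y) (g y') \<le> K * dT y y' + K"
    and gh: "\<And>x. x \<in> C \<Longrightarrow> dC x (g (h x)) \<le> K" and K: "0 \<le> K"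
    and pq: "p \<in> C" "q \<in> C" and P: "P 0 = h p" "P n = h q"
    and PT: "\<And>i. i < n \<Longrightarrow> (P i, P (Suc i)) \<in> T" and Pinj: "inj_on P {..n}"
    and k: "k < n" and Pk: "P k \<in> W" and R: "2 * K * K + 2 * K \<le> real R"
  shows "(p, q) \<notin> (induced_graph G (- gball G R (g (P k))))\<^sup>*"
proof
  define w where "w = P k"
  define S where "S = - gball G R (g w)"
  assume "(p, q) \<in> (induced_graph G (- gball G R (g (P k))))\<^sup>*"
  then have walk: "(p, q) \<in> (induced_graph G S)\<^sup>*" by (simp add: S_def w_def)
  have conT: "connected_graph W T" and ac: "acyclic_graph T" using T by (auto simp: tree_graph_def)
  have symT: "sym T" and irT: "irrefl T" and TW: "T \<subseteq> W \<times> W"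
    using conT by (auto simp: connected_graph_def graph_on_def)
  interpret dC: Metric_space C dC unfolding dC_def by (rule Metric_space_path_dist[OF connected_graph_C])
  interpret dT: Metric_space W dT unfolding dT_def by (rule Metric_space_path_dist[OF conT])
  have w: "w \<in> W" "g w \<in> C" using Pk g by (auto simp: w_def)
  \<comment> \<open>The source of the bound on \<open>R\<close>: if \<open>dT w (h x)\<close> is at
    most \<open>2 * K\<close>, then \<open>dC (g w) x\<close> is at most
    \<open>(2 * K * K + K) + K\<close>.\<close>
  have far: "2 * K < dT w (h x)" if x: "x \<in> C" "x \<in> S" for x
  proof (rule ccontr)
    assume "\<not> 2 * K < dT w (h x)"
    then have "K * dT w (h x) \<le> K * (2 * K)" using K by (intro mult_left_mono) auto
    moreover have hx: "h x \<in> W" "g (h x) \<in> C" using x h g by auto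
    moreover have "dC (g w) x \<le> dC (g w) (g (h x)) + dC (g (h x)) x"
      using w hx x by (intro dC.triangle) auto
    moreover have "dC (g (h x)) x \<le> K" using gh[OF x(1)] dC.commute by metis
    ultimately have "dC (g w) x \<le> real R" using gK[OF w(1) hx(1)] R by (simp add: algebra_simps)
    then have "x \<in> gball G R (g w)" using path_dist_gball[OF w(2) x(1)] by (simp add: dC_def)
    then show False using x(2) by (simp add: S_def)
  qed
  have lift: "(h x, h y) \<in> (induced_graph T (- {w}))\<^sup>*"
    if xy: "(x, y) \<in> G" "x \<in> C" "x \<in> S" "y \<in> C" for x y
  proof -
    have hxy: "h x \<in> W" "h y \<in> W" using xy h by auto
    obtain Q m where Q: "Q 0 = h x" "Q m = h y" "dT (h x) (h y) = real m"
      "\<And>i. i < m \<Longrightarrow> (Q i, Q (Suc i)) \<in> T" "\<And>i. i \<le> m \<Longrightarrow> Q i \<in> W"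
      "\<And>i j. i \<le> j \<Longrightarrow> j \<le> m \<Longrightarrow> dT (Q i) (Q j) = real (j - i)"
      using geodesic_exists[OF conT hxy] unfolding dT_def by blast
    have "y \<in> gball G 1 x" using gballI[of x y 1 G 1] xy(1) by simp
    then have "dC x y \<le> 1" using path_dist_gball[OF xy(2,4), of 1] by (simp add: dC_def)
    then have "K * dC x y \<le> K * 1" using K by (intro mult_left_mono) auto
    then have m: "real m \<le> 2 * K" using hK[OF xy(2,4)] Q(3) by simp
    have avoid: "Q i \<noteq> w" if "i \<le> m" for i
    proof
      assume "Q i = w"
      then have "dT (h x) w = real i" using Q(6)[of 0 i] Q(1) that by simp
      then show False using far[OF xy(2,3)] m that dT.commute[of w "h x"] by simp
    qed
    have "(Q 0, Q i) \<in> (induced_graph T (- {w}))\<^sup>*" if "i \<le> m" for i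
      using that
    proof (induction i)
      case (Suc i)
      then have "(Q i, Q (Suc i)) \<in> induced_graph T (- {w})"
        using Q(4)[of i] avoid[of i] avoid[of "Suc i"] by (simp add: induced_graph_def)
      then show ?case using Suc by (simp add: rtrancl_into_rtrancl)
    qed simp
    from this[of m] show ?thesis using Q(1,2) by simp
  qed
  have "(h p, h x) \<in> (induced_graph T (- {w}))\<^sup>* \<and> x \<in> C" if "(p, x) \<in> (induced_graph G S)\<^sup>*" for x
    using that
  proof (induction rule: rtrancl_induct)
    case (step x y)
    then have "(x, y) \<in> G" "x \<in> C" "x \<in> S" by (auto simp: induced_graph_def)
    moreover from this have y: "y \<in> C" using closed by blast
    ultimately have "(h x, h y) \<in> (induced_graph T (- {w}))\<^sup>*" using lift by blast
    then show ?case using y step.IH by (meson rtrancl_trans)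
  qed (use pq in simp)
  then have "(P 0, P n) \<in> (induced_graph T (- {P k}))\<^sup>*" using walk P by (simp add: w_def)
  then show False
    using tree_geodesic_separates[OF symT acyclic_graph_bridges[OF symT irT ac], of n P k] PT Pinj k by blast
qed

text \<open>An edge leaving a common half would end in both balls.\<close>

lemma half_distinct:
  assumes "x \<in> C" "y \<in> C" "p \<in> C" "q \<in> C" "p \<notin> gball G R x" "p \<notin> gball G R y"
    "q \<notin> half G R x p" "gball G R x \<inter> gball G R y = {}"
  shows "half G R x p \<noteq> half G R y p"
proof
  assume eq: "half G R x p = half G R y p"
  have "p \<in> half G R x p" using assms(5) by (simp add: half_outside)
  then obtain a b where ab: "(a, b) \<in> G" "a \<in> half G R x p" "b \<notin> half G R x p"
    using relation_path_change[OF connected[OF assms(3,4)], of "\<lambda>v. v \<in> half G R x p"] assms(7) by blast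
  then have "b \<in> gball G R x" "b \<in> gball G R y"
    using half_boundary(3)[OF ab] half_boundary(3)[of a b R y p] assms(5,6) eq by auto
  then show False using assms(8) by blast
qed

text \<open>The walls come from balls around the \<open>g\<close>-images of equally spaced points on
  the tree geodesic from \<open>h p\<close> to \<open>h q\<close>. \<open>R\<close> depends on
  \<open>K\<close> alone; the spacing makes the balls disjoint and so the walls distinct, and a
  distant \<open>q\<close> leaves room for \<open>n\<close> of them.\<close>

theorem quasi_tree_wide:
  assumes "quasi_tree TYPE('b) C (induced_graph G C)"
  shows "\<exists>R. wide C G R"
proof -
  define dC where "dC = path_dist (induced_graph G C)"
  obtain W :: "'b set" and T h where T: "tree_graph W T"
    and qi: "quasi_isometry_on C dC W (path_dist T) h"
    using assms unfolding quasi_tree_def dC_def by blast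
  define dT where "dT = path_dist T"
  obtain g K where h: "h \<in> C \<rightarrow> W" and g: "g \<in> W \<rightarrow> C"
    and hK: "\<And>x x'. x \<in> C \<Longrightarrow> x' \<in> C \<Longrightarrow> dT (h x) (h x') \<le> K * dC x x' + K"
    and gK: "\<And>y y'. y \<in> W \<Longrightarrow> y' \<in> W \<Longrightarrow> dC (g y) (g y') \<le> K * dT y y' + K"
    and gh: "\<And>x. x \<in> C \<Longrightarrow> dC x (g (h x)) \<le> K" and hg: "\<And>y. y \<in> W \<Longrightarrow> dT y (h (g y)) \<le> K"
    using qi unfolding quasi_isometry_on_def dT_def by blast
  have conT: "connected_graph W T" using T by (simp add: tree_graph_def)
  interpret dC: Metric_space C dC unfolding dC_def by (rule Metric_space_path_dist[OF connected_graph_C])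
  interpret dT: Metric_space W dT unfolding dT_def by (rule Metric_space_path_dist[OF conT])
  obtain c0 where "c0 \<in> C" using nonempty by blast
  then have K: "0 \<le> K" using gh dC.nonneg[of c0 "g (h c0)"] by (meson order_trans)
  obtain R :: nat where R: "2 * K * K + 2 * K \<le> real R" using real_arch_simple by blast
  \<comment> \<open>If \<open>g y\<close> and \<open>g y'\<close> are at most \<open>2 * R\<close>
    apart, then \<open>y\<close> and \<open>y'\<close> are at most
    \<open>K + (2 * K * R + K) + K\<close> apart. Points at tree distance \<open>S\<close> or more
    therefore get disjoint balls.\<close>
  obtain S :: nat where S: "3 * K + 2 * (K * real R) < real S" using reals_Archimedean2 by blast
  have KR: "0 \<le> K * real R" using K by simp
  have near_T: "dT y y' < real S" if "y \<in> W" "y' \<in> W" "dC (g y) (g y') \<le> 2 * real R" for y y'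
  proof -
    have W: "h (g y) \<in> W" "h (g y') \<in> W" "g y \<in> C" "g y' \<in> C" using that h g by auto
    have "dT y y' \<le> dT y (h (g y)) + dT (h (g y)) y'" using that W by (intro dT.triangle) auto
    moreover have "dT (h (g y)) y' \<le> dT (h (g y)) (h (g y')) + dT (h (g y')) y'"
      using that W by (intro dT.triangle) auto
    moreover have "dT (h (g y')) y' \<le> K" using hg[OF that(2)] dT.commute by metis
    moreover have "K * dC (g y) (g y') \<le> 2 * (K * real R)"
      using mult_left_mono[OF that(3) K] by (simp add: algebra_simps)
    ultimately show ?thesis using hg[OF that(1)] hK[OF W(3,4)] S by linarith
  qed
  have near_p: "dT (h p) y < real S" if "p \<in> C" "y \<in> W" "dC p (g y) \<le> real R" for p y
  proof -
    have W: "h (g y) \<in> W" "h p \<in> W" "g y \<in> C" using that h g by auto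
    have "dT (h p) y \<le> dT (h p) (h (g y)) + dT (h (g y)) y" using that W by (intro dT.triangle) auto
    moreover have "dT (h (g y)) y \<le> K" using hg[OF that(2)] dT.commute by metis
    moreover have "K * dC p (g y) \<le> K * real R" using that(3) K by (rule mult_left_mono)
    ultimately show ?thesis using hK[OF that(1) W(3)] S K KR by linarith
  qed
  have "wide C G R"
    unfolding wide_def
  proof (intro ballI allI)
    fix p n assume p: "p \<in> C"
    \<comment> \<open>If \<open>dT (h p) (h q)\<close> is at most \<open>S * n\<close>, then
      \<open>dC p q\<close> is at most \<open>K + (K * S * n + K) + K\<close>; so beyond radius
      \<open>L\<close> the geodesic is longer than \<open>S * n\<close>.\<close>
    obtain L :: nat where L: "3 * K + K * real (S * n) \<le> real L" using real_arch_simple by blast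
    obtain l where l: "set l = gball G L p" using finite_list[OF finite_gball[OF p]] by blast
    have "\<exists>hs. length hs = n \<and> separators C G R p q hs" if q: "q \<in> C" "q \<notin> gball G L p" for q
    proof -
      have W: "h p \<in> W" "h q \<in> W" "g (h p) \<in> C" "g (h q) \<in> C" using p q h g by auto
      obtain P N where P: "P 0 = h p" "P N = h q" "dT (h p) (h q) = real N"
        "\<And>i. i < N \<Longrightarrow> (P i, P (Suc i)) \<in> T" "\<And>i. i \<le> N \<Longrightarrow> P i \<in> W"
        "\<And>i j. i \<le> j \<Longrightarrow> j \<le> N \<Longrightarrow> dT (P i) (P j) = real (j - i)"
        using geodesic_exists[OF conT W(1,2)] unfolding dT_def by blast
      have SN: "S * n < N"
      proof (rule ccontr)
        assume "\<not> S * n < N"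
        then have "real N \<le> real (S * n)" unfolding of_nat_le_iff by simp
        then have "K * real N \<le> K * real (S * n)" using K by (rule mult_left_mono)
        moreover have "dC p q \<le> dC p (g (h p)) + dC (g (h p)) q" using p q W by (intro dC.triangle) auto
        moreover have "dC (g (h p)) q \<le> dC (g (h p)) (g (h q)) + dC (g (h q)) q"
          using p q W by (intro dC.triangle) auto
        moreover have "dC (g (h q)) q \<le> K" using gh[OF q(1)] dC.commute by metis
        ultimately have "dC p q \<le> real L" using gh[OF p] gK[OF W(1,2), unfolded P(3)] L by linarith
        then show False using q path_dist_gball[OF p q(1)] by (simp add: dC_def)
      qed
      have Pinj: "inj_on P {..N}"
      proof (rule inj_onI)
        have *: "i = j" if "i \<le> j" "j \<le> N" "P i = P j" for i j
          using P(6)[OF that(1,2)] that P(5)[of j] dT.mdist_zero[of "P j"] by simp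
        fix i j assume "i \<in> {..N}" "j \<in> {..N}" "P i = P j"
        then show "i = j" using *[of i j] *[of j i] by (cases "i \<le> j") auto
      qed
      \<comment> \<open>\<open>Suc i\<close> skips the start of the geodesic, so that no ball
        contains \<open>p\<close>.\<close>
      define c where "c i = g (P (S * Suc i))" for i
      have idx: "S * Suc i < N" "S * Suc i \<le> N" if "i < n" for i
      proof -
        have "S * Suc i \<le> S * n" using that by (intro mult_le_mono2) auto
        then show "S * Suc i < N" "S * Suc i \<le> N" using SN by auto
      qed
      have c: "c i \<in> C" if "i < n" for i using P(5)[OF idx(2)[OF that]] g by (auto simp: c_def)
      have p_out: "p \<notin> gball G R (c i)" if i: "i < n" for i
      proof
        assume "p \<in> gball G R (c i)"
        then have "dC p (c i) \<le> real R"
          using path_dist_gball[OF c[OF i] p, of R] dC.commute[of p "c i"] by (simp add: dC_def)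
        then have "dT (h p) (P (S * Suc i)) < real S"
          using near_p[OF p P(5)[OF idx(2)[OF i]]] by (simp add: c_def)
        moreover have "dT (P 0) (P (S * Suc i)) = real (S * Suc i - 0)" by (rule P(6)) (use idx[OF i] in auto)
        ultimately have "real (S * Suc i - 0) < real S" unfolding P(1) by (simp only:)
        then show False unfolding of_nat_less_iff by simp
      qed
      have sep: "q \<notin> half G R (c i) p" if i: "i < n" for i
        using quasi_tree_separation[OF T h g hK[unfolded dT_def dC_def] gK[unfolded dT_def dC_def]
            gh[unfolded dC_def] K p q(1) P(1,2,4) Pinj idx(1)[OF i] P(5)[OF idx(2)[OF i]] R]
          half_outside[OF p_out[OF i]] by (simp add: c_def)
      have "gball G R (c i) \<inter> gball G R (c j) = {}" if ij: "i < j" "j < n" for i j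
      proof (rule ccontr)
        assume "gball G R (c i) \<inter> gball G R (c j) \<noteq> {}"
        then obtain x where x: "x \<in> gball G R (c i)" "x \<in> gball G R (c j)" by blast
        have i: "i < n" using ij by simp
        have xC: "x \<in> C" using x gball_C[OF c[OF i]] by blast
        have "dC (c i) x \<le> real R" "dC (c j) x \<le> real R"
          using x path_dist_gball[OF c[OF i] xC] path_dist_gball[OF c[OF ij(2)] xC] by (auto simp: dC_def)
        moreover have "dC (c i) (c j) \<le> dC (c i) x + dC x (c j)"
          using c[OF i] c[OF ij(2)] xC by (intro dC.triangle)
        ultimately have "dC (c i) (c j) \<le> 2 * real R" using dC.commute[of x "c j"] by simp
        then have "dT (P (S * Suc i)) (P (S * Suc j)) < real S"
          using near_T P(5) idx(2)[OF i] idx(2)[OF ij(2)] by (simp add: c_def)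
        moreover have "S * Suc i \<le> S * Suc j" using ij by (intro mult_le_mono2) auto
        from P(6)[OF this idx(2)[OF ij(2)]]
        have "dT (P (S * Suc i)) (P (S * Suc j)) = real (S * Suc j - S * Suc i)" .
        ultimately have "real (S * Suc j - S * Suc i) < real S" by (simp only:)
        then have "S * Suc j - S * Suc i < S" unfolding of_nat_less_iff .
        moreover have "S * Suc j - S * Suc i = S * (j - i)" by (simp add: diff_mult_distrib2)
        moreover have "S * 1 \<le> S * (j - i)" using ij by (intro mult_le_mono2) auto
        ultimately show False by simp
      qed
      then have disj: "gball G R (c i) \<inter> gball G R (c j) = {}" if "i < n" "j < n" "i \<noteq> j" for i j
        using that by (cases "i < j") (blast, metis Int_commute linorder_neqE_nat)
      have ne: "half G R (c i) p \<noteq> half G R (c j) p" if "i < n" "j < n" "i \<noteq> j" for i j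
        using half_distinct[OF c c p q(1) p_out p_out sep disj] that by blast
      define hs where "hs = map (\<lambda>i. (c i, p)) [0..<n]"
      have "separators C G R p q hs"
        unfolding separators_def
      proof (intro conjI ballI)
        show "set hs \<subseteq> C \<times> C" using c p by (auto simp: hs_def)
        show "distinct (map (\<lambda>h. half G R (fst h) (snd h)) hs)"
        proof -
          have "inj_on (\<lambda>i. half G R (c i) p) {0..<n}" using ne unfolding inj_on_def by force
          then show ?thesis by (simp add: hs_def distinct_map comp_def)
        qed
        fix hh assume "hh \<in> set hs"
        then obtain i where i: "i < n" "hh = (c i, p)" by (auto simp: hs_def)
        then show "p \<in> half G R (fst hh) (snd hh)" "q \<notin> half G R (fst hh) (snd hh)"
          using p_out sep by (auto simp: half_outside)
      qed
      then show ?thesis by (intro exI[of _ hs]) (simp add: hs_def)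
    qed
    then show "\<exists>L. set L \<subseteq> C \<and> (\<forall>q\<in>C. q \<in> set L \<or> (\<exists>hs. length hs = n \<and> separators C G R p q hs))"
      using l gball_C[OF p] by blast
  qed
  then show ?thesis ..
qed

end

section \<open>Borel measurability of walls and orientations\<close>

text \<open>Points with nearby balls have different colours, because each is isolated from the other by its base set.\<close>

definition locator :: "(nat \<Rightarrow> 'a set) \<Rightarrow> ('a \<times> 'a) set \<Rightarrow> nat \<Rightarrow> 'a \<Rightarrow> nat \<Rightarrow> bool" where
  "locator B G R x k \<longleftrightarrow> x \<in> B k \<and> (\<forall>y\<in>component G x. y \<in> B k \<longrightarrow>
     (\<exists>z\<in>component G x. z \<in> gball G (Suc R) x \<and> z \<in> gball G (Suc R) y) \<longrightarrow> y = x)"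

definition point_colour :: "(nat \<Rightarrow> 'a set) \<Rightarrow> ('a \<times> 'a) set \<Rightarrow> nat \<Rightarrow> 'a \<Rightarrow> nat" where
  "point_colour B G R x = (LEAST k. locator B G R x k)"

text \<open>The lexicographic order of the indicator sequences. It is Borel, and linear because the
  base separates points.\<close>

definition base_less :: "(nat \<Rightarrow> 'a set) \<Rightarrow> 'a \<Rightarrow> 'a \<Rightarrow> bool" where
  "base_less B x y \<longleftrightarrow> (\<exists>k. x \<notin> B k \<and> y \<in> B k \<and> (\<forall>j<k. x \<in> B j \<longleftrightarrow> y \<in> B j))"

lemma base_less_irrefl: "\<not> base_less B x x"
  by (simp add: base_less_def)

lemma base_less_trans: "base_less B x y \<Longrightarrow> base_less B y z \<Longrightarrow> base_less B x z"
proof -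
  assume "base_less B x y" "base_less B y z"
  then obtain k l where k: "x \<notin> B k" "y \<in> B k" "\<And>j. j < k \<Longrightarrow> x \<in> B j \<longleftrightarrow> y \<in> B j"
    and l: "y \<notin> B l" "z \<in> B l" "\<And>j. j < l \<Longrightarrow> y \<in> B j \<longleftrightarrow> z \<in> B j"
    unfolding base_less_def by blast
  have "x \<notin> B (min k l)" "z \<in> B (min k l)"
    using k l by (metis min_def not_le_imp_less less_irrefl nat_less_le)+
  moreover have "\<forall>j<min k l. x \<in> B j \<longleftrightarrow> z \<in> B j" using k(3) l(3) by simp
  ultimately show "base_less B x z" unfolding base_less_def by blast
qed

lemma Least_eq_iff:
  fixes P :: "nat \<Rightarrow> bool"
  assumes "\<exists>k. P k"
  shows "(LEAST k. P k) = n \<longleftrightarrow> P n \<and> (\<forall>m<n. \<not> P m)"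
proof
  assume "(LEAST k. P k) = n"
  then show "P n \<and> (\<forall>m<n. \<not> P m)" using LeastI_ex[OF assms] not_less_Least by blast
next
  assume *: "P n \<and> (\<forall>m<n. \<not> P m)"
  then show "(LEAST k. P k) = n" by (intro Least_equality) (auto simp: not_less[symmetric])
qed

text \<open>\<open>N\<close> will be \<open>M\<close> itself, in order to find the least radius, and
  then the restriction of \<open>M\<close> to the points with a given least radius.\<close>

locale borel_graph =
  fixes M :: "'a measure" and G :: "('a \<times> 'a) set" and B :: "nat \<Rightarrow> 'a set" and f :: "nat \<Rightarrow> 'a \<Rightarrow> 'a"
    and N :: "'a measure"
  assumes base: "separating_base M B"
    and G_sets: "G \<in> sets (M \<Otimes>\<^sub>M M)" and graph: "graph_on (space M) G"
    and lf: "locally_finite (space M) G"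
    and f_meas: "f i \<in> M \<rightarrow>\<^sub>M M"
    and f_range: "x \<in> space M \<Longrightarrow> component G x = range (\<lambda>i. f i x)"
    and N_M: "(\<lambda>x. x) \<in> N \<rightarrow>\<^sub>M M"
begin

abbreviation Cm :: "'a \<Rightarrow> 'a set" where "Cm x \<equiv> component G x"

lemma N_space: "x \<in> space N \<Longrightarrow> x \<in> space M"
  using measurable_space[OF N_M] .

lemma component_self: "x \<in> Cm x"
  by (simp add: component_def)

lemma component_eq:
  assumes "y \<in> Cm x"
  shows "Cm y = Cm x"
proof -
  have "sym (G\<^sup>*)" using graph by (intro sym_rtrancl) (simp add: graph_on_def)
  then have "(x, y) \<in> G\<^sup>*" "(y, x) \<in> G\<^sup>*" using assms by (auto simp: component_def dest: symD)
  then show ?thesis unfolding component_def by (auto intro: rtrancl_trans)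
qed

lemma component_space: "x \<in> space M \<Longrightarrow> Cm x \<subseteq> space M"
  unfolding f_range using measurable_space[OF f_meas] by blast

lemma connected_component: "x \<in> space M \<Longrightarrow> connected_component (Cm x) G"
proof
  assume x: "x \<in> space M"
  show "sym G" "irrefl G" using graph by (auto simp: graph_on_def)
  fix y assume y: "y \<in> Cm x"
  show "z \<in> Cm x" if "(y, z) \<in> G" for z
    using y that by (auto simp: component_def intro: rtrancl_into_rtrancl)
  show "(y, z) \<in> G\<^sup>*" if "z \<in> Cm x" for z
    using that component_eq[OF y] by (auto simp: component_def)
  show "finite (G `` {y})" using lf y component_space[OF x] by (auto simp: locally_finite_def)
next
  show "Cm x \<noteq> {}" using component_self by blast
qed

text \<open>Vertices of the component enter formulas as Borel functions of the base point.
  Quantifiers over the component become countable ones over the \<open>f i\<close>, and Borelness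
  follows along the structure of the formula.\<close>

definition sel :: "('a \<Rightarrow> 'a) \<Rightarrow> bool" where
  "sel a \<longleftrightarrow> a \<in> N \<rightarrow>\<^sub>M M \<and> (\<forall>x\<in>space N. a x \<in> Cm x)"

lemma sel_id: "sel (\<lambda>x. x)"
  using N_M component_self by (simp add: sel_def)

lemma sel_f: "sel a \<Longrightarrow> sel (\<lambda>x. f i (a x))"
  unfolding sel_def
proof (intro conjI ballI)
  assume a: "a \<in> N \<rightarrow>\<^sub>M M \<and> (\<forall>x\<in>space N. a x \<in> Cm x)"
  then show "(\<lambda>x. f i (a x)) \<in> N \<rightarrow>\<^sub>M M" using measurable_compose[OF _ f_meas] by blast
  fix x assume x: "x \<in> space N"
  then have ax: "a x \<in> Cm x" using a by blast
  then have "a x \<in> space M" using component_space N_space[OF x] by blast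
  then have "f i (a x) \<in> Cm (a x)" using f_range by auto
  then show "f i (a x) \<in> Cm x" using component_eq[OF ax] by simp
qed

lemma sel_fx: "sel (f i)"
  using sel_f[OF sel_id] .

lemma selD: "sel a \<Longrightarrow> x \<in> space N \<Longrightarrow> a x \<in> Cm x"
  by (simp add: sel_def)

lemma sel_meas: "sel a \<Longrightarrow> a \<in> N \<rightarrow>\<^sub>M M"
  by (simp add: sel_def)

lemma range_f: "x \<in> space N \<Longrightarrow> Cm x = range (\<lambda>i. f i x)"
  using f_range N_space by blast

lemma Bex_component: "x \<in> space N \<Longrightarrow> (\<exists>y\<in>Cm x. P y) \<longleftrightarrow> (\<exists>i. P (f i x))"
  unfolding range_f by blast

lemma Ball_component: "x \<in> space N \<Longrightarrow> (\<forall>y\<in>Cm x. P y) \<longleftrightarrow> (\<forall>i. P (f i x))"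
  unfolding range_f by blast

lemma pred_cong: "(\<And>x. x \<in> space N \<Longrightarrow> P x = Q x) \<Longrightarrow> Measurable.pred N Q \<Longrightarrow> Measurable.pred N P"
  using measurable_cong[of N P Q] by blast

lemma pred_base: "sel a \<Longrightarrow> Measurable.pred N (\<lambda>x. a x \<in> B k)"
  using sel_meas separating_baseD(1)[OF base] by measurable

lemma pred_eq:
  assumes "sel a" "sel b"
  shows "Measurable.pred N (\<lambda>x. a x = b x)"
proof (rule pred_cong)
  fix x assume x: "x \<in> space N"
  have "a x \<in> space M" "b x \<in> space M" using assms selD[OF _ x] component_space[OF N_space[OF x]] by blast+
  then show "a x = b x \<longleftrightarrow> (\<forall>k. a x \<in> B k \<longleftrightarrow> b x \<in> B k)"
    using separating_baseD(2)[OF base, of "{b x}" "a x"] by auto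
next
  have [measurable]: "Measurable.pred N (\<lambda>x. a x \<in> B k)" "Measurable.pred N (\<lambda>x. b x \<in> B k)" for k
    using pred_base assms by blast+
  show "Measurable.pred N (\<lambda>x. \<forall>k. a x \<in> B k \<longleftrightarrow> b x \<in> B k)" by measurable
qed

lemma pred_edge:
  assumes "sel a" "sel b"
  shows "Measurable.pred N (\<lambda>x. (a x, b x) \<in> G)"
proof -
  have [measurable]: "a \<in> N \<rightarrow>\<^sub>M M" "b \<in> N \<rightarrow>\<^sub>M M" using assms sel_meas by blast+
  show ?thesis using G_sets by measurable
qed

lemma relpow_Suc_component:
  assumes x: "x \<in> space N" and y: "y \<in> Cm x" and H: "H \<subseteq> G"
  shows "(y, z) \<in> H ^^ Suc n \<longleftrightarrow> (\<exists>i. (y, f i x) \<in> H ^^ n \<and> (f i x, z) \<in> H)"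
proof -
  have "v \<in> Cm x" if "(y, v) \<in> H ^^ n" for v
  proof -
    have "(y, v) \<in> H\<^sup>*" using that by (rule relpow_imp_rtrancl)
    then have "(y, v) \<in> G\<^sup>*" using rtrancl_mono[OF H] by blast
    then show ?thesis using component_eq[OF y] by (auto simp: component_def)
  qed
  then show ?thesis unfolding range_f[OF x] by fastforce
qed

lemma pred_relpow:
  assumes "sel a"
  shows "sel b \<Longrightarrow> Measurable.pred N (\<lambda>x. (a x, b x) \<in> G ^^ n)"
proof (induction n arbitrary: b)
  case 0
  then show ?case using pred_eq[OF assms] by simp
next
  case (Suc n)
  have [measurable]: "Measurable.pred N (\<lambda>x. (a x, f i x) \<in> G ^^ n)"
    "Measurable.pred N (\<lambda>x. (f i x, b x) \<in> G)" for i
    using Suc.IH[OF sel_fx] pred_edge[OF sel_fx Suc.prems] by blast+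
  have "Measurable.pred N (\<lambda>x. \<exists>i. (a x, f i x) \<in> G ^^ n \<and> (f i x, b x) \<in> G)" by measurable
  then show ?case
    by (rule pred_cong[rotated]) (use relpow_Suc_component[OF _ selD[OF assms]] in blast)
qed

lemma pred_gball:
  assumes "sel a" "sel b"
  shows "Measurable.pred N (\<lambda>x. b x \<in> gball G R (a x))"
proof -
  have [measurable]: "Measurable.pred N (\<lambda>x. (a x, b x) \<in> G ^^ n)" for n
    using pred_relpow assms by blast
  have "Measurable.pred N (\<lambda>x. \<exists>n. n \<le> R \<and> (a x, b x) \<in> G ^^ n)" by measurable
  then show ?thesis by (simp add: gball_def)
qed

lemma pred_avoiding:
  assumes a: "sel a" and b: "sel b"
  shows "sel c \<Longrightarrow> Measurable.pred N (\<lambda>x. (b x, c x) \<in> induced_graph G (- gball G R (a x)) ^^ n)"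
proof (induction n arbitrary: c)
  case 0
  then show ?case using pred_eq[OF b] by simp
next
  case (Suc n)
  let ?H = "\<lambda>x. induced_graph G (- gball G R (a x))"
  have [measurable]: "Measurable.pred N (\<lambda>x. (b x, f i x) \<in> ?H x ^^ n)"
    "Measurable.pred N (\<lambda>x. (f i x, c x) \<in> G)" "Measurable.pred N (\<lambda>x. f i x \<in> gball G R (a x))"
    "Measurable.pred N (\<lambda>x. c x \<in> gball G R (a x))" for i
    using Suc.IH[OF sel_fx] pred_edge[OF sel_fx Suc.prems] pred_gball a sel_fx Suc.prems by blast+
  have "Measurable.pred N (\<lambda>x. \<exists>i. (b x, f i x) \<in> ?H x ^^ n \<and> (f i x, c x) \<in> G \<and>
      f i x \<notin> gball G R (a x) \<and> c x \<notin> gball G R (a x))" by measurable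
  then show ?case
  proof (rule pred_cong[rotated])
    fix x assume "x \<in> space N"
    from relpow_Suc_component[OF this selD[OF b this], of "?H x" "c x" n]
    show "(b x, c x) \<in> ?H x ^^ Suc n \<longleftrightarrow> (\<exists>i. (b x, f i x) \<in> ?H x ^^ n \<and> (f i x, c x) \<in> G \<and>
      f i x \<notin> gball G R (a x) \<and> c x \<notin> gball G R (a x))"
      by (auto simp: induced_graph_def)
  qed
qed

lemma pred_half:
  assumes "sel a" "sel b" "sel c"
  shows "Measurable.pred N (\<lambda>x. c x \<in> half G R (a x) (b x))"
proof -
  have [measurable]: "Measurable.pred N (\<lambda>x. b x \<in> gball G R (a x))" "Measurable.pred N (\<lambda>x. c x = a x)"
    "Measurable.pred N (\<lambda>x. (b x, c x) \<in> induced_graph G (- gball G R (a x)) ^^ n)" for n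
    using pred_gball pred_eq pred_avoiding assms by blast+
  have "Measurable.pred N (\<lambda>x. b x \<in> gball G R (a x) \<and> c x = a x \<or> b x \<notin> gball G R (a x) \<and>
      (\<exists>n. (b x, c x) \<in> induced_graph G (- gball G R (a x)) ^^ n))" by measurable
  then show ?thesis by (rule pred_cong[rotated]) (auto simp: half_def component_def rtrancl_power)
qed

lemma pred_shalf:
  assumes "sel a" "sel b" "sel c"
  shows "Measurable.pred N (\<lambda>x. c x \<in> shalf (Cm x) G R (a x, b x, s))"
proof -
  have [measurable]: "Measurable.pred N (\<lambda>x. c x \<in> half G R (a x) (b x))"
    using pred_half assms by blast
  have "Measurable.pred N (\<lambda>x. if s then c x \<in> half G R (a x) (b x) else c x \<notin> half G R (a x) (b x))"
    by measurable
  then show ?thesis by (rule pred_cong[rotated]) (use selD[OF assms(3)] in auto)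
qed

lemma shalf_sub:
  assumes x: "x \<in> space N" and "sel a" "sel b"
  shows "shalf (Cm x) G R (a x, b x, s) \<subseteq> Cm x"
proof -
  have "half G R (a x) (b x) \<subseteq> Cm x"
    using connected_component.half_C[OF connected_component[OF N_space[OF x]]] selD[OF _ x] assms by blast
  then show ?thesis by auto
qed

lemma eq_on_component:
  assumes "x \<in> space N" "A \<subseteq> Cm x" "D \<subseteq> Cm x"
  shows "A = D \<longleftrightarrow> (\<forall>i. f i x \<in> A \<longleftrightarrow> f i x \<in> D)"
  using assms(2,3) unfolding range_f[OF assms(1)] by blast

lemma pred_shalf_eq:
  assumes "sel a" "sel b" "sel a'" "sel b'"
  shows "Measurable.pred N (\<lambda>x. shalf (Cm x) G R (a x, b x, s) = shalf (Cm x) G R (a' x, b' x, s'))"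
proof (rule pred_cong)
  fix x assume x: "x \<in> space N"
  show "shalf (Cm x) G R (a x, b x, s) = shalf (Cm x) G R (a' x, b' x, s') \<longleftrightarrow>
      (\<forall>i. f i x \<in> shalf (Cm x) G R (a x, b x, s) \<longleftrightarrow> f i x \<in> shalf (Cm x) G R (a' x, b' x, s'))"
    by (rule eq_on_component[OF x shalf_sub[OF x assms(1,2)] shalf_sub[OF x assms(3,4)]])
next
  have [measurable]: "Measurable.pred N (\<lambda>x. f i x \<in> shalf (Cm x) G R (a x, b x, s))"
    "Measurable.pred N (\<lambda>x. f i x \<in> shalf (Cm x) G R (a' x, b' x, s'))" for i
    using pred_shalf assms sel_fx by blast+
  show "Measurable.pred N (\<lambda>x. \<forall>i. f i x \<in> shalf (Cm x) G R (a x, b x, s) \<longleftrightarrow>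
      f i x \<in> shalf (Cm x) G R (a' x, b' x, s'))" by measurable
qed

lemma Bex_halves:
  assumes x: "x \<in> space N"
  shows "(\<exists>A\<in>halves (Cm x) G R. P A) \<longleftrightarrow> (\<exists>i j s. P (shalf (Cm x) G R (f i x, f j x, s)))"
  unfolding halves_def using Bex_component[OF x] by (simp add: Bex_def)

lemma Ball_halves:
  assumes x: "x \<in> space N"
  shows "(\<forall>A\<in>halves (Cm x) G R. P A) \<longleftrightarrow> (\<forall>i j s. P (shalf (Cm x) G R (f i x, f j x, s)))"
  using Bex_halves[OF x, of R "\<lambda>A. \<not> P A"] by blast

section \<open>Codes of orientations\<close>

definition ori :: "nat \<Rightarrow> ('a \<Rightarrow> 'a) \<Rightarrow> (nat \<times> nat) list \<Rightarrow> 'a \<Rightarrow> 'a set set" where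
  "ori R e c x = orient (Cm x) G R (e x) (pairs f (e x) c)"

lemma pairs_sub: "x \<in> space N \<Longrightarrow> sel e \<Longrightarrow> set (pairs f (e x) c) \<subseteq> Cm x \<times> Cm x"
  using selD[OF sel_f] by (auto simp: pairs_def)

lemma shalf_halves: "x \<in> space N \<Longrightarrow> sel a \<Longrightarrow> sel b \<Longrightarrow> shalf (Cm x) G R (a x, b x, s) \<in> halves (Cm x) G R"
  using connected_component.halvesI[OF connected_component[OF N_space] selD selD] by blast

lemma pred_ori:
  assumes "sel a" "sel b" "sel e"
  shows "Measurable.pred N (\<lambda>x. shalf (Cm x) G R (a x, b x, s) \<in> ori R e c x)"
proof (rule pred_cong)
  fix x assume x: "x \<in> space N"
  have "shalf (Cm x) G R (a x, b x, s) \<in> towards (Cm x) G R (e x) \<longleftrightarrow> e x \<in> shalf (Cm x) G R (a x, b x, s)"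
    using shalf_halves[OF x assms(1,2)] by (simp only: towards_def mem_Collect_eq simp_thms)
  then show "shalf (Cm x) G R (a x, b x, s) \<in> ori R e c x \<longleftrightarrow>
      (e x \<in> shalf (Cm x) G R (a x, b x, s)) \<noteq> (\<exists>p\<in>set c. \<exists>t.
        shalf (Cm x) G R (a x, b x, s) = shalf (Cm x) G R (f (fst p) (e x), f (snd p) (e x), t))"
    unfolding ori_def orient_mem ex_bool_eq shalf.simps(1)[where s = True] shalf.simps(1)[where s = False]
    by (simp only: pairs_def set_map bex_simps fst_conv snd_conv case_prod_beta if_True if_False)
next
  have [measurable]: "Measurable.pred N (\<lambda>x. e x \<in> shalf (Cm x) G R (a x, b x, s))"
    "Measurable.pred N (\<lambda>x. shalf (Cm x) G R (a x, b x, s) = shalf (Cm x) G R (f i (e x), f j (e x), t))" for i j t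
    using pred_shalf pred_shalf_eq assms sel_f[OF assms(3)] by blast+
  show "Measurable.pred N (\<lambda>x. (e x \<in> shalf (Cm x) G R (a x, b x, s)) \<noteq> (\<exists>p\<in>set c. \<exists>t.
        shalf (Cm x) G R (a x, b x, s) = shalf (Cm x) G R (f (fst p) (e x), f (snd p) (e x), t)))"
    by measurable
qed

lemma ori_halves: "x \<in> space N \<Longrightarrow> sel e \<Longrightarrow> ori R e c x \<subseteq> halves (Cm x) G R"
  unfolding ori_def
  by (rule connected_component.orient_halves[OF connected_component[OF N_space] pairs_sub])

lemma pred_ori_eq:
  assumes "sel e" "sel e'"
  shows "Measurable.pred N (\<lambda>x. ori R e c x = ori R e' c' x)"
proof (rule pred_cong)
  fix x assume x: "x \<in> space N"
  show "ori R e c x = ori R e' c' x \<longleftrightarrow> (\<forall>i j s. shalf (Cm x) G R (f i x, f j x, s) \<in> ori R e c x \<longleftrightarrow>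
      shalf (Cm x) G R (f i x, f j x, s) \<in> ori R e' c' x)"
  proof -
    have "ori R e c x = ori R e' c' x \<longleftrightarrow>
        (\<forall>A\<in>halves (Cm x) G R. A \<in> ori R e c x \<longleftrightarrow> A \<in> ori R e' c' x)"
      using ori_halves[OF x assms(1), of R c] ori_halves[OF x assms(2), of R c'] by blast
    then show ?thesis unfolding Ball_halves[OF x] .
  qed
next
  have [measurable]: "Measurable.pred N (\<lambda>x. shalf (Cm x) G R (f i x, f j x, s) \<in> ori R e c x)"
    "Measurable.pred N (\<lambda>x. shalf (Cm x) G R (f i x, f j x, s) \<in> ori R e' c' x)" for i j s
    using pred_ori sel_fx assms by blast+
  show "Measurable.pred N (\<lambda>x. \<forall>i j s. shalf (Cm x) G R (f i x, f j x, s) \<in> ori R e c x \<longleftrightarrow>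
      shalf (Cm x) G R (f i x, f j x, s) \<in> ori R e' c' x)" by measurable
qed

lemma pred_valid:
  assumes e: "sel e"
  shows "Measurable.pred N (\<lambda>x. ori R e c x \<in> orientations (Cm x) G R)"
proof (rule pred_cong)
  fix x assume x: "x \<in> space N"
  have "A \<inter> D \<noteq> {} \<longleftrightarrow> (\<exists>y\<in>Cm x. y \<in> A \<and> y \<in> D)" if "A \<in> halves (Cm x) G R" for A D
    using connected_component.halves_C[OF connected_component[OF N_space[OF x]] that] by blast
  then have "ori R e c x \<in> orientations (Cm x) G R \<longleftrightarrow> (\<forall>A\<in>halves (Cm x) G R. \<forall>D\<in>halves (Cm x) G R.
      A \<in> ori R e c x \<longrightarrow> D \<in> ori R e c x \<longrightarrow> (\<exists>y\<in>Cm x. y \<in> A \<and> y \<in> D))"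
    unfolding ori_def connected_component.orient_orientation_iff[OF connected_component[OF N_space[OF x]]
        selD[OF e x] pairs_sub[OF x e]] by blast
  then show "ori R e c x \<in> orientations (Cm x) G R \<longleftrightarrow> (\<forall>i j s i' j' s'.
      shalf (Cm x) G R (f i x, f j x, s) \<in> ori R e c x \<longrightarrow> shalf (Cm x) G R (f i' x, f j' x, s') \<in> ori R e c x \<longrightarrow>
      (\<exists>k. f k x \<in> shalf (Cm x) G R (f i x, f j x, s) \<and> f k x \<in> shalf (Cm x) G R (f i' x, f j' x, s')))"
    unfolding Ball_halves[OF x] Bex_component[OF x] .
next
  have [measurable]: "Measurable.pred N (\<lambda>x. shalf (Cm x) G R (f i x, f j x, s) \<in> ori R e c x)"
    "Measurable.pred N (\<lambda>x. f k x \<in> shalf (Cm x) G R (f i x, f j x, s))" for i j k s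
    using pred_ori pred_shalf sel_fx e by blast+
  show "Measurable.pred N (\<lambda>x. \<forall>i j s i' j' s'.
      shalf (Cm x) G R (f i x, f j x, s) \<in> ori R e c x \<longrightarrow> shalf (Cm x) G R (f i' x, f j' x, s') \<in> ori R e c x \<longrightarrow>
      (\<exists>k. f k x \<in> shalf (Cm x) G R (f i x, f j x, s) \<and> f k x \<in> shalf (Cm x) G R (f i' x, f j' x, s')))"
    by measurable
qed

section \<open>The Borel colouring and the Borel order of points\<close>

text \<open>By local finiteness only finitely many other vertices have a ball of radius
  \<open>Suc R\<close> that meets the one around \<open>x\<close>, and some base set around
  \<open>x\<close> misses them all.\<close>

lemma locator_ex:
  assumes "x \<in> space M"
  shows "\<exists>k. locator B G R x k"
proof -
  interpret connected_component "Cm x" G using connected_component assms .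
  define F where "F = (\<Union>z\<in>gball G (Suc R) x. gball G (Suc R) z) - {x}"
  have "finite F"
    unfolding F_def using finite_gball component_self gball_C[OF component_self] by blast
  then obtain k where k: "x \<in> B k" "B k \<inter> F = {}"
    using separating_baseD(2)[OF base _ assms, of F] by (auto simp: F_def)
  have "y \<in> F" if "z \<in> gball G (Suc R) x" "z \<in> gball G (Suc R) y" "y \<noteq> x" for y z
    using that gball_sym[OF sym_G] by (auto simp: F_def)
  then have "locator B G R x k" using k unfolding locator_def by blast
  then show ?thesis ..
qed

lemma pred_locator:
  assumes "sel a"
  shows "Measurable.pred N (\<lambda>x. locator B G R (a x) k)"
proof (rule pred_cong)
  fix x assume x: "x \<in> space N"
  show "locator B G R (a x) k \<longleftrightarrow> a x \<in> B k \<and> (\<forall>i. f i x \<in> B k \<longrightarrow>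
      (\<exists>j. f j x \<in> gball G (Suc R) (a x) \<and> f j x \<in> gball G (Suc R) (f i x)) \<longrightarrow> f i x = a x)"
    unfolding locator_def component_eq[OF selD[OF assms x]] Ball_component[OF x] Bex_component[OF x] ..
next
  have [measurable]: "Measurable.pred N (\<lambda>x. a x \<in> B k)" "Measurable.pred N (\<lambda>x. f i x \<in> B k)"
    "Measurable.pred N (\<lambda>x. f j x \<in> gball G (Suc R) (a x))"
    "Measurable.pred N (\<lambda>x. f j x \<in> gball G (Suc R) (f i x))" "Measurable.pred N (\<lambda>x. f i x = a x)" for i j
    using pred_base pred_gball pred_eq assms sel_fx by blast+
  show "Measurable.pred N (\<lambda>x. a x \<in> B k \<and> (\<forall>i. f i x \<in> B k \<longrightarrow>
      (\<exists>j. f j x \<in> gball G (Suc R) (a x) \<and> f j x \<in> gball G (Suc R) (f i x)) \<longrightarrow> f i x = a x))"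
    by measurable
qed

lemma pred_point_colour:
  assumes "sel a"
  shows "Measurable.pred N (\<lambda>x. point_colour B G R (a x) = n)"
proof (rule pred_cong)
  fix x assume x: "x \<in> space N"
  then have "a x \<in> space M" using selD[OF assms x] component_space[OF N_space[OF x]] by blast
  from Least_eq_iff[OF locator_ex[OF this]]
  show "point_colour B G R (a x) = n \<longleftrightarrow> locator B G R (a x) n \<and> (\<forall>m<n. \<not> locator B G R (a x) m)"
    unfolding point_colour_def .
next
  have [measurable]: "Measurable.pred N (\<lambda>x. locator B G R (a x) k)" for k
    using pred_locator assms by blast
  show "Measurable.pred N (\<lambda>x. locator B G R (a x) n \<and> (\<forall>m<n. \<not> locator B G R (a x) m))"
    by measurable
qed

text \<open>The common colour is the index of a base set containing both points, and the locator
  condition at \<open>y\<close> admits no second such point with a meeting ball.\<close>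

lemma point_colour_separates:
  assumes x: "x \<in> space M" and yz: "y \<in> Cm x" "z \<in> Cm x" "y \<noteq> z"
    and eq: "point_colour B G R y = point_colour B G R z"
  shows "gball G (Suc R) y \<inter> gball G (Suc R) z = {}"
proof (rule ccontr)
  assume "gball G (Suc R) y \<inter> gball G (Suc R) z \<noteq> {}"
  then obtain v where v: "v \<in> gball G (Suc R) y" "v \<in> gball G (Suc R) z" by blast
  have yM: "y \<in> space M" "z \<in> space M" using yz component_space[OF x] by blast+
  have loc: "locator B G R y (point_colour B G R y)" "locator B G R z (point_colour B G R y)"
    using LeastI_ex[OF locator_ex[OF yM(1)]] LeastI_ex[OF locator_ex[OF yM(2)]] eq
    unfolding point_colour_def by metis+
  have C: "Cm y = Cm x" "Cm z = Cm x" using component_eq yz by blast+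
  have "v \<in> Cm x"
    using v(1) connected_component.gball_C[OF connected_component[OF x] yz(1)] by blast
  then have "z = y" using loc v yz C unfolding locator_def by blast
  then show False using yz(3) by simp
qed

lemma pred_less:
  assumes "sel a" "sel b"
  shows "Measurable.pred N (\<lambda>x. base_less B (a x) (b x))"
proof -
  have [measurable]: "Measurable.pred N (\<lambda>x. a x \<in> B k)" "Measurable.pred N (\<lambda>x. b x \<in> B k)" for k
    using pred_base assms by blast+
  show ?thesis unfolding base_less_def by measurable
qed

lemma base_less_total:
  assumes "x \<in> space M" "y \<in> space M" "x \<noteq> y"
  shows "base_less B x y \<or> base_less B y x"
proof -
  have "\<exists>k. (x \<in> B k) \<noteq> (y \<in> B k)"
    using separating_baseD(2)[OF base, of "{y}" x] assms by auto
  then obtain k where "(x \<in> B k) \<noteq> (y \<in> B k)" "\<And>j. j < k \<Longrightarrow> (x \<in> B j) = (y \<in> B j)"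
    using exists_least_iff[of "\<lambda>k. (x \<in> B k) \<noteq> (y \<in> B k)"] by blast
  then show ?thesis unfolding base_less_def by blast
qed

section \<open>Borelness of \<open>wide\<close>\<close>

text \<open>\<open>separators\<close> for walls given by indices, so that a quantifier over the list
  is countable. Distinctness is spelled out since equality of two halves is itself a Borel condition
  on the base point.\<close>

definition sep_code :: "nat \<Rightarrow> 'a \<Rightarrow> 'a \<Rightarrow> 'a \<Rightarrow> nat \<Rightarrow> (nat \<times> nat) list \<Rightarrow> bool" where
  "sep_code R x p q n c \<longleftrightarrow> length c = n \<and>
     (\<forall>i<n. \<forall>j<n. i \<noteq> j \<longrightarrow>
        half G R (f (fst (c ! i)) x) (f (snd (c ! i)) x) \<noteq> half G R (f (fst (c ! j)) x) (f (snd (c ! j)) x)) \<and>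
     (\<forall>h\<in>set c. p \<in> half G R (f (fst h) x) (f (snd h) x) \<and> q \<notin> half G R (f (fst h) x) (f (snd h) x))"

lemma separators_pairs:
  assumes "x \<in> space N"
  shows "length c = n \<and> separators (Cm x) G R p q (pairs f x c) \<longleftrightarrow> sep_code R x p q n c"
  using pairs_sub[OF assms sel_id, of c]
  unfolding sep_code_def separators_def distinct_conv_nth by (auto simp: pairs_def case_prod_beta)

lemma pairs_surj:
  assumes "x \<in> space N"
  shows "set hs \<subseteq> Cm x \<times> Cm x \<Longrightarrow> \<exists>c. hs = pairs f x c"
proof (induction hs)
  case (Cons h hs)
  then obtain c where c: "hs = pairs f x c" by auto
  have "fst h \<in> Cm x" "snd h \<in> Cm x" using Cons.prems by auto
  then obtain i j where "fst h = f i x" "snd h = f j x" unfolding range_f[OF assms] by blast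
  then have "h # hs = pairs f x ((i, j) # c)" using c by (simp add: pairs_def prod_eq_iff)
  then show ?case ..
qed (simp add: pairs_def)

lemma wide_code:
  assumes x: "x \<in> space N"
  shows "wide (Cm x) G R \<longleftrightarrow> (\<forall>a n. \<exists>l. \<forall>b. (\<exists>i\<in>set l. f b x = f i x) \<or> (\<exists>c. sep_code R x (f a x) (f b x) n c))"
proof -
  have sep: "(\<exists>hs. length hs = n \<and> separators (Cm x) G R p q hs) \<longleftrightarrow> (\<exists>c. sep_code R x p q n c)" for p q n
  proof
    assume "\<exists>hs. length hs = n \<and> separators (Cm x) G R p q hs"
    then obtain hs where hs: "length hs = n" "separators (Cm x) G R p q hs" by blast
    then obtain c where c: "hs = pairs f x c" using pairs_surj[OF x] unfolding separators_def by blast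
    then have "length c = n" using hs(1) by (simp add: pairs_def)
    then show "\<exists>c. sep_code R x p q n c" using hs(2) c separators_pairs[OF x] by blast
  next
    assume "\<exists>c. sep_code R x p q n c"
    then obtain c where "length c = n" "separators (Cm x) G R p q (pairs f x c)"
      using separators_pairs[OF x] by blast
    then show "\<exists>hs. length hs = n \<and> separators (Cm x) G R p q hs"
      by (intro exI[of _ "pairs f x c"]) (simp add: pairs_def)
  qed
  define Q where "Q p n L \<longleftrightarrow> (\<forall>q\<in>Cm x. q \<in> set L \<or> (\<exists>c. sep_code R x p q n c))" for p n and L :: "'a list"
  have 1: "wide (Cm x) G R \<longleftrightarrow> (\<forall>p\<in>Cm x. \<forall>n. \<exists>L. set L \<subseteq> Cm x \<and> Q p n L)"
    unfolding wide_def sep Q_def ..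
  have 2: "(\<exists>L. set L \<subseteq> Cm x \<and> Q p n L) \<longleftrightarrow> (\<exists>l. Q p n (map (\<lambda>i. f i x) l))" for p n
  proof
    assume "\<exists>L. set L \<subseteq> Cm x \<and> Q p n L"
    then obtain L where L: "set L \<subseteq> Cm x" "Q p n L" by blast
    then have "\<forall>y\<in>set L. \<exists>i. y = f i x" unfolding range_f[OF x] by blast
    then obtain l where "L = map (\<lambda>i. f i x) l" unfolding ex_map_conv[symmetric] by blast
    then show "\<exists>l. Q p n (map (\<lambda>i. f i x) l)" using L(2) by blast
  next
    assume "\<exists>l. Q p n (map (\<lambda>i. f i x) l)"
    then obtain l where "Q p n (map (\<lambda>i. f i x) l)" by blast
    moreover have "set (map (\<lambda>i. f i x) l) \<subseteq> Cm x" unfolding range_f[OF x] by auto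
    ultimately show "\<exists>L. set L \<subseteq> Cm x \<and> Q p n L" by blast
  qed
  have 3: "Q p n (map (\<lambda>i. f i x) l) \<longleftrightarrow>
      (\<forall>b. (\<exists>i\<in>set l. f b x = f i x) \<or> (\<exists>c. sep_code R x p (f b x) n c))" for p n l
    unfolding Q_def Ball_component[OF x] set_map image_iff ..
  show ?thesis unfolding 1 2 3 Ball_component[OF x] ..
qed

lemma pred_wide: "Measurable.pred N (\<lambda>x. wide (Cm x) G R)"
proof (rule pred_cong[OF wide_code])
  have [measurable]: "Measurable.pred N (\<lambda>x. f a x \<in> half G R (f i x) (f j x))"
    "Measurable.pred N (\<lambda>x. f b x = f i x)" for a b i j
    using pred_half pred_eq sel_fx by blast+
  have [measurable]: "Measurable.pred N (\<lambda>x. half G R (f i x) (f j x) = half G R (f i' x) (f j' x))" for i j i' j'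
    using pred_shalf_eq[OF sel_fx sel_fx sel_fx sel_fx, of R i j True i' j' True] by simp
  have [measurable]: "Measurable.pred N (\<lambda>x. sep_code R x (f a x) (f b x) n c)" for a b n c
    unfolding sep_code_def by measurable
  show "Measurable.pred N (\<lambda>x. \<forall>a n. \<exists>l. \<forall>b. (\<exists>i\<in>set l. f b x = f i x) \<or> (\<exists>c. sep_code R x (f a x) (f b x) n c))"
    by measurable
qed

end

section \<open>Borel measurability of the trees\<close>

locale wide_graph = borel_graph +
  fixes R :: nat
  assumes wide: "x \<in> space N \<Longrightarrow> wide (component G x) G R"
begin

abbreviation kap :: "'a \<Rightarrow> nat" where "kap \<equiv> point_colour B G R"
abbreviation Hv :: "'a \<Rightarrow> 'a set set" where "Hv x \<equiv> halves (Cm x) G R"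
abbreviation Ov :: "'a \<Rightarrow> 'a set set set" where "Ov x \<equiv> orientations (Cm x) G R"
abbreviation sh :: "('a \<Rightarrow> 'a) \<Rightarrow> ('a \<Rightarrow> 'a) \<Rightarrow> bool \<Rightarrow> 'a \<Rightarrow> 'a set" where
  "sh a b s x \<equiv> shalf (Cm x) G R (a x, b x, s)"
abbreviation col :: "'a \<Rightarrow> 'a set \<Rightarrow> nat" where "col x \<equiv> wall_colour (Cm x) G R kap"
abbreviation wkey :: "'a \<Rightarrow> 'a set \<Rightarrow> 'a set set \<Rightarrow> nat" where "wkey x \<equiv> wall_key (Cm x) G R kap f"
abbreviation vx :: "(nat \<times> nat) list \<Rightarrow> 'a \<Rightarrow> 'a set set" where "vx \<equiv> ori R (\<lambda>x. x)"

lemma walled: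
  assumes x: "x \<in> space N"
  shows "walled_component (Cm x) G R kap f (base_less B)"
proof -
  note xM = N_space[OF x]
  have sub: "y \<in> space M" if "y \<in> Cm x" for y using component_space[OF xM] that by blast
  show ?thesis
  proof (intro walled_component.intro walled_component_axioms.intro)
    show "connected_component (Cm x) G" using connected_component[OF xM] .
    show "wide (Cm x) G R" using wide[OF x] .
    show "gball G (Suc R) y \<inter> gball G (Suc R) z = {}"
      if "y \<in> Cm x" "z \<in> Cm x" "y \<noteq> z" "kap y = kap z" for y z
      using point_colour_separates[OF xM that] .
    show "Cm x = range (\<lambda>i. f i y)" if "y \<in> Cm x" for y
      using f_range[OF sub[OF that]] component_eq[OF that] by simp
    show "\<not> base_less B y y" for y by (rule base_less_irrefl)
    show "base_less B u v \<Longrightarrow> base_less B v w \<Longrightarrow> base_less B u w" for u v w by (rule base_less_trans)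
    show "base_less B y z \<or> base_less B z y" if "y \<in> Cm x" "z \<in> Cm x" "y \<noteq> z" for y z
      using base_less_total[OF sub[OF that(1)] sub[OF that(2)] that(3)] .
  qed
qed

lemma pred_centres:
  assumes "sel a" "sel b" "sel c"
  shows "Measurable.pred N (\<lambda>x. a x \<in> centres (Cm x) G R (sh b c s x))"
proof (rule pred_cong)
  fix x assume x: "x \<in> space N"
  have "a x \<in> centres (Cm x) G R (sh b c s x) \<longleftrightarrow> (\<exists>z\<in>Cm x. \<exists>t. sh b c s x = shalf (Cm x) G R (a x, z, t))"
    using selD[OF assms(1) x] unfolding centres_def by blast
  then show "a x \<in> centres (Cm x) G R (sh b c s x) \<longleftrightarrow> (\<exists>j t. sh b c s x = shalf (Cm x) G R (a x, f j x, t))"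
    unfolding Bex_component[OF x] .
next
  have [measurable]: "Measurable.pred N (\<lambda>x. sh b c s x = shalf (Cm x) G R (a x, f j x, t))" for j t
    using pred_shalf_eq assms sel_fx by blast
  show "Measurable.pred N (\<lambda>x. \<exists>j t. sh b c s x = shalf (Cm x) G R (a x, f j x, t))" by measurable
qed

lemma pred_colour:
  assumes "sel b" "sel c"
  shows "Measurable.pred N (\<lambda>x. col x (sh b c s x) = n)"
proof -
  define Q where "Q n x \<longleftrightarrow> (\<exists>i. f i x \<in> centres (Cm x) G R (sh b c s x) \<and> kap (f i x) = n)" for n x
  have [measurable]: "Measurable.pred N (\<lambda>x. f i x \<in> centres (Cm x) G R (sh b c s x))"
    "Measurable.pred N (\<lambda>x. kap (f i x) = n)" for i n
    using pred_centres pred_point_colour assms sel_fx by blast+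
  have [measurable]: "Measurable.pred N (Q n)" for n
    unfolding Q_def[abs_def] by measurable
  have "col x (sh b c s x) = n \<longleftrightarrow> Q n x \<and> (\<forall>m<n. \<not> Q m x)" if x: "x \<in> space N" for x
  proof -
    have Q: "(\<exists>y\<in>centres (Cm x) G R (sh b c s x). kap y = n) \<longleftrightarrow> Q n x" for n
    proof -
      have "(\<exists>y\<in>centres (Cm x) G R (sh b c s x). kap y = n) \<longleftrightarrow>
          (\<exists>y\<in>Cm x. y \<in> centres (Cm x) G R (sh b c s x) \<and> kap y = n)"
        unfolding centres_def by blast
      then show ?thesis unfolding Bex_component[OF x] Q_def .
    qed
    have "\<exists>n. \<exists>y\<in>centres (Cm x) G R (sh b c s x). kap y = n"
      using walled_component.centre(1)[OF walled[OF x] shalf_halves[OF x assms]] by blast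
    from Least_eq_iff[OF this] show ?thesis unfolding wall_colour_def Q .
  qed
  then show ?thesis by (rule pred_cong) measurable
qed

lemma pred_centre:
  assumes "sel a" "sel b" "sel c"
  shows "Measurable.pred N (\<lambda>x. centre (Cm x) G R kap (sh b c s x) = a x)"
proof (rule pred_cong)
  fix x assume x: "x \<in> space N"
  note centre = walled_component.centre[OF walled[OF x] shalf_halves[OF x assms(2,3)]]
  show "centre (Cm x) G R kap (sh b c s x) = a x \<longleftrightarrow>
      a x \<in> centres (Cm x) G R (sh b c s x) \<and> (\<exists>n. kap (a x) = n \<and> col x (sh b c s x) = n)"
    using centre(1,2)[of s] centre(3)[of "a x" s] by metis
next
  have [measurable]: "Measurable.pred N (\<lambda>x. a x \<in> centres (Cm x) G R (sh b c s x))"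
    "Measurable.pred N (\<lambda>x. kap (a x) = n)" "Measurable.pred N (\<lambda>x. col x (sh b c s x) = n)" for n
    using pred_centres pred_point_colour pred_colour assms by blast+
  show "Measurable.pred N (\<lambda>x. a x \<in> centres (Cm x) G R (sh b c s x) \<and>
      (\<exists>n. kap (a x) = n \<and> col x (sh b c s x) = n))" by measurable
qed

text \<open>A relation rather than a value, so that it can be treated as a predicate for each
  \<open>n\<close>. The first conjunct restricts it to lists coding orientations, for which a code
  relative to the centre is known to exist.\<close>

definition keyp :: "nat \<Rightarrow> nat \<Rightarrow> bool \<Rightarrow> (nat \<times> nat) list \<Rightarrow> nat \<Rightarrow> 'a \<Rightarrow> bool" where
  "keyp i j s c n x \<longleftrightarrow> vx c x \<in> Ov x \<and> wkey x (sh (f i) (f j) s x) (vx c x) = n"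

lemma pred_keyp: "Measurable.pred N (keyp i j s c n)"
proof -
  \<comment> \<open>The centre is some \<open>f k x\<close>; naming it allows codes relative to the
    centre to be compared with the code \<open>c\<close> relative to \<open>x\<close>.\<close>
  define Q where "Q n x \<longleftrightarrow>
    (\<exists>k. centre (Cm x) G R kap (sh (f i) (f j) s x) = f k x \<and> ori R (f k) (from_nat n) x = vx c x)" for n x
  have [measurable]: "Measurable.pred N (\<lambda>x. centre (Cm x) G R kap (sh (f i) (f j) s x) = f k x)"
    "Measurable.pred N (\<lambda>x. ori R (f k) (from_nat n) x = vx c x)" "Measurable.pred N (\<lambda>x. vx c x \<in> Ov x)" for k n
    using pred_centre pred_ori_eq pred_valid sel_fx sel_id by blast+
  have [measurable]: "Measurable.pred N (Q n)" for n
    unfolding Q_def[abs_def] by measurable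
  have "keyp i j s c n x \<longleftrightarrow> vx c x \<in> Ov x \<and> Q n x \<and> (\<forall>m<n. \<not> Q m x)" if x: "x \<in> space N" for x
  proof (cases "vx c x \<in> Ov x")
    case True
    interpret walled_component "Cm x" G R kap f "base_less B" using walled[OF x] .
    define y where "y = centre (Cm x) G R kap (sh (f i) (f j) s x)"
    have y: "y \<in> Cm x"
      using centre(1)[OF shalf_halves[OF x sel_fx sel_fx]] unfolding centres_def y_def by blast
    then obtain k where k: "y = f k x" unfolding range_f[OF x] by blast
    have Q: "orient (Cm x) G R y (pairs f y (from_nat n)) = vx c x \<longleftrightarrow> Q n x" for n
      unfolding Q_def y_def[symmetric] ori_def[of R "f _"] using k by metis
    obtain d where "orient (Cm x) G R y (pairs f y d) = vx c x"
      using orient_surj[where f = f, OF True y enum[OF y]] by blast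
    then have "\<exists>n. orient (Cm x) G R y (pairs f y (from_nat n)) = vx c x" by (metis from_nat_to_nat)
    from Least_eq_iff[OF this, of n] show ?thesis
      using True unfolding keyp_def wall_key_def y_def[symmetric] Q by blast
  qed (simp add: keyp_def)
  then show ?thesis by (rule pred_cong) measurable
qed

definition adjp :: "nat \<Rightarrow> nat \<Rightarrow> bool \<Rightarrow> (nat \<times> nat) list \<Rightarrow> (nat \<times> nat) list \<Rightarrow> 'a \<Rightarrow> bool" where
  "adjp i j s c d x \<longleftrightarrow> vx c x \<in> Ov x \<and> vx d x \<in> Ov x \<and>
     sym_diff (vx c x) (vx d x) = {sh (f i) (f j) s x, Cm x - sh (f i) (f j) s x}"

lemma neg_sh: "x \<in> space N \<Longrightarrow> Cm x - sh (f i) (f j) s x = sh (f i) (f j) (\<not> s) x"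
  using connected_component.shalf_neg[OF connected_component[OF N_space] selD[OF sel_fx] selD[OF sel_fx]] .

lemma pred_adjp: "Measurable.pred N (adjp i j s c d)"
proof (rule pred_cong)
  fix x assume x: "x \<in> space N"
  have 1: "vx c x \<subseteq> Hv x" "vx d x \<subseteq> Hv x" "sh (f i) (f j) t x \<in> Hv x" for t
    using ori_halves[OF x sel_id] shalf_halves[OF x sel_fx sel_fx] by blast+
  have "sym_diff (vx c x) (vx d x) = {sh (f i) (f j) s x, sh (f i) (f j) (\<not> s) x} \<longleftrightarrow>
    (\<forall>D\<in>Hv x. ((D \<in> vx c x) \<noteq> (D \<in> vx d x)) = (D = sh (f i) (f j) s x \<or> D = sh (f i) (f j) (\<not> s) x))"
    using 1(1,2) 1(3)[of s] 1(3)[of "\<not> s"] by blast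
  then show "adjp i j s c d x \<longleftrightarrow> vx c x \<in> Ov x \<and> vx d x \<in> Ov x \<and>
    (\<forall>k l t. ((sh (f k) (f l) t x \<in> vx c x) \<noteq> (sh (f k) (f l) t x \<in> vx d x)) =
      (sh (f k) (f l) t x = sh (f i) (f j) s x \<or> sh (f k) (f l) t x = sh (f i) (f j) (\<not> s) x))"
    unfolding adjp_def neg_sh[OF x] Ball_halves[OF x] by simp
next
  have [measurable]: "Measurable.pred N (\<lambda>x. vx c x \<in> Ov x)" "Measurable.pred N (\<lambda>x. vx d x \<in> Ov x)"
    "Measurable.pred N (\<lambda>x. sh (f k) (f l) t x \<in> vx c x)" "Measurable.pred N (\<lambda>x. sh (f k) (f l) t x \<in> vx d x)"
    "Measurable.pred N (\<lambda>x. sh (f k) (f l) t x = sh (f i) (f j) t' x)" for k l t t'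
    using pred_valid pred_ori pred_shalf_eq sel_fx sel_id by blast+
  show "Measurable.pred N (\<lambda>x. vx c x \<in> Ov x \<and> vx d x \<in> Ov x \<and>
    (\<forall>k l t. ((sh (f k) (f l) t x \<in> vx c x) \<noteq> (sh (f k) (f l) t x \<in> vx d x)) =
      (sh (f k) (f l) t x = sh (f i) (f j) s x \<or> sh (f k) (f l) t x = sh (f i) (f j) (\<not> s) x)))"
    by measurable
qed

definition simil :: "nat \<Rightarrow> nat \<Rightarrow> bool \<Rightarrow> (nat \<times> nat) list \<Rightarrow> (nat \<times> nat) list \<Rightarrow> 'a \<Rightarrow> bool" where
  "simil i j s c d x \<longleftrightarrow> (\<forall>D\<in>Hv x. col x (sh (f i) (f j) s x) \<le> col x D \<longrightarrow>
     D \<notin> {sh (f i) (f j) s x, Cm x - sh (f i) (f j) s x} \<longrightarrow> (D \<in> vx c x \<longleftrightarrow> D \<in> vx d x))"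

lemma pred_simil: "Measurable.pred N (simil i j s c d)"
proof (rule pred_cong)
  fix x assume x: "x \<in> space N"
  show "simil i j s c d x \<longleftrightarrow>
    (\<forall>k l t. (\<exists>m n. col x (sh (f i) (f j) s x) = m \<and> col x (sh (f k) (f l) t x) = n \<and> m \<le> n) \<longrightarrow>
      \<not> (sh (f k) (f l) t x = sh (f i) (f j) s x \<or> sh (f k) (f l) t x = sh (f i) (f j) (\<not> s) x) \<longrightarrow>
      (sh (f k) (f l) t x \<in> vx c x) = (sh (f k) (f l) t x \<in> vx d x))"
  proof -
    define P where "P D \<longleftrightarrow> (col x (sh (f i) (f j) s x) \<le> col x D \<longrightarrow>
      D \<notin> {sh (f i) (f j) s x, sh (f i) (f j) (\<not> s) x} \<longrightarrow> (D \<in> vx c x \<longleftrightarrow> D \<in> vx d x))" for D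
    have 1: "simil i j s c d x \<longleftrightarrow> (\<forall>D\<in>Hv x. P D)" unfolding simil_def P_def neg_sh[OF x] ..
    have 2: "(\<forall>D\<in>Hv x. P D) \<longleftrightarrow> (\<forall>k l t. P (sh (f k) (f l) t x))" by (rule Ball_halves[OF x])
    have 3: "P D \<longleftrightarrow> (\<exists>m n. col x (sh (f i) (f j) s x) = m \<and> col x D = n \<and> m \<le> n) \<longrightarrow>
      \<not> (D = sh (f i) (f j) s x \<or> D = sh (f i) (f j) (\<not> s) x) \<longrightarrow> (D \<in> vx c x) = (D \<in> vx d x)" for D
      unfolding P_def by blast
    show ?thesis unfolding 1 2 3 ..
  qed
next
  have [measurable]: "Measurable.pred N (\<lambda>x. sh (f k) (f l) t x \<in> vx c x)" for k l t c
    by (rule pred_ori[OF sel_fx sel_fx sel_id])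
  have [measurable]: "Measurable.pred N (\<lambda>x. sh (f k) (f l) t x = sh (f i) (f j) t' x)" for k l t t'
    by (rule pred_shalf_eq[OF sel_fx sel_fx sel_fx sel_fx])
  have [measurable]: "Measurable.pred N (\<lambda>x. col x (sh (f k) (f l) t x) = n)" for k l t n
    by (rule pred_colour[OF sel_fx sel_fx])
  show "Measurable.pred N (\<lambda>x.
    (\<forall>k l t. (\<exists>m n. col x (sh (f i) (f j) s x) = m \<and> col x (sh (f k) (f l) t x) = n \<and> m \<le> n) \<longrightarrow>
      \<not> (sh (f k) (f l) t x = sh (f i) (f j) s x \<or> sh (f k) (f l) t x = sh (f i) (f j) (\<not> s) x) \<longrightarrow>
      (sh (f k) (f l) t x \<in> vx c x) = (sh (f k) (f l) t x \<in> vx d x)))"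
    by measurable
qed

text \<open>\<open>x\<close> enters only through its component, so all base points of a component
  give the same tree.\<close>

definition tr :: "'a \<Rightarrow> ('a set set \<times> 'a set set) set" where
  "tr x = coloured_cube.tree (Ov x) (Hv x) (\<lambda>A. Cm x - A) (col x) (wkey x)"

lemma vx_surj:
  assumes x: "x \<in> space N" and u: "u \<in> Ov x"
  shows "\<exists>c. u = vx c x"
  using connected_component.orient_surj[where f = f, OF connected_component[OF N_space[OF x]] u component_self range_f[OF x]]
  unfolding ori_def by metis

lemma tr_V: "x \<in> space N \<Longrightarrow> tr x \<subseteq> Ov x \<times> Ov x"
proof -
  assume x: "x \<in> space N"
  interpret walled_component "Cm x" G R kap f "base_less B" using walled[OF x] .
  show ?thesis unfolding tr_def by (rule cube.tree_V)
qed

text \<open>Quantifiers over orientations become quantifiers over codes, as every orientation has a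
  code relative to \<open>x\<close>. The keys are named by numbers so that they occur only inside
  \<open>keyp\<close>.\<close>

lemma tr_code:
  assumes x: "x \<in> space N"
  shows "(vx c x, vx d x) \<in> tr x \<longleftrightarrow> (\<exists>i j s. adjp i j s c d x \<and> (\<forall>c' d'. adjp i j s c' d' x \<longrightarrow>
    simil i j s c c' x \<longrightarrow> (\<exists>n1 n2 m. keyp i j s c n1 x \<and> keyp i j s d n2 x \<and> keyp i j s c' m x \<and> min n1 n2 \<le> m)))"
proof -
  interpret walled_component "Cm x" G R kap f "base_less B" using walled[OF x] .
  define P where "P A \<longleftrightarrow> cube.adj A (vx c x) (vx d x) \<and> (\<forall>w w'. cube.adj A w w' \<longrightarrow> cube.sim A (vx c x) w \<longrightarrow>
      min (wkey x A (vx c x)) (wkey x A (vx d x)) \<le> wkey x A w)" for A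
  define Q where "Q i j s \<longleftrightarrow> adjp i j s c d x \<and> (\<forall>c' d'. adjp i j s c' d' x \<longrightarrow>
    simil i j s c c' x \<longrightarrow> (\<exists>n1 n2 m. keyp i j s c n1 x \<and> keyp i j s d n2 x \<and> keyp i j s c' m x \<and> min n1 n2 \<le> m))"
    for i j s
  have "P (sh (f i) (f j) s x) \<longleftrightarrow> Q i j s" for i j s
  proof -
    define A where "A = sh (f i) (f j) s x"
    have adj: "adjp i j s c d x \<longleftrightarrow> cube.adj A (vx c x) (vx d x)" for c d
      unfolding adjp_def cube.adj_def A_def ..
    have sim: "simil i j s c d x \<longleftrightarrow> cube.sim A (vx c x) (vx d x)" for c d
      unfolding simil_def cube.sim_def A_def ..
    have keyp: "keyp i j s c n x \<longleftrightarrow> vx c x \<in> Ov x \<and> wkey x A (vx c x) = n" for c n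
      unfolding keyp_def A_def ..
    have adj_V1: "u \<in> Ov x" if "cube.adj A u v" for u v
      using that unfolding cube.adj_def by (rule conjunct1)
    have adj_V2: "v \<in> Ov x" if "cube.adj A u v" for u v
      using that unfolding cube.adj_def by (rule conjunct2[THEN conjunct1])
    note adj_V = adj_V1 adj_V2
    show ?thesis
      unfolding A_def[symmetric]
    proof
      assume "P A"
      then have cd: "cube.adj A (vx c x) (vx d x)" and min: "\<And>w w'. cube.adj A w w' \<Longrightarrow>
          cube.sim A (vx c x) w \<Longrightarrow> min (wkey x A (vx c x)) (wkey x A (vx d x)) \<le> wkey x A w"
        unfolding P_def by blast+
      show "Q i j s"
        unfolding Q_def adj sim keyp
      proof (intro conjI allI impI)
        show "cube.adj A (vx c x) (vx d x)" by (rule cd)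
        fix c' d' assume "cube.adj A (vx c' x) (vx d' x)" "cube.sim A (vx c x) (vx c' x)"
        then have "min (wkey x A (vx c x)) (wkey x A (vx d x)) \<le> wkey x A (vx c' x)" "vx c' x \<in> Ov x"
          using min adj_V by blast+
        then show "\<exists>n1 n2 m. (vx c x \<in> Ov x \<and> wkey x A (vx c x) = n1) \<and> (vx d x \<in> Ov x \<and> wkey x A (vx d x) = n2) \<and>
            (vx c' x \<in> Ov x \<and> wkey x A (vx c' x) = m) \<and> min n1 n2 \<le> m"
          using adj_V[OF cd] by blast
      qed
    next
      assume "Q i j s"
      then have cd: "cube.adj A (vx c x) (vx d x)" and min: "\<And>c' d'. cube.adj A (vx c' x) (vx d' x) \<Longrightarrow>
          cube.sim A (vx c x) (vx c' x) \<Longrightarrow> min (wkey x A (vx c x)) (wkey x A (vx d x)) \<le> wkey x A (vx c' x)"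
        unfolding Q_def adj sim keyp by blast+
      show "P A"
        unfolding P_def
      proof (intro conjI allI impI)
        show "cube.adj A (vx c x) (vx d x)" by (rule cd)
        fix w w' assume w: "cube.adj A w w'" "cube.sim A (vx c x) w"
        obtain c' where c': "w = vx c' x" using vx_surj[OF x adj_V(1)[OF w(1)]] ..
        obtain d' where d': "w' = vx d' x" using vx_surj[OF x adj_V(2)[OF w(1)]] ..
        show "min (wkey x A (vx c x)) (wkey x A (vx d x)) \<le> wkey x A w"
          using min[of c' d'] w unfolding c' d' .
      qed
    qed
  qed
  note PQ = this
  have "(vx c x, vx d x) \<in> tr x \<longleftrightarrow> (\<exists>A\<in>Hv x. P A)"
    unfolding tr_def cube.tree_def P_def by simp
  then show ?thesis unfolding Bex_halves[OF x] PQ Q_def .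
qed

lemma pred_tr: "Measurable.pred N (\<lambda>x. (vx c x, vx d x) \<in> tr x)"
proof (rule pred_cong[OF tr_code])
  have [measurable]: "Measurable.pred N (adjp i j s c d)" "Measurable.pred N (simil i j s c d)"
    "Measurable.pred N (keyp i j s c n)" for i j s c d n
    by (fact pred_adjp pred_simil pred_keyp)+
  show "Measurable.pred N (\<lambda>x. \<exists>i j s. adjp i j s c d x \<and> (\<forall>c' d'. adjp i j s c' d' x \<longrightarrow>
    simil i j s c c' x \<longrightarrow> (\<exists>n1 n2 m. keyp i j s c n1 x \<and> keyp i j s d n2 x \<and> keyp i j s c' m x \<and> min n1 n2 \<le> m)))"
    by measurable
qed

lemma pred_tr_relpow: "Measurable.pred N (\<lambda>x. (vx c x, vx d x) \<in> tr x ^^ n)"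
proof (induction n arbitrary: d)
  case 0
  then show ?case using pred_ori_eq[OF sel_id sel_id] by simp
next
  case (Suc n)
  show ?case
  proof (rule pred_cong)
    fix x assume x: "x \<in> space N"
    show "(vx c x, vx d x) \<in> tr x ^^ Suc n \<longleftrightarrow> (\<exists>e. (vx c x, vx e x) \<in> tr x ^^ n \<and> (vx e x, vx d x) \<in> tr x)"
    proof
      assume "(vx c x, vx d x) \<in> tr x ^^ Suc n"
      then obtain u where u: "(vx c x, u) \<in> tr x ^^ n" "(u, vx d x) \<in> tr x" by auto
      then obtain e where "u = vx e x" using tr_V[OF x] vx_surj[OF x] by blast
      then show "\<exists>e. (vx c x, vx e x) \<in> tr x ^^ n \<and> (vx e x, vx d x) \<in> tr x" using u by blast
    qed auto
  next
    have [measurable]: "Measurable.pred N (\<lambda>x. (vx c x, vx e x) \<in> tr x ^^ n)"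
      "Measurable.pred N (\<lambda>x. (vx e x, vx d x) \<in> tr x)" for e
      by (fact Suc.IH pred_tr)+
    show "Measurable.pred N (\<lambda>x. \<exists>e. (vx c x, vx e x) \<in> tr x ^^ n \<and> (vx e x, vx d x) \<in> tr x)"
      by measurable
  qed
qed

text \<open>\<open>towards\<close> at \<open>a x\<close> has the empty code relative to
  \<open>a x\<close>, whereas tree paths are known to be Borel for codes relative to
  \<open>x\<close>; hence the search for a code \<open>d\<close> of the same orientation.\<close>

lemma pred_tr_point:
  assumes a: "sel a"
  shows "Measurable.pred N (\<lambda>x. (vx c x, towards (Cm x) G R (a x)) \<in> tr x ^^ n)"
proof (rule pred_cong)
  fix x assume x: "x \<in> space N"
  interpret walled_component "Cm x" G R kap f "base_less B" using walled[OF x] .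
  have e: "ori R a [] x = towards (Cm x) G R (a x)"
    by (simp add: ori_def orient_def pairs_def)
  have "towards (Cm x) G R (a x) \<in> Ov x" by (rule towards_orientation[OF selD[OF a x]])
  then obtain d where d: "towards (Cm x) G R (a x) = vx d x" using vx_surj[OF x] by blast
  show "(vx c x, towards (Cm x) G R (a x)) \<in> tr x ^^ n \<longleftrightarrow>
      (\<exists>d. vx d x = ori R a [] x \<and> (vx c x, vx d x) \<in> tr x ^^ n)"
    unfolding e using d by metis
next
  have [measurable]: "Measurable.pred N (\<lambda>x. (vx c x, vx d x) \<in> tr x ^^ n)"
    "Measurable.pred N (\<lambda>x. vx d x = ori R a [] x)" for d
    by (rule pred_tr_relpow, rule pred_ori_eq[OF sel_id a])
  show "Measurable.pred N (\<lambda>x. \<exists>d. vx d x = ori R a [] x \<and> (vx c x, vx d x) \<in> tr x ^^ n)"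
    by measurable
qed

section \<open>Voronoi cells in terms of codes\<close>

definition nearp :: "nat \<Rightarrow> (nat \<times> nat) list \<Rightarrow> ('a \<Rightarrow> 'a) \<Rightarrow> 'a \<Rightarrow> bool" where
  "nearp n c a x \<longleftrightarrow> (vx c x, towards (Cm x) G R (a x)) \<in> tr x ^^ n \<and>
     (\<forall>i. \<forall>m<n. (vx c x, towards (Cm x) G R (f i x)) \<notin> tr x ^^ m)"

definition cellp :: "(nat \<times> nat) list \<Rightarrow> ('a \<Rightarrow> 'a) \<Rightarrow> 'a \<Rightarrow> bool" where
  "cellp c a x \<longleftrightarrow> (\<exists>n. nearp n c a x \<and> (\<forall>i. nearp n c (f i) x \<longrightarrow> \<not> base_less B (f i x) (a x)))"

lemma pred_nearp:
  assumes "sel a"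
  shows "Measurable.pred N (nearp n c a)"
proof -
  have [measurable]: "Measurable.pred N (\<lambda>x. (vx c x, towards (Cm x) G R (a x)) \<in> tr x ^^ n)"
    "Measurable.pred N (\<lambda>x. (vx c x, towards (Cm x) G R (f i x)) \<in> tr x ^^ m)" for i m
    by (rule pred_tr_point[OF assms], rule pred_tr_point[OF sel_fx])
  show ?thesis unfolding nearp_def[abs_def] by measurable
qed

lemma pred_cellp:
  assumes "sel a"
  shows "Measurable.pred N (cellp c a)"
proof -
  have [measurable]: "Measurable.pred N (nearp n c a)" "Measurable.pred N (nearp n c (f i))"
    "Measurable.pred N (\<lambda>x. base_less B (f i x) (a x))" for n i
    by (rule pred_nearp[OF assms], rule pred_nearp[OF sel_fx], rule pred_less[OF sel_fx assms])
  show ?thesis unfolding cellp_def[abs_def] by measurable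
qed

definition treeing :: "'a \<Rightarrow> ('a \<times> 'a) set" where
  "treeing x = voronoi.contraction (tr x) (Cm x) (towards (Cm x) G R) (base_less B)"

lemma treeing:
  assumes x: "x \<in> space N"
  shows "treeing x \<subseteq> Cm x \<times> Cm x" "sym (treeing x)" "irrefl (treeing x)" "bridges (treeing x)"
    "y \<in> Cm x \<Longrightarrow> z \<in> Cm x \<Longrightarrow> (y, z) \<in> (treeing x)\<^sup>*"
proof -
  interpret walled_component "Cm x" G R kap f "base_less B" using walled[OF x] .
  show "treeing x \<subseteq> Cm x \<times> Cm x" unfolding treeing_def tr_def by (rule cells.contraction_X)
  show "sym (treeing x)" unfolding treeing_def tr_def by (rule cells.contraction_sym)
  show "irrefl (treeing x)" unfolding treeing_def tr_def by (rule cells.contraction_irrefl)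
  show "bridges (treeing x)" unfolding treeing_def tr_def by (rule cells.contraction_bridges)
  show "y \<in> Cm x \<Longrightarrow> z \<in> Cm x \<Longrightarrow> (y, z) \<in> (treeing x)\<^sup>*"
    unfolding treeing_def tr_def by (rule cells.contraction_connected)
qed

lemma pred_treeing:
  assumes a: "sel a" and b: "sel b"
  shows "Measurable.pred N (\<lambda>x. (a x, b x) \<in> treeing x)"
proof (rule pred_cong)
  fix x assume x: "x \<in> space N"
  interpret walled_component "Cm x" G R kap f "base_less B" using walled[OF x] .
  have near: "cells.near n (vx c x) (g x) \<longleftrightarrow> nearp n c g x" if "sel g" for n c g
    unfolding cells.near_def nearp_def unfolding tr_def[symmetric] Ball_component[OF x]
    using selD[OF that x] by blast
  have near_C: "cells.near n u y \<Longrightarrow> y \<in> Cm x" for n u y by (simp add: cells.near_def)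
  have cell: "cells.cell (vx c x) (g x) \<longleftrightarrow> cellp c g x" if g: "sel g" for c g
  proof -
    have "(\<forall>y. cells.near n (vx c x) y \<longrightarrow> \<not> base_less B y (g x)) \<longleftrightarrow>
        (\<forall>y\<in>Cm x. cells.near n (vx c x) y \<longrightarrow> \<not> base_less B y (g x))" for n
      using near_C by blast
    then show ?thesis
      unfolding cells.cell_def cellp_def Ball_component[OF x] near[OF g] near[OF sel_fx] by (simp only:)
  qed
  have "(a x, b x) \<in> treeing x \<longleftrightarrow> a x \<noteq> b x \<and>
      (\<exists>u v. (u, v) \<in> tr x \<and> cells.cell u (a x) \<and> cells.cell v (b x))"
    unfolding treeing_def tr_def cells.contraction_def by simp
  also have "\<dots> \<longleftrightarrow> a x \<noteq> b x \<and>
      (\<exists>c d. (vx c x, vx d x) \<in> tr x \<and> cells.cell (vx c x) (a x) \<and> cells.cell (vx d x) (b x))"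
  proof -
    have "\<exists>c d. u = vx c x \<and> v = vx d x" if "(u, v) \<in> tr x" for u v
      using tr_V[OF x] vx_surj[OF x] that by blast
    then show ?thesis by blast
  qed
  finally show "(a x, b x) \<in> treeing x \<longleftrightarrow> a x \<noteq> b x \<and>
      (\<exists>c d. (vx c x, vx d x) \<in> tr x \<and> cellp c a x \<and> cellp d b x)"
    unfolding cell[OF a] cell[OF b] .
next
  have [measurable]: "Measurable.pred N (\<lambda>x. a x = b x)" "Measurable.pred N (\<lambda>x. (vx c x, vx d x) \<in> tr x)"
    "Measurable.pred N (cellp c a)" "Measurable.pred N (cellp d b)" for c d
    by (rule pred_eq[OF a b], rule pred_tr, rule pred_cellp[OF a], rule pred_cellp[OF b])
  show "Measurable.pred N (\<lambda>x. a x \<noteq> b x \<and> (\<exists>c d. (vx c x, vx d x) \<in> tr x \<and> cellp c a x \<and> cellp d b x))"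
    by measurable
qed

end

section \<open>Treeability\<close>

text \<open>Since no radius need serve all components, treeings are built on the sets
  \<open>X n\<close> of points with least radius \<open>n\<close> and then united. Each
  \<open>X n\<close> is a union of components, so edges never join different pieces.\<close>

theorem theorem1p1:
  fixes M :: "'a measure" and E G :: "('a \<times> 'a) set"
  assumes "standard_borel M"
    and "cber M E"
    and "borel_graphing M E G"
    and "locally_finite (space M) G"
    and "\<And>x. x \<in> space M \<Longrightarrow>
           quasi_tree TYPE('b) (component G x) (induced_graph G (component G x))"
  shows "borel_treeable M E"
proof -
  have G: "graph_on (space M) G" "G \<in> sets (M \<Otimes>\<^sub>M M)" "G\<^sup>* \<inter> space M \<times> space M = E"
    using assms(3) by (auto simp: borel_graphing_def)
  obtain B where B: "separating_base M B" using standard_borel_separating_base[OF assms(1)] .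
  have "\<exists>f :: nat \<Rightarrow> 'a \<Rightarrow> 'a. (\<forall>i. f i \<in> M \<rightarrow>\<^sub>M M) \<and> (\<forall>x\<in>space M. component G x = range (\<lambda>i. f i x))"
  proof (rule locally_finite_enumeration[OF assms(1) B G(2) assms(4)])
    fix f :: "nat \<Rightarrow> 'a \<Rightarrow> 'a"
    assume f: "\<And>i. f i \<in> M \<rightarrow>\<^sub>M M" "\<And>x. x \<in> space M \<Longrightarrow> component G x = range (\<lambda>i. f i x)"
    show "\<exists>f :: nat \<Rightarrow> 'a \<Rightarrow> 'a. (\<forall>i. f i \<in> M \<rightarrow>\<^sub>M M) \<and> (\<forall>x\<in>space M. component G x = range (\<lambda>i. f i x))"
      by (rule exI[of _ f]) (intro conjI allI ballI f)
  qed
  then obtain f :: "nat \<Rightarrow> 'a \<Rightarrow> 'a" where "(\<forall>i. f i \<in> M \<rightarrow>\<^sub>M M) \<and> (\<forall>x\<in>space M. component G x = range (\<lambda>i. f i x))" ..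
  then have f: "\<And>i. f i \<in> M \<rightarrow>\<^sub>M M" "\<And>x. x \<in> space M \<Longrightarrow> component G x = range (\<lambda>i. f i x)"
    by simp_all
  have bg: "borel_graph M G B f N" if "(\<lambda>x. x) \<in> N \<rightarrow>\<^sub>M M" for N
    by (rule borel_graph.intro) (use B G assms(4) f that in auto)
  interpret main: borel_graph M G B f M by (rule bg) simp
  define Rad where "Rad x = (LEAST R. wide (component G x) G R)" for x
  have wide_ex: "\<exists>R. wide (component G x) G R" if "x \<in> space M" for x
    using connected_component.quasi_tree_wide[OF main.connected_component assms(5)] that by blast
  define X where "X n = {x \<in> space M. Rad x = n}" for n
  have X [measurable]: "X n \<in> sets M" for n
  proof -
    have [measurable]: "Measurable.pred M (\<lambda>x. wide (component G x) G R)" for R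
      by (rule main.pred_wide)
    have "X n = {x \<in> space M. wide (component G x) G n \<and> (\<forall>m<n. \<not> wide (component G x) G m)}"
      unfolding X_def Rad_def using Least_eq_iff[OF wide_ex] by blast
    also have "\<dots> \<in> sets M" by measurable
    finally show ?thesis .
  qed
  have space_X: "space (restrict_space M (X n)) = X n" for n
    by (auto simp: space_restrict_space X_def)
  have wg: "wide_graph M G B f (restrict_space M (X n)) n" for n
  proof (intro wide_graph.intro wide_graph_axioms.intro)
    show "borel_graph M G B f (restrict_space M (X n))"
      by (rule bg) (rule measurable_restrict_space1[OF measurable_ident_sets[OF refl]])
    fix x assume "x \<in> space (restrict_space M (X n))"
    then have "x \<in> X n" unfolding space_X .
    then have x: "x \<in> space M" "Rad x = n" by (simp_all add: X_def)
    show "wide (component G x) G n"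
      using LeastI_ex[OF wide_ex[OF x(1)]] unfolding x(2)[symmetric] Rad_def .
  qed
  define tt where "tt n x = wide_graph.treeing G B f n x" for n x
  define T where "T = {(x, y). x \<in> space M \<and> (x, y) \<in> tt (Rad x) x}"
  \<comment> \<open>The treeing is built from the component without reference to a base point; this
    lets the relations \<open>tt (Rad x) x\<close> fit together into one \<open>T\<close>.\<close>
  have inv: "component G y = component G x" "Rad y = Rad x" "tt n y = tt n x"
    if "y \<in> component G x" for x y n
  proof -
    show eq: "component G y = component G x" using that by (rule main.component_eq)
    show "Rad y = Rad x" unfolding Rad_def eq ..
    show "tt n y = tt n x"
      unfolding tt_def wide_graph.treeing_def[OF wg] wide_graph.tr_def[OF wg] eq ..
  qed
  have tt: "tt (Rad x) x \<subseteq> component G x \<times> component G x" "sym (tt (Rad x) x)" "irrefl (tt (Rad x) x)"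
    "bridges (tt (Rad x) x)" "y \<in> component G x \<Longrightarrow> z \<in> component G x \<Longrightarrow> (y, z) \<in> (tt (Rad x) x)\<^sup>*"
    if "x \<in> space M" for x y z
  proof -
    have x: "x \<in> space (restrict_space M (X (Rad x)))" unfolding space_X using that by (simp add: X_def)
    note wide_graph.treeing[OF wg x]
    then show "tt (Rad x) x \<subseteq> component G x \<times> component G x" "sym (tt (Rad x) x)" "irrefl (tt (Rad x) x)"
      "bridges (tt (Rad x) x)" "y \<in> component G x \<Longrightarrow> z \<in> component G x \<Longrightarrow> (y, z) \<in> (tt (Rad x) x)\<^sup>*"
      unfolding tt_def by blast+
  qed
  have T_iff: "(a, b) \<in> T \<longleftrightarrow> (a, b) \<in> tt (Rad x) x" if x: "x \<in> space M" and a: "a \<in> component G x" for x a b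
  proof -
    have "a \<in> space M" using main.component_space[OF x] a by blast
    then show ?thesis unfolding T_def using inv(2,3)[OF a] by simp
  qed
  have T_component: "b \<in> component G a" "a \<in> space M" if "(a, b) \<in> T" for a b
  proof -
    show a: "a \<in> space M" using that by (auto simp: T_def)
    show "b \<in> component G a" using that tt(1)[OF a] by (auto simp: T_def)
  qed
  have T_sub: "T \<subseteq> space M \<times> space M"
  proof (rule subrelI)
    fix a b assume "(a, b) \<in> T"
    then show "(a, b) \<in> space M \<times> space M"
      using T_component[of a b] main.component_space[of a] by blast
  qed
  have "sym T"
  proof (rule symI)
    fix a b assume ab: "(a, b) \<in> T"
    note ba = T_component[OF ab]
    have "(a, b) \<in> tt (Rad a) a" using ab by (simp add: T_def)
    then have "(b, a) \<in> tt (Rad a) a" using tt(2)[OF ba(2)] by (auto dest: symD)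
    then show "(b, a) \<in> T" using T_iff[OF ba(2,1)] by blast
  qed
  moreover have "irrefl T" using tt(3) by (auto simp: irrefl_def T_def)
  ultimately have graph: "graph_on (space M) T" using T_sub by (simp add: graph_on_def)
  have meas: "T \<in> sets (M \<Otimes>\<^sub>M M)"
  proof -
    have A: "{x \<in> X n. (x, f i x) \<in> tt n x} \<in> sets M" for n i
    proof -
      interpret wide_graph M G B f "restrict_space M (X n)" n by (rule wg)
      have "Measurable.pred (restrict_space M (X n)) (\<lambda>x. (x, f i x) \<in> tt n x)"
        unfolding tt_def by (rule pred_treeing[OF sel_id sel_fx])
      then have "{x \<in> X n. (x, f i x) \<in> tt n x} \<in> sets (restrict_space M (X n))"
        unfolding pred_def space_X .
      then show ?thesis using X by (subst (asm) sets_restrict_space_iff) auto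
    qed
    have [measurable]: "B k \<in> sets M" "f i \<in> M \<rightarrow>\<^sub>M M" for k i
      using separating_baseD(1)[OF B] f(1) by blast+
    \<comment> \<open>Equality of \<open>f i (fst z)\<close> and \<open>snd z\<close> is tested on
      the base sets, which makes the graph of \<open>f i\<close> Borel in the product.\<close>
    have D: "{z \<in> space (M \<Otimes>\<^sub>M M). fst z \<in> {x \<in> X n. (x, f i x) \<in> tt n x} \<and>
        (\<forall>k. f i (fst z) \<in> B k \<longleftrightarrow> snd z \<in> B k)} \<in> sets (M \<Otimes>\<^sub>M M)" (is "?D n i \<in> _") for n i
      using A[of n i] by measurable
    have "T = (\<Union>n. \<Union>i. ?D n i)"
    proof (intro equalityI subsetI)
      fix z assume "z \<in> T"
      then obtain x y where z: "z = (x, y)" and xy: "(x, y) \<in> T" by (cases z) auto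
      note yx = T_component[OF xy]
      obtain i where i: "y = f i x" using yx f(2) by blast
      have "z \<in> ?D (Rad x) i"
        using xy T_sub i unfolding z T_def X_def by (auto simp: space_pair_measure)
      then show "z \<in> (\<Union>n. \<Union>i. ?D n i)" by blast
    next
      fix z assume "z \<in> (\<Union>n. \<Union>i. ?D n i)"
      then obtain n i where "z \<in> ?D n i" by blast
      moreover obtain x y where z: "z = (x, y)" by (cases z)
      ultimately have xy: "x \<in> X n" "(x, f i x) \<in> tt n x" "x \<in> space M" "y \<in> space M"
        and same: "\<And>k. f i x \<in> B k \<longleftrightarrow> y \<in> B k"
        by (auto simp: space_pair_measure)
      have "f i x \<in> space M" using measurable_space[OF f(1) xy(3)] .
      then have "f i x = y" using separating_baseD(2)[OF B, of "{y}" "f i x"] same by auto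
      then show "z \<in> T" using xy unfolding z T_def X_def by simp
    qed
    also have "\<dots> \<in> sets (M \<Otimes>\<^sub>M M)" by (intro sets.countable_UN'' D) auto
    finally show ?thesis .
  qed
  have "T\<^sup>* \<inter> space M \<times> space M = G\<^sup>* \<inter> space M \<times> space M"
  proof -
    have "T \<subseteq> G\<^sup>*" using T_component(1) by (auto simp: component_def)
    then have "T\<^sup>* \<subseteq> G\<^sup>*" by (rule rtrancl_subset_rtrancl)
    moreover have "(x, y) \<in> T\<^sup>*" if x: "x \<in> space M" and xy: "(x, y) \<in> G\<^sup>*" for x y
    proof -
      have "(x, y) \<in> (tt (Rad x) x)\<^sup>*"
        using tt(5)[OF x] xy by (auto simp: component_def)
      moreover have "tt (Rad x) x \<subseteq> T"
      proof (rule subrelI)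
        fix a b assume "(a, b) \<in> tt (Rad x) x"
        then show "(a, b) \<in> T" using T_iff[OF x, of a b] tt(1)[OF x] by blast
      qed
      ultimately show ?thesis using rtrancl_mono by blast
    qed
    ultimately show ?thesis by blast
  qed
  then have "borel_graphing M E T" using graph meas G(3) by (simp add: borel_graphing_def)
  moreover have "acyclic_graph T"
  proof (rule bridges_acyclic_graph[OF _ \<open>sym T\<close>])
    show "bridges T"
      unfolding bridges_def
    proof (intro allI impI notI)
      fix x y assume xy: "(x, y) \<in> T" "(y, x) \<in> (T - {(x, y), (y, x)})\<^sup>*"
      note yx = T_component[OF xy(1)]
      \<comment> \<open>A detour in \<open>T\<close> never leaves the component of \<open>x\<close>,
        so it is a detour in the single tree \<open>tt (Rad x) x\<close>.\<close>
      have "z \<in> component G x \<and> (y, z) \<in> (tt (Rad x) x - {(x, y), (y, x)})\<^sup>*"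
        if "(y, z) \<in> (T - {(x, y), (y, x)})\<^sup>*" for z
        using that
      proof (induction rule: rtrancl_induct)
        case (step a b)
        then have "(a, b) \<in> tt (Rad x) x - {(x, y), (y, x)}" using T_iff[OF yx(2)] by blast
        then show ?case using step.IH tt(1)[OF yx(2)] by (auto intro: rtrancl_into_rtrancl)
      qed (use yx in simp)
      then have "(y, x) \<in> (tt (Rad x) x - {(x, y), (y, x)})\<^sup>*" using xy(2) by blast
      moreover have "(x, y) \<in> tt (Rad x) x" using xy(1) by (simp add: T_def)
      ultimately show False using tt(4)[OF yx(2)] unfolding bridges_def by blast
    qed
  qed
  ultimately show ?thesis unfolding borel_treeable_def by blast
qed

end
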